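(* (1) The real vector space $E_{\sqrt2}^+$ has dimension $12$, and for any two points $x_1\neq x_2$ of $\mathbb T^3$ it cannot interpolate arbitrary zero values and trace-free symmetric first jets: there exist $H_1,H_2\in\operatorname{Sym}_0(3)$ for which no $W\in E_{\sqrt2}^+$ satisfies $W(x_\ell)=0$ and $\nabla W(x_\ell)=H_\ell$ for $\ell=1,2$. (2) If $\lambda=\sqrt m$ with $m\in\mathbb N$, $m\ge 1$, then every $W\in E_\lambda^+$ satisfies, for all $x\in\mathbb T^3$, $$W(x+\pi\boldsymbol1)=(-1)^mW(x),\qquad\nabla W(x+\pi\boldsymbol1)=(-1)^m\nabla W(x),\qquad\boldsymbol1=(1,1,1).$$ Thus the first jets $(W,\operatorname{sym}\nabla W)$ at the pair $x,\ x+\pi\boldsymbol1$ cannot be prescribed independently in $\mathbb R^3\oplus\operatorname{Sym}_0(3)$; in particular, surjectivity of the two-point jet map on $E_\lambda^+$ fails at such pairs. (3) If an unforced Euler ($\nu=0$) or Navier--Stokes ($\nu>0$) solution $u$ on $\mathbb T^3$ satisfies $u(t)\in E_\lambda^+$ for all $t$, with one fixed $\lambda>0$, then $$u(t)=u(0)\quad(\nu=0),\qquad u(t)=e^{-\nu\lambda^2t}u(0)\quad(\nu>0).$$ Consequently, at a zero $x_0$ of $u(0)$, the deformation gradients $\nabla_aX(x_0,t)$, $t\ge0$, all lie in a one-parameter matrix subgroup $\{\exp(sM):s\in\mathbb R\}$, so that, for two distinct positive times $t_1,t_2$, arbitrary pairs of symmetric positive-definite determinant-one targets $F_1,F_2$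 cannot be realized as $\nabla_aX(x_0,t_1)=F_1$, $\nabla_aX(x_0,t_2)=F_2$ by such solutions at such zeros.
   Context: $\mathbb T^3=(\mathbb R/2\pi\mathbb Z)^3$; $\operatorname{Sym}_0(3)$ is the space of trace-free real symmetric $3\times3$ matrices; $\operatorname{sym}A=\frac12(A+A^\top)$; $E_\lambda^+=\{W\in C^\omega(\mathbb T^3;\mathbb R^3):\nabla\times W=\lambda W\}$ for $\lambda>0$. The equations are $\partial_tu+u\cdot\nabla u+\nabla p=\nu\Delta u$, $\nabla\cdot u=0$, without force. The Lagrangian flow is $\partial_tX(a,t)=u(X(a,t),t)$, $X(a,0)=a$, with Jacobian matrix $\nabla_aX$. *)

theory Defs
  imports "HOL-Analysis.Analysis" "HOL-Library.Function_Algebras"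
begin

text \<open>The pointwise real vector space structure on functions; it makes \<^const>\<open>subspace\<close> and
  \<^const>\<open>dim\<close> available for spaces of vector fields.\<close>

instantiation "fun" :: (type, real_vector) real_vector
begin

definition scaleR_fun :: "real \<Rightarrow> ('a \<Rightarrow> 'b) \<Rightarrow> 'a \<Rightarrow> 'b"
  where "scaleR_fun c f = (\<lambda>x. c *\<^sub>R f x)"

instance
  by standard (simp_all add: scaleR_fun_def plus_fun_def fun_eq_iff scaleR_add_right scaleR_add_left)

end


section \<open>Fields on the torus\<close>

text \<open>A point of the torus is represented by a point of \<^typ>\<open>real^3\<close>, two of which are the same point
  of the torus iff they differ by an element of the lattice \<open>2\<pi>\<int>\<^sup>3\<close>; a function on the torus is a
  function on \<^typ>\<open>real^3\<close> that is \<open>2\<pi>\<close>-periodic in each coordinate.\<close>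

definition same_torus_point :: "real^3 \<Rightarrow> real^3 \<Rightarrow> bool"
  where "same_torus_point x y \<longleftrightarrow> (\<forall>i. \<exists>k::int. x $ i - y $ i = 2 * pi * of_int k)"

definition periodic :: "(real^3 \<Rightarrow> 'b) \<Rightarrow> bool"
  where "periodic f \<longleftrightarrow> (\<forall>x j. f (x + axis j (2 * pi)) = f x)"

text \<open>Real analyticity in several variables: near every point the function is the sum of an
  (unconditionally convergent) power series, indexed by the multi-indices \<open>\<alpha>\<close>.\<close>

definition real_analytic :: "(real^'n \<Rightarrow> real) \<Rightarrow> bool"
  where "real_analytic f \<longleftrightarrow>
    (\<forall>x. \<exists>r>0. \<exists>c :: ('n \<Rightarrow> nat) \<Rightarrow> real. \<forall>y\<in>ball x r.
       ((\<lambda>\<alpha>. c \<alpha> * (\<Prod>i\<in>UNIV. (y $ i - x $ i) ^ \<alpha> i)) has_sum f y) UNIV)"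

text \<open>Throughout, \<open>\<nabla>W(x)\<close> is \<^term>\<open>jacobian W (at x)\<close>, whose entry in row \<open>i\<close> and column \<open>j\<close> is
  \<open>\<partial>\<^sub>j W\<^sub>i(x)\<close>.\<close>

definition curl :: "(real^3 \<Rightarrow> real^3) \<Rightarrow> real^3 \<Rightarrow> real^3"
  where "curl W x = (let J = jacobian W (at x) in
    vector [J $ 3 $ 2 - J $ 2 $ 3, J $ 1 $ 3 - J $ 3 $ 1, J $ 2 $ 1 - J $ 1 $ 2])"

definition E_plus :: "real \<Rightarrow> (real^3 \<Rightarrow> real^3) set"
  where "E_plus lam = {W. periodic W \<and> (\<forall>i. real_analytic (\<lambda>x. W x $ i)) \<and>
    (\<forall>x. curl W x = lam *\<^sub>R W x)}"


section \<open>Matrices and first jets\<close>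

definition Sym0 :: "(real^3^3) set"
  where "Sym0 = {A. transpose A = A \<and> trace A = 0}"

definition sym_part :: "real^3^3 \<Rightarrow> real^3^3"
  where "sym_part A = (1/2) *\<^sub>R (A + transpose A)"

definition first_jet :: "(real^3 \<Rightarrow> real^3) \<Rightarrow> real^3 \<Rightarrow> (real^3) \<times> (real^3^3)"
  where "first_jet W x = (W x, sym_part (jacobian W (at x)))"

definition two_point_jet ::
    "real^3 \<Rightarrow> real^3 \<Rightarrow> (real^3 \<Rightarrow> real^3) \<Rightarrow> ((real^3) \<times> (real^3^3)) \<times> ((real^3) \<times> (real^3^3))"
  where "two_point_jet x y W = (first_jet W x, first_jet W y)"

definition jet_targets :: "((real^3) \<times> (real^3^3)) set"
  where "jet_targets = UNIV \<times> Sym0"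

definition SPD1 :: "(real^3^3) set"
  where "SPD1 = {F. transpose F = F \<and> (\<forall>v. v \<noteq> 0 \<longrightarrow> 0 < v \<bullet> (F *v v)) \<and> det F = 1}"

text \<open>\<^const>\<open>exp\<close> is not available on \<^typ>\<open>real^3^3\<close>, where \<open>*\<close> and hence \<open>^\<close> act entrywise.\<close>

definition mat_exp :: "real^3^3 \<Rightarrow> real^3^3"
  where "mat_exp A = (\<Sum>n. (1 / fact n) *\<^sub>R (((**) A ^^ n) (mat 1)))"


section \<open>Euler and Navier--Stokes solutions, Lagrangian flow\<close>

definition partial :: "3 \<Rightarrow> (real^3 \<Rightarrow> 'b::real_normed_vector) \<Rightarrow> real^3 \<Rightarrow> 'b"
  where "partial j f x = frechet_derivative f (at x) (axis j 1)"

definition grad :: "(real^3 \<Rightarrow> real) \<Rightarrow> real^3 \<Rightarrow> real^3"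
  where "grad q x = (\<chi> j. partial j q x)"

definition divergence :: "(real^3 \<Rightarrow> real^3) \<Rightarrow> real^3 \<Rightarrow> real"
  where "divergence W x = (\<Sum>j\<in>UNIV. partial j W x $ j)"

definition laplacian :: "(real^3 \<Rightarrow> real^3) \<Rightarrow> real^3 \<Rightarrow> real^3"
  where "laplacian W x = (\<Sum>j\<in>UNIV. partial j (partial j W) x)"

text \<open>Classical unforced solutions on the time interval \<open>[0,\<infinity>)\<close>, for \<open>\<nu> \<ge> 0\<close>; the time derivative at
  \<open>t = 0\<close> is one-sided. Only the derivatives occurring in the equations are required to exist, in
  particular second space derivatives are required only in the viscous case. The matrix-vector
  product is the advection term \<open>(u \<cdot> \<nabla>)u\<close>.\<close>

definition NS_solution :: "real \<Rightarrow> (real \<Rightarrow> real^3 \<Rightarrow> real^3) \<Rightarrow> bool"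
  where "NS_solution \<nu> u \<longleftrightarrow> (\<exists>p :: real \<Rightarrow> real^3 \<Rightarrow> real. \<forall>t\<ge>0.
    periodic (u t) \<and> periodic (p t) \<and>
    (\<forall>x. u t differentiable (at x) \<and>
         (\<nu> \<noteq> 0 \<longrightarrow> (\<forall>j. partial j (u t) differentiable (at x))) \<and>
         p t differentiable (at x) \<and>
         (\<exists>u'. ((\<lambda>s. u s x) has_vector_derivative u') (at t within {0..}) \<and>
               u' + jacobian (u t) (at x) *v u t x + grad (p t) x = \<nu> *\<^sub>R laplacian (u t) x) \<and>
         divergence (u t) x = 0))"

text \<open>The Lagrangian flow is lifted to \<^typ>\<open>real^3\<close>, starting from the identity; \<open>X a t\<close> is the
  position at time \<open>t\<close> of the particle that starts at \<open>a\<close>.\<close>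

definition lagrangian_flow :: "(real \<Rightarrow> real^3 \<Rightarrow> real^3) \<Rightarrow> (real^3 \<Rightarrow> real \<Rightarrow> real^3) \<Rightarrow> bool"
  where "lagrangian_flow u X \<longleftrightarrow> (\<forall>a. X a 0 = a \<and>
    (\<forall>t\<ge>0. ((\<lambda>s. X a s) has_vector_derivative u t (X a t)) (at t within {0..})))"

definition E_plus_solution :: "real \<Rightarrow> real \<Rightarrow> (real \<Rightarrow> real^3 \<Rightarrow> real^3) \<Rightarrow> bool"
  where "E_plus_solution \<nu> lam u \<longleftrightarrow>
    \<nu> \<ge> 0 \<and> lam > 0 \<and> NS_solution \<nu> u \<and> (\<forall>t\<ge>0. u t \<in> E_plus lam)"

end

theory Submission
  imports Defs
begin

text \<open>Integrating by parts on the period cell, the Fourier coefficients of \<open>W \<in> E\<^sub>\<lambda>\<^sup>+\<close> vanish off the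
  finite set of integer vectors \<open>k\<close> with \<open>|k| = \<lambda>\<close>, and at such \<open>k\<close> the sine coefficient is
  \<open>- (k \<times> A) / \<lambda>\<close>, with \<open>A \<bottom> k\<close> the cosine coefficient. By completeness of the trigonometric system,
  \<open>E\<^sub>\<lambda>\<^sup>+\<close> consists of the corresponding finite trigonometric sums, so its dimension is the number of
  these \<open>k\<close>: 12 for \<open>\<lambda> = \<surd>2\<close>, which is less than the dimension 13 of a value and a symmetric
  gradient at one point together with a symmetric gradient at another. For \<open>\<lambda>\<^sup>2 = m\<close> the parity of
  \<open>k\<^sub>1 + k\<^sub>2 + k\<^sub>3\<close> is that of \<open>m\<close>, which gives the half-period symmetry.

  For a solution in \<open>E\<^sub>\<lambda>\<^sup>+\<close> the advection term is the gradient of \<open>|u|\<^sup>2 / 2\<close>, and \<open>\<partial>\<^sub>t u\<close> lies again in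
  the finite-dimensional space \<open>E\<^sub>\<lambda>\<^sup>+\<close>; so the gradient of \<open>p + |u|\<^sup>2 / 2\<close> is an element of \<open>E\<^sub>\<lambda>\<^sup>+\<close>, is
  orthogonal to itself, and vanishes. Hence \<open>\<partial>\<^sub>t u = - \<nu> \<lambda>\<^sup>2 u\<close>, the flow is that of \<open>u(0)\<close> up to a
  change of time, and its linearisation at a zero is the exponential of a multiple of \<open>\<nabla>u(0)\<close>. Such
  exponentials commute, while symmetric positive-definite matrices in general do not.\<close>

section \<open>Real analytic functions\<close>

text \<open>Gradients alone give 5 + 5 = 10 conditions, which 12 parameters could meet. The missing
  3 come from fields in \<open>E_plus (sqrt 2)\<close> with any prescribed value at
  \<open>x1\<close>, whose symmetric gradients the assumed interpolation would correct without
  disturbing that value. Values at both points cannot be added to the count in this way, since they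
  need not be independent: at a half-period shift one determines the other. Regularity shapes the
  evolution part. The time derivative is given at each point separately and the pressure is merely
  differentiable. The former is brought into \<open>E_plus lam\<close> by recovering a field from
  finitely many of its values; then the gradient of \<open>p + |u|^2 / 2\<close> is itself in
  \<open>E_plus lam\<close>, and this supplies the continuity that integration by parts requires.
  The flow is differentiated at the zero by hand: an energy estimate compares each trajectory with
  its linearisation, and a Lipschitz bound on all of space lets it run for every time.\<close>

lemma real_analytic_C1_local:
  fixes f :: "real^'n \<Rightarrow> real" and c :: "('n \<Rightarrow> nat) \<Rightarrow> real"
  assumes r: "r > 0"
    and c: "\<And>y. y \<in> ball x r \<Longrightarrow> ((\<lambda>\<alpha>. c \<alpha> * (\<Prod>i\<in>UNIV. (y $ i - x $ i) ^ \<alpha> i)) has_sum f y) UNIV"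
  obtains \<rho> G where "\<rho> > 0" "\<And>j::'n. continuous_on (ball x \<rho>) (G j)"
    "\<And>y. y \<in> ball x \<rho> \<Longrightarrow> (f has_derivative (\<lambda>h. \<Sum>j\<in>UNIV. h $ j * G j y)) (at y)"
proof -
  \<comment> \<open>Dividing by one more than the dimension keeps the corner \<open>y0\<close>,
    offset by \<rho> in every coordinate, inside the ball: its distance to \<open>x\<close> is at
    most the l1 norm, dimension times \<rho>.\<close>
  define \<rho> where "\<rho> = r / (real CARD('n) + 1)"
  have \<rho>: "\<rho> > 0" using r by (simp add: \<rho>_def)
  have \<rho>r: "real CARD('n) * \<rho> < r" using r by (simp add: \<rho>_def field_simps)
  define y0 where "y0 = x + (\<chi> i. \<rho>)"
  have "dist x y0 \<le> (\<Sum>i\<in>UNIV. \<bar>(x - y0) $ i\<bar>)" unfolding dist_norm by (rule norm_le_l1_cart)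
  also have "\<dots> = real CARD('n) * \<rho>" using \<rho> by (simp add: y0_def)
  finally have y0: "y0 \<in> ball x r" using \<rho>r by simp
  \<comment> \<open>Absolute convergence at the corner \<open>y0\<close> provides the majorant for
    all points with smaller coordinate offsets.\<close>
  define M where "M \<alpha> = \<bar>c \<alpha>\<bar> * (\<Prod>i\<in>UNIV. \<rho> ^ \<alpha> i)" for \<alpha>
  have "(\<lambda>\<alpha>. c \<alpha> * (\<Prod>i\<in>UNIV. \<rho> ^ \<alpha> i)) summable_on UNIV"
    using c[OF y0] unfolding summable_on_def by (auto simp: y0_def)
  then have "(\<lambda>\<alpha>. norm (c \<alpha> * (\<Prod>i\<in>UNIV. \<rho> ^ \<alpha> i))) summable_on UNIV"
    by (rule iffD1[OF summable_on_iff_abs_summable_on_real])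
  also have "(\<lambda>\<alpha>. norm (c \<alpha> * (\<Prod>i\<in>UNIV. \<rho> ^ \<alpha> i))) = M"
    using \<rho> by (auto simp: M_def abs_mult abs_prod power_abs)
  finally have M: "M summable_on UNIV" .
  \<comment> \<open>Convergence is unconditional, so the multi-indices may be enumerated by
    \<open>nat\<close> and the theorems on series of functions apply.\<close>
  have "infinite (UNIV :: ('n \<Rightarrow> nat) set)"
    using finite_fun_UNIVD2 infinite_UNIV_nat by blast
  then obtain e :: "nat \<Rightarrow> ('n \<Rightarrow> nat)" where e: "bij_betw e UNIV UNIV"
    using bij_betw_from_nat_into[of "UNIV :: ('n \<Rightarrow> nat) set"] by auto
  have "(\<lambda>n. M (e n)) summable_on UNIV"
    using M summable_on_reindex_bij_betw[OF e, of M] by simp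
  then have sM: "summable (\<lambda>n. M (e n))" by (rule summable_on_imp_summable)
  define F where "F n y = c (e n) * (\<Prod>i\<in>UNIV. (y $ i - x $ i) ^ e n i)" for n y
  define D where "D n j y = c (e n) * (real (e n j) * (y $ j - x $ j) ^ (e n j - 1) *
     (\<Prod>i\<in>UNIV - {j}. (y $ i - x $ i) ^ e n i))" for n j y
  have fs: "(\<lambda>n. F n y) sums f y" if "y \<in> ball x r" for y
    unfolding F_def using c[OF that] has_sum_reindex_bij_betw[OF e] has_sum_imp_sums by blast
  let ?S = "ball x (\<rho>/2)"
  have Fd: "(F n has_derivative (\<lambda>h. \<Sum>j\<in>UNIV. h $ j * D n j y)) (at y within ?S)" for n y
  proof -
    have "((\<lambda>y. (y $ i - x $ i) ^ e n i) has_derivative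
        (\<lambda>h. real (e n i) * (h $ i - 0) * (y $ i - x $ i) ^ (e n i - 1))) (at y within ?S)" for i
      by (intro has_derivative_power has_derivative_diff has_derivative_const
        bounded_linear.has_derivative[OF bounded_linear_vec_nth] has_derivative_ident)
    then have "((\<lambda>y. \<Prod>i\<in>UNIV. (y $ i - x $ i) ^ e n i) has_derivative
       (\<lambda>h. \<Sum>i\<in>UNIV. (real (e n i) * (h $ i - 0) * (y $ i - x $ i) ^ (e n i - 1)) *
          (\<Prod>j\<in>UNIV - {i}. (y $ j - x $ j) ^ e n j))) (at y within ?S)"
      by (intro has_derivative_prod) auto
    from has_derivative_mult_right[OF this, of "c (e n)"]
    show ?thesis unfolding F_def
      by (rule has_derivative_eq_rhs) (auto simp: D_def sum_distrib_left fun_eq_iff mult_ac intro!: sum.cong)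
  qed
  have Db: "norm (D n j y) \<le> (2 / \<rho>) * M (e n)" if y: "y \<in> ?S" for n j y
  proof -
    have yi: "\<bar>y $ i - x $ i\<bar> \<le> \<rho> / 2" for i
      using y component_le_norm_cart[of "y - x" i] by (simp add: dist_norm norm_minus_commute)
    \<comment> \<open>Halving the radius pays for the factor that differentiation brings down: n <=
      2^n turns n (\<rho>/2)^(n-1) into at most (2/\<rho>) \<rho>^n.\<close>
    have 1: "real (e n j) * \<bar>y $ j - x $ j\<bar> ^ (e n j - 1) \<le> (2 / \<rho>) * \<rho> ^ e n j"
    proof (cases "e n j")
      case 0 then show ?thesis using \<rho> by simp
    next
      case (Suc k)
      have "real (Suc k) * \<bar>y $ j - x $ j\<bar> ^ k \<le> 2 ^ Suc k * (\<rho> / 2) ^ k"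
      proof (intro mult_mono power_mono yi)
        have "Suc k < 2 ^ Suc k" by (rule less_exp)
        then have "real (Suc k) < real (2 ^ Suc k)" by (simp only: of_nat_less_iff)
        then show "real (Suc k) \<le> 2 ^ Suc k" by simp
      qed auto
      also have "\<dots> = (2 / \<rho>) * \<rho> ^ Suc k" using \<rho> by (simp add: power_divide)
      finally show ?thesis using Suc by simp
    qed
    have 2: "(\<Prod>i\<in>UNIV - {j}. \<bar>y $ i - x $ i\<bar> ^ e n i) \<le> (\<Prod>i\<in>UNIV - {j}. \<rho> ^ e n i)"
      using \<rho> by (intro prod_mono conjI power_mono) (auto intro!: order_trans[OF yi])
    have "norm (D n j y) = \<bar>c (e n)\<bar> * ((real (e n j) * \<bar>y $ j - x $ j\<bar> ^ (e n j - 1)) *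
       (\<Prod>i\<in>UNIV - {j}. \<bar>y $ i - x $ i\<bar> ^ e n i))"
      by (simp add: D_def abs_mult abs_prod power_abs)
    also have "\<dots> \<le> \<bar>c (e n)\<bar> * (((2 / \<rho>) * \<rho> ^ e n j) * (\<Prod>i\<in>UNIV - {j}. \<rho> ^ e n i))"
      using \<rho> by (intro mult_left_mono mult_mono 1 2) (auto intro!: prod_nonneg)
    also have "\<dots> = (2 / \<rho>) * M (e n)"
      by (simp add: M_def prod.remove[of UNIV j])
    finally show ?thesis .
  qed
  have sM': "summable (\<lambda>n. (2 / \<rho>) * M (e n))" using sM by (rule summable_mult)
  define G where "G j y = (\<Sum>n. D n j y)" for j y
  have ul: "uniform_limit ?S (\<lambda>n y. \<Sum>i<n. D i j y) (G j) sequentially" for j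
    unfolding G_def by (rule Weierstrass_m_test[OF Db sM'])
  have Gc: "continuous_on ?S (G j)" for j
    by (rule uniform_limit_theorem[OF always_eventually ul])
       (auto simp: D_def intro!: continuous_intros)
  have "\<exists>g. \<forall>y\<in>?S. (\<lambda>n. F n y) sums g y \<and> (g has_derivative (\<lambda>h. \<Sum>j\<in>UNIV. h $ j * G j y)) (at y within ?S)"
  proof (rule has_derivative_series)
    show "convex ?S" by simp
    show "x \<in> ?S" "(\<lambda>n. F n x) sums f x" using \<rho> r fs by auto
    fix \<epsilon> :: real assume \<epsilon>: "\<epsilon> > 0"
    \<comment> \<open>The derivatives must converge uniformly in the direction \<open>h\<close> as
      well; the errors of the finitely many partial derivatives, each below \<delta>, add up to
      \<epsilon> times \<open>norm h\<close>.\<close>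
    define \<delta> where "\<delta> = \<epsilon> / real CARD('n)"
    have \<delta>: "\<delta> > 0" using \<epsilon> by (simp add: \<delta>_def)
    have "\<forall>\<^sub>F n in sequentially. \<forall>j\<in>UNIV. \<forall>y\<in>?S. dist (\<Sum>i<n. D i j y) (G j y) < \<delta>"
      using uniform_limitD[OF ul \<delta>] by (intro eventually_ball_finite) auto
    then show "\<forall>\<^sub>F n in sequentially. \<forall>y\<in>?S. \<forall>h. norm ((\<Sum>i<n. \<Sum>j\<in>UNIV. h $ j * D i j y) - (\<Sum>j\<in>UNIV. h $ j * G j y)) \<le> \<epsilon> * norm h"
    proof (rule eventually_mono, intro ballI allI)
      fix n y and h :: "real^'n"
      assume *: "\<forall>j\<in>UNIV. \<forall>y\<in>?S. dist (\<Sum>i<n. D i j y) (G j y) < \<delta>" and y: "y \<in> ?S"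
      have "(\<Sum>i<n. \<Sum>j\<in>UNIV. h $ j * D i j y) = (\<Sum>j\<in>UNIV. h $ j * (\<Sum>i<n. D i j y))"
        by (subst sum.swap) (simp add: sum_distrib_left)
      then have "norm ((\<Sum>i<n. \<Sum>j\<in>UNIV. h $ j * D i j y) - (\<Sum>j\<in>UNIV. h $ j * G j y))
         = norm (\<Sum>j\<in>UNIV. h $ j * ((\<Sum>i<n. D i j y) - G j y))"
        by (simp add: sum_subtractf algebra_simps)
      also have "\<dots> \<le> (\<Sum>j\<in>(UNIV::'n set). norm h * \<delta>)"
      proof (intro sum_norm_le)
        fix j
        have "\<bar>(\<Sum>i<n. D i j y) - G j y\<bar> \<le> \<delta>"
          using * y by (auto simp: dist_real_def intro: less_imp_le)
        then show "norm (h $ j * ((\<Sum>i<n. D i j y) - G j y)) \<le> norm h * \<delta>"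
          by (simp add: abs_mult mult_mono component_le_norm_cart)
      qed
      also have "\<dots> = \<epsilon> * norm h" by (simp add: \<delta>_def)
      finally show "norm ((\<Sum>i<n. \<Sum>j\<in>UNIV. h $ j * D i j y) - (\<Sum>j\<in>UNIV. h $ j * G j y)) \<le> \<epsilon> * norm h" .
    qed
  qed (rule Fd)
  then obtain g where g: "\<And>y. y \<in> ?S \<Longrightarrow> (\<lambda>n. F n y) sums g y"
    "\<And>y. y \<in> ?S \<Longrightarrow> (g has_derivative (\<lambda>h. \<Sum>j\<in>UNIV. h $ j * G j y)) (at y within ?S)" by blast
  have "\<rho> \<le> r" using r by (simp add: \<rho>_def field_simps)
  then have "g y = f y" if "y \<in> ?S" for y
    using sums_unique2[OF g(1)[OF that] fs] that \<rho> by auto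
  then have "(f has_derivative (\<lambda>h. \<Sum>j\<in>UNIV. h $ j * G j y)) (at y)" if "y \<in> ?S" for y
    using has_derivative_transform[OF that _ g(2)[OF that], of f] at_within_open[OF that open_ball] \<open>\<And>y. y \<in> ?S \<Longrightarrow> g y = f y\<close> by simp
  with Gc \<rho> show ?thesis by (intro that[of "\<rho>/2" G]) auto
qed

text \<open>The local coefficient functions are forced to be the partial derivatives of
  \<open>f\<close>, so one globally defined \<open>G\<close> agrees with all of them and inherits
  their continuity.\<close>

lemma real_analytic_C1:
  fixes f :: "real^'n \<Rightarrow> real"
  assumes "real_analytic f"
  obtains G where "\<And>j::'n. continuous_on UNIV (G j)"
    "\<And>x. (f has_derivative (\<lambda>h. \<Sum>j\<in>UNIV. h $ j * G j x)) (at x)"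
proof -
  define G where "G j x = frechet_derivative f (at x) (axis j 1)" for j :: 'n and x
  have loc: "\<exists>\<rho>>0. (\<forall>j. continuous_on (ball x \<rho>) (G j)) \<and>
    (\<forall>y\<in>ball x \<rho>. (f has_derivative (\<lambda>h. \<Sum>j\<in>UNIV. h $ j * G j y)) (at y))" for x
  proof -
    obtain r c where "r > 0" "\<And>y. y \<in> ball x r \<Longrightarrow>
       ((\<lambda>\<alpha>. c \<alpha> * (\<Prod>i\<in>UNIV. (y $ i - x $ i) ^ \<alpha> i)) has_sum f y) UNIV"
      using assms unfolding real_analytic_def by blast
    then obtain \<rho> H where \<rho>: "\<rho> > 0" and H: "\<And>j::'n. continuous_on (ball x \<rho>) (H j)"
      "\<And>y. y \<in> ball x \<rho> \<Longrightarrow> (f has_derivative (\<lambda>h. \<Sum>j\<in>UNIV. h $ j * H j y)) (at y)"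
      using real_analytic_C1_local by blast
    have eq: "G j y = H j y" if "y \<in> ball x \<rho>" for j y
      unfolding G_def frechet_derivative_at[OF H(2)[OF that], symmetric]
      by (simp add: axis_def if_distrib[where f="\<lambda>x. x * _"] cong: if_cong)
    have "continuous_on (ball x \<rho>) (G j)" for j
      by (rule continuous_on_cong[THEN iffD2, OF refl eq H(1)])
    then show ?thesis using \<rho> H(2) eq by auto
  qed
  have "continuous_on UNIV (G j)" for j
    unfolding continuous_on_eq_continuous_at[OF open_UNIV]
  proof
    fix x
    obtain \<rho> where "\<rho> > 0" "continuous_on (ball x \<rho>) (G j)" using loc by blast
    then show "isCont (G j) x" using continuous_on_eq_continuous_at[OF open_ball, of x \<rho> "G j"] centre_in_ball[of x \<rho>] by blast
  qed
  moreover have "(f has_derivative (\<lambda>h. \<Sum>j\<in>UNIV. h $ j * G j x)) (at x)" for x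
    using loc[of x] centre_in_ball by blast
  ultimately show ?thesis by (rule that)
qed

section \<open>Analyticity of plane waves\<close>

lemma real_analytic_add:
  assumes "real_analytic f" "real_analytic g"
  shows "real_analytic (\<lambda>x. f x + g x)"
  unfolding real_analytic_def
proof
  fix x
  obtain r c where r: "r > 0" "\<forall>y\<in>ball x r. ((\<lambda>\<alpha>. c \<alpha> * (\<Prod>i\<in>UNIV. (y $ i - x $ i) ^ \<alpha> i)) has_sum f y) UNIV"
    using assms(1) unfolding real_analytic_def by blast
  obtain s d where s: "s > 0" "\<forall>y\<in>ball x s. ((\<lambda>\<alpha>. d \<alpha> * (\<Prod>i\<in>UNIV. (y $ i - x $ i) ^ \<alpha> i)) has_sum g y) UNIV"
    using assms(2) unfolding real_analytic_def by blast
  show "\<exists>r>0. \<exists>c. \<forall>y\<in>ball x r. ((\<lambda>\<alpha>. c \<alpha> * (\<Prod>i\<in>UNIV. (y $ i - x $ i) ^ \<alpha> i)) has_sum f y + g y) UNIV"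
    using r s by (intro exI[of _ "min r s"] conjI exI[of _ "\<lambda>\<alpha>. c \<alpha> + d \<alpha>"])
      (auto simp: distrib_right intro!: has_sum_add)
qed

lemma real_analytic_sum:
  assumes "\<And>k. k \<in> K \<Longrightarrow> real_analytic (f k)" "finite K" "K \<noteq> {}"
  shows "real_analytic (\<lambda>x. \<Sum>k\<in>K. f k x)"
  using assms(2,3,1) by (induction K rule: finite_ne_induct) (auto intro: real_analytic_add)

text \<open>Distributivity for finitely many absolutely convergent series: this is how one-variable
  exponential series become a single multi-index power series.\<close>

lemma has_sum_prod_UNIV:
  fixes f :: "'n::finite \<Rightarrow> nat \<Rightarrow> complex"
  assumes "\<And>i. summable (\<lambda>n. norm (f i n))" "\<And>i. f i sums S i"
  shows "((\<lambda>\<alpha>. \<Prod>i\<in>UNIV. f i (\<alpha> i)) has_sum (\<Prod>i\<in>UNIV. S i)) UNIV"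
proof -
  have abs: "Infinite_Sum.abs_summable_on (f i) UNIV" for i
    using assms(1)[of i] by (simp add: norm_summable_imp_summable_on)
  have "Infinite_Sum.abs_summable_on (\<lambda>\<alpha>. \<Prod>i\<in>UNIV. f i (\<alpha> i)) (PiE UNIV (\<lambda>_. UNIV))"
    using abs by (subst abs_summable_equivalent, intro abs_summable_on_prod_PiE)
      (auto simp flip: abs_summable_equivalent)
  then have "((\<lambda>\<alpha>. \<Prod>i\<in>UNIV. f i (\<alpha> i)) has_sum (infsum (\<lambda>\<alpha>. \<Prod>i\<in>UNIV. f i (\<alpha> i)) (PiE UNIV (\<lambda>_. UNIV)))) (PiE UNIV (\<lambda>_. UNIV))"
    by (rule has_sum_infsum[OF abs_summable_summable])
  moreover have "infsum (\<lambda>\<alpha>. \<Prod>i\<in>UNIV. f i (\<alpha> i)) (PiE UNIV (\<lambda>_. UNIV)) = (\<Prod>i\<in>UNIV. infsum (f i) UNIV)"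
    using abs by (intro infsum_prod_PiE_abs) auto
  moreover have "infsum (f i) UNIV = S i" for i
    using norm_summable_imp_has_sum[OF assms] by (rule infsumI)
  ultimately show ?thesis by simp
qed

lemma Re_complex_of_real_mult: "Re (w * complex_of_real t) = Re w * t"
  by simp

text \<open>The function is the real part of (a - ib) exp (i k.x). The phase at the centre goes into
  \<open>z\<close>; what remains, exp (i k.(y - x)), is a product of exponentials in single
  coordinates.\<close>

lemma real_analytic_wave:
  fixes k :: "real^'n"
  shows "real_analytic (\<lambda>x. a * cos (k \<bullet> x) + b * sin (k \<bullet> x))"
  unfolding real_analytic_def
proof (intro allI exI[of _ "1::real"] conjI exI ballI)
  fix x y :: "real^'n"
  define z where "z = Complex a (- b) * cis (k \<bullet> x)"
  define g where "g i n = (\<i> * of_real (k $ i)) ^ n / fact n" for i n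
  have "((\<lambda>\<alpha>. \<Prod>i\<in>UNIV. (\<i> * of_real (k $ i * (y $ i - x $ i))) ^ \<alpha> i / fact (\<alpha> i)) has_sum
     (\<Prod>i\<in>UNIV. exp (\<i> * of_real (k $ i * (y $ i - x $ i))))) UNIV"
  proof (rule has_sum_prod_UNIV)
    fix i
    show "summable (\<lambda>n. norm ((\<i> * of_real (k $ i * (y $ i - x $ i))) ^ n / fact n))"
      using summable_norm_exp[of "\<i> * of_real (k $ i * (y $ i - x $ i))"]
      by (simp add: scaleR_conv_of_real divide_inverse mult.commute norm_mult)
    show "(\<lambda>n. (\<i> * of_real (k $ i * (y $ i - x $ i))) ^ n / fact n) sums exp (\<i> * of_real (k $ i * (y $ i - x $ i)))"
      using exp_converges[of "\<i> * of_real (k $ i * (y $ i - x $ i))"]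
      by (simp add: scaleR_conv_of_real divide_inverse mult.commute)
  qed
  also have "(\<Prod>i\<in>UNIV. exp (\<i> * of_real (k $ i * (y $ i - x $ i)))) = cis (k \<bullet> (y - x))"
    by (simp add: cis_conv_exp inner_vec_def sum_distrib_left flip: exp_sum)
  finally have 1: "((\<lambda>\<alpha>. Re (z * (\<Prod>i\<in>UNIV. (\<i> * of_real (k $ i * (y $ i - x $ i))) ^ \<alpha> i / fact (\<alpha> i)))) has_sum
     Re (z * cis (k \<bullet> (y - x)))) UNIV"
    by (intro has_sum_Re has_sum_cmult_right)
  have "z * cis (k \<bullet> (y - x)) = Complex a (- b) * cis (k \<bullet> y)"
    by (simp add: z_def mult.assoc cis_mult inner_diff_right)
  then have 2: "Re (z * cis (k \<bullet> (y - x))) = a * cos (k \<bullet> y) + b * sin (k \<bullet> y)"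
    by simp
  have "z * (\<Prod>i\<in>UNIV. (\<i> * of_real (k $ i * (y $ i - x $ i))) ^ \<alpha> i / fact (\<alpha> i))
     = (z * (\<Prod>i\<in>UNIV. g i (\<alpha> i))) * of_real (\<Prod>i\<in>UNIV. (y $ i - x $ i) ^ \<alpha> i)" for \<alpha>
    by (simp add: g_def power_mult_distrib prod.distrib divide_inverse mult.assoc)
  then have 3: "Re (z * (\<Prod>i\<in>UNIV. (\<i> * of_real (k $ i * (y $ i - x $ i))) ^ \<alpha> i / fact (\<alpha> i)))
     = Re (z * (\<Prod>i\<in>UNIV. g i (\<alpha> i))) * (\<Prod>i\<in>UNIV. (y $ i - x $ i) ^ \<alpha> i)" for \<alpha>
    by (simp only: Re_complex_of_real_mult)
  from 1[unfolded 2 3]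
  show "((\<lambda>\<alpha>. Re ((Complex a (- b) * cis (k \<bullet> x)) * (\<Prod>i\<in>UNIV. (\<i> * of_real (k $ i)) ^ \<alpha> i / fact (\<alpha> i))) * (\<Prod>i\<in>UNIV. (y $ i - x $ i) ^ \<alpha> i))
     has_sum a * cos (k \<bullet> y) + b * sin (k \<bullet> y)) UNIV"
    by (simp only: g_def z_def)
qed simp

section \<open>Trigonometric polynomials on the torus\<close>

lemma periodic_lattice:
  assumes "periodic f" "\<And>i. \<exists>n::int. d $ i = 2 * pi * of_int n"
  shows "f (x + d) = f x"
proof -
  have step: "f (x + axis j (2 * pi * real n)) = f x" for x j n
  proof (induction n)
    case 0 then show ?case by (simp add: axis_def vec_eq_iff plus_vec_def flip: zero_vec_def)
  next
    case (Suc n)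
    have "x + axis j (2 * pi * real (Suc n)) = (x + axis j (2 * pi * real n)) + axis j (2 * pi)"
      by (simp add: vec_eq_iff axis_def algebra_simps)
    with Suc assms(1) show ?case unfolding periodic_def by metis
  qed
  have step': "f (x + axis j (2 * pi * of_int n)) = f x" for x j and n :: int
  proof (cases "n \<ge> 0")
    case True
    then show ?thesis using step[of x j "nat n"] by simp
  next
    case False
    have "x + axis j (2 * pi * of_int n) + axis j (2 * pi * real (nat (- n))) = x"
      using False by (simp add: vec_eq_iff axis_def algebra_simps)
    then show ?thesis using step[of "x + axis j (2 * pi * of_int n)" j "nat (- n)"] by metis
  qed
  obtain n :: "3 \<Rightarrow> int" where n: "\<And>i. d $ i = 2 * pi * of_int (n i)" using assms(2) by metis
  have "d = axis 1 (2 * pi * of_int (n 1)) + axis 2 (2 * pi * of_int (n 2)) + axis 3 (2 * pi * of_int (n 3))"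
    using n by (simp add: vec_eq_iff forall_3 axis_def)
  then show ?thesis by (simp add: step' flip: add.assoc)
qed

section \<open>Integration over a period cell\<close>

abbreviation cell :: "(real^3) set" where "cell \<equiv> cbox 0 (vec (2 * pi))"

text \<open>The part of the shifted box beyond the face \<open>x $ j = 2 * pi\<close> is a slab that
  periodicity moves back to the one missing at the face \<open>x $ j = 0\<close>.\<close>

lemma integral_cell_shift:
  fixes f :: "real^3 \<Rightarrow> real"
  assumes f: "continuous_on UNIV f" "periodic f" and s: "0 \<le> s" "s \<le> 2 * pi"
  shows "integral cell (\<lambda>x. f (x + axis j s)) = integral cell f"
proof -
  define B where "B l h = cbox ((\<chi> i. if i = j then l else 0) :: real^3) (\<chi> i. if i = j then h else 2 * pi)" for l h
  have cell: "cell = B 0 (2 * pi)" by (simp add: B_def vec_def zero_vec_def if_distrib cong: if_cong)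
  have shift: "integral (B l h) (\<lambda>x. f (x + axis j s)) = integral (B (l + s) (h + s)) f" for l h s
  proof -
    have "(\<chi> i. if i = j then l + s else 0) - axis j s = (\<chi> i. if i = j then l else 0)"
      "(\<chi> i. if i = j then h + s else 2 * pi) - axis j s = (\<chi> i. if i = j then h else 2 * pi)"
      by (simp_all add: vec_eq_iff axis_def)
    then show ?thesis
      using integral_shift_cbox[of "\<chi> i. if i = j then l + s else 0" "axis j s" "\<chi> i. if i = j then h + s else 2 * pi" f]
      by (simp add: B_def)
  qed
  have split: "integral (B l h) f = integral (B l m) f + integral (B m h) f" if "l \<le> m" "m \<le> h" for l m h
  proof -
    have "f integrable_on B l h" unfolding B_def
      using f(1) by (intro integrable_continuous) (rule continuous_on_subset, auto)
    moreover have "axis j (1::real) \<in> Basis" by (simp add: axis_in_Basis_iff)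
    moreover have "B l h \<inter> {x. x \<bullet> axis j 1 \<le> m} = B l m" "B l h \<inter> {x. x \<bullet> axis j 1 \<ge> m} = B m h"
      using that by (auto simp: B_def mem_box_cart inner_axis split: if_splits) (metis order_trans)+
    ultimately show ?thesis using integral_split[of f _ _ "axis j 1" m] by (simp add: B_def)
  qed
  have "integral cell (\<lambda>x. f (x + axis j s)) = integral (B s (2 * pi + s)) f"
    by (simp add: cell shift)
  also have "\<dots> = integral (B s (2 * pi)) f + integral (B (0 + 2 * pi) (s + 2 * pi)) f"
    using s by (subst split[of s "2 * pi"]) (auto simp: add.commute)
  also have "integral (B (0 + 2 * pi) (s + 2 * pi)) f = integral (B 0 s) f"
    unfolding shift[symmetric] using f(2) by (simp add: periodic_def)
  also have "integral (B s (2 * pi)) f + \<dots> = integral cell f"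
    using s by (simp add: cell split[of 0 s "2 * pi"])
  finally show ?thesis .
qed

text \<open>Averaging the cell integral over all translates along the \<open>j\<close>-axis reduces this to the
  one-dimensional fundamental theorem of calculus.\<close>

lemma integral_cell_derivative_eq_0:
  fixes g :: "real^3 \<Rightarrow> real"
  assumes g: "\<And>x. ((\<lambda>s. g (x + axis j s)) has_real_derivative d x) (at 0)" "periodic g"
    and d: "continuous_on UNIV d"
  shows "integral cell d = 0"
proof -
  have ax: "axis j (s + t) = axis j s + axis j t" for s t :: real by (simp add: vec_eq_iff axis_def)
  have dper: "periodic d" unfolding periodic_def
  proof (intro allI)
    fix x i
    have "g (x + axis i (2 * pi) + axis j s) = g (x + axis j s)" for s
      using g(2) unfolding periodic_def by (metis add.assoc add.commute)
    then show "d (x + axis i (2 * pi)) = d x"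
      using g(1)[of "x + axis i (2 * pi)"] g(1)[of x] by (simp add: DERIV_unique)
  qed
  have deriv: "((\<lambda>s. g (x + axis j s)) has_real_derivative d (x + axis j s)) (at s)" for x s
  proof -
    have "((\<lambda>t. g (x + axis j (s + t))) has_real_derivative d (x + axis j s)) (at 0)"
      using g(1)[of "x + axis j s"] by (simp add: ax add.assoc)
    then show ?thesis using DERIV_shift[of "\<lambda>s. g (x + axis j s)" _ 0 s] by (simp add: add.commute)
  qed
  have axc: "continuous_on S (\<lambda>z. axis j (h z) :: real^3)" if "continuous_on S h" for h :: "'b::topological_space \<Rightarrow> real" and S
  proof -
    have "continuous_on S (\<lambda>z. if i = j then h z else 0)" for i using that by (cases "i = j") auto
    then show ?thesis unfolding axis_def by (rule continuous_on_vec_lambda)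
  qed
  have "integral {0..2*pi} (\<lambda>s. integral cell (\<lambda>x. d (x + axis j s))) = integral {0..2*pi} (\<lambda>s. integral cell d)"
    by (rule integral_cong) (use d dper integral_cell_shift in auto)
  also have "\<dots> = 2 * pi * integral cell d" by simp
  finally have "2 * pi * integral cell d = integral (cbox 0 (2*pi)) (\<lambda>s. integral cell (\<lambda>x. d (x + axis j s)))"
    by simp
  also have "\<dots> = integral cell (\<lambda>x. integral (cbox 0 (2*pi)) (\<lambda>s. d (x + axis j s)))"
    by (rule integral_swap_continuous)
      (auto simp: case_prod_unfold intro!: axc continuous_intros continuous_on_compose2[OF d])
  also have "\<dots> = integral cell (\<lambda>x. 0)"
  proof (rule integral_cong)
    fix x
    have "((\<lambda>s. d (x + axis j s)) has_integral g (x + axis j (2 * pi)) - g (x + axis j 0)) {0..2*pi}"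
      using deriv by (intro fundamental_theorem_of_calculus)
        (auto simp: has_real_derivative_iff_has_vector_derivative intro: has_vector_derivative_at_within)
    moreover have "g (x + axis j (2 * pi)) - g (x + axis j 0) = 0"
      using g(2) by (simp add: periodic_def iffD2[OF axis_eq_0_iff refl])
    ultimately show "integral (cbox 0 (2*pi)) (\<lambda>s. d (x + axis j s)) = 0"
      by (simp add: integral_unique)
  qed
  finally show ?thesis by simp
qed

section \<open>Trigonometric polynomials and completeness\<close>

definition int_vec :: "real^3 \<Rightarrow> bool" where "int_vec k \<longleftrightarrow> (\<forall>i. k $ i \<in> \<int>)"

lemma int_vec_simps [simp]:
  "int_vec 0" "int_vec (- k) = int_vec k"
  "int_vec k \<Longrightarrow> int_vec l \<Longrightarrow> int_vec (k + l)" "int_vec k \<Longrightarrow> int_vec l \<Longrightarrow> int_vec (k - l)"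
  by (auto simp: int_vec_def)

lemma int_vec_axis [simp]: "int_vec (axis i 1)"
  by (simp add: int_vec_def axis_def)

lemma periodic_cos_sin:
  assumes "int_vec k"
  shows "periodic (\<lambda>x. cos (k \<bullet> x))" "periodic (\<lambda>x. sin (k \<bullet> x))"
proof -
  have "\<exists>n::int. k \<bullet> (x + axis j (2 * pi)) = k \<bullet> x + 2 * pi * of_int n" for x j
    using assms by (auto simp: inner_add_right inner_axis int_vec_def Ints_def dest!: spec[of _ j])
  then show "periodic (\<lambda>x. cos (k \<bullet> x))" "periodic (\<lambda>x. sin (k \<bullet> x))"
    unfolding periodic_def by (metis cos_int_2pin sin_int_2pin sin.plus_of_int cos.plus_of_int sin_add cos_add mult.right_neutral mult_zero_right add_0_right diff_zero)+
qed

text \<open>Linear generation lets orthogonality be checked on single sines and cosines; the closure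
  under products that Stone-Weierstrass demands is recovered from the product-to-sum
  formulas.\<close>

inductive trig_poly :: "(real^3 \<Rightarrow> real) \<Rightarrow> bool" where
  cos: "int_vec k \<Longrightarrow> trig_poly (\<lambda>x. cos (k \<bullet> x))"
| sin: "int_vec k \<Longrightarrow> trig_poly (\<lambda>x. sin (k \<bullet> x))"
| add: "trig_poly f \<Longrightarrow> trig_poly g \<Longrightarrow> trig_poly (\<lambda>x. f x + g x)"
| scale: "trig_poly f \<Longrightarrow> trig_poly (\<lambda>x. c * f x)"

lemma trig_poly_const: "trig_poly (\<lambda>x. c)"
  using trig_poly.scale[OF trig_poly.cos[of 0], of c] by simp

lemma trig_poly_sum: "(\<And>i. i \<in> I \<Longrightarrow> trig_poly (f i)) \<Longrightarrow> trig_poly (\<lambda>x. \<Sum>i\<in>I. f i x)"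
  by (induction I rule: infinite_finite_induct) (auto intro: trig_poly_const trig_poly.add)

lemma trig_poly_mult_basic:
  assumes "int_vec k" "trig_poly g"
  shows "trig_poly (\<lambda>x. cos (k \<bullet> x) * g x) \<and> trig_poly (\<lambda>x. sin (k \<bullet> x) * g x)"
  using assms(2)
proof induction
  case (cos l)
  have "(\<lambda>x. cos (k \<bullet> x) * cos (l \<bullet> x)) = (\<lambda>x. (1/2) * cos ((k - l) \<bullet> x) + (1/2) * cos ((k + l) \<bullet> x))"
    "(\<lambda>x. sin (k \<bullet> x) * cos (l \<bullet> x)) = (\<lambda>x. (1/2) * sin ((k + l) \<bullet> x) + (1/2) * sin ((k - l) \<bullet> x))"
    by (rule ext, simp add: inner_add_left inner_diff_left cos_times_cos sin_times_cos add_divide_distrib)+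
  note eq = this
  show ?case unfolding eq using assms(1) cos by (intro conjI trig_poly.intros) auto
next
  case (sin l)
  have "(\<lambda>x. cos (k \<bullet> x) * sin (l \<bullet> x)) = (\<lambda>x. (1/2) * sin ((k + l) \<bullet> x) + (-1/2) * sin ((k - l) \<bullet> x))"
    "(\<lambda>x. sin (k \<bullet> x) * sin (l \<bullet> x)) = (\<lambda>x. (1/2) * cos ((k - l) \<bullet> x) + (-1/2) * cos ((k + l) \<bullet> x))"
    by (rule ext, simp add: inner_add_left inner_diff_left cos_times_sin sin_times_sin diff_divide_distrib)+
  note eq = this
  show ?case unfolding eq using assms(1) sin by (intro conjI trig_poly.intros) auto
next
  case (add f g)
  then show ?case by (auto simp: distrib_left intro: trig_poly.add)
next
  case (scale f c)
  then show ?case by (auto simp: mult.left_commute[of _ c] intro: trig_poly.scale)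
qed

lemma trig_poly_mult:
  assumes "trig_poly f" "trig_poly g"
  shows "trig_poly (\<lambda>x. f x * g x)"
  using assms(1)
  by induction (auto simp: distrib_right mult.assoc assms(2) trig_poly_mult_basic intro: trig_poly.intros)

lemma trig_poly_continuous: "trig_poly f \<Longrightarrow> continuous_on S f"
  by (induction rule: trig_poly.induct) (auto intro!: continuous_intros)

lemma cis_eq_iff_int: "cis a = cis b \<longleftrightarrow> (\<exists>n::int. a - b = 2 * pi * of_int n)"
proof
  assume "cis a = cis b"
  then have "exp (\<i> * of_real a) = exp (\<i> * of_real b)" by (simp add: cis_conv_exp)
  then obtain n :: int where "\<i> * of_real a = \<i> * of_real b + of_int (2 * n) * of_real pi * \<i>"
    by (auto simp: exp_eq)
  then have "Im (\<i> * of_real a) = Im (\<i> * of_real b + of_int (2 * n) * of_real pi * \<i>)" by simp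
  then show "\<exists>n::int. a - b = 2 * pi * of_int n" by (intro exI[of _ n]) simp
next
  assume "\<exists>n::int. a - b = 2 * pi * of_int n"
  then obtain n :: int where "a = b + 2 * pi * of_int n" by (auto simp: algebra_simps)
  then show "cis a = cis b" by (simp add: complex_eq_iff cos_add sin_add)
qed

lemma exists_cell_representative:
  obtains d where "\<And>i. \<exists>n::int. d $ i = 2 * pi * of_int n" "x + d \<in> cell"
proof
  define d where "d = (\<chi> i. 2 * pi * of_int (- \<lfloor>x $ i / (2 * pi)\<rfloor>))"
  show "\<exists>n::int. d $ i = 2 * pi * of_int n" for i unfolding d_def by (simp only: vec_lambda_beta) blast
  have "0 \<le> (x + d) $ i \<and> (x + d) $ i \<le> 2 * pi" for i
  proof -
    have "(x + d) $ i = 2 * pi * frac (x $ i / (2 * pi))"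
      by (simp add: d_def frac_def field_simps)
    then show ?thesis
      using frac_ge_0[of "x $ i / (2 * pi)"] frac_lt_1[of "x $ i / (2 * pi)"]
      by (simp add: mult_le_cancel_left1)
  qed
  then show "x + d \<in> cell" by (simp add: mem_box_cart vec_def)
qed

text \<open>A periodic function factors through the embedded torus \<open>x \<mapsto> (cis x\<^sub>1, cis x\<^sub>2, cis x\<^sub>3)\<close>, on which
  real polynomials restrict to trigonometric polynomials.\<close>

lemma trig_poly_dense:
  assumes f: "continuous_on UNIV f" "periodic f" and e: "e > 0"
  obtains p where "trig_poly p" "\<And>x. x \<in> cell \<Longrightarrow> \<bar>f x - p x\<bar> < e"
proof -
  define \<phi> :: "real^3 \<Rightarrow> complex^3" where "\<phi> x = (\<chi> i. cis (x $ i))" for x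
  have \<phi>c: "continuous_on S \<phi>" for S
    unfolding \<phi>_def by (intro continuous_on_vec_lambda continuous_on_cis continuous_intros)
  have f\<phi>: "f x = f y" if "\<phi> x = \<phi> y" for x y
    using that periodic_lattice[OF f(2), of "x - y" y] by (auto simp: \<phi>_def vec_eq_iff cis_eq_iff_int)
  define h where "h z = f (SOME x. x \<in> cell \<and> \<phi> x = z)" for z
  have h: "h (\<phi> x) = f x" if "x \<in> cell" for x
    unfolding h_def
  proof (rule someI2)
    show "x \<in> cell \<and> \<phi> x = \<phi> x" using that by simp
    show "f y = f x" if "y \<in> cell \<and> \<phi> y = \<phi> x" for y using that by (intro f\<phi>) simp
  qed
  have K: "compact (\<phi> ` cell)" by (intro compact_continuous_image \<phi>c compact_cbox)
  \<comment> \<open>On the compact \<open>cell\<close> the map \<open>\<phi>\<close> is closed,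
    hence a quotient map onto its image: closed subsets of the cell have compact images, so
    \<open>h\<close> pulls closed sets back to closed sets.\<close>
  have "continuous_on (\<phi> ` cell) h"
    unfolding continuous_on_closed_invariant
  proof (intro allI impI)
    fix B :: "real set" assume B: "closed B"
    have eq: "h -` B \<inter> \<phi> ` cell = \<phi> ` (cell \<inter> f -` B)" using h by auto
    have "compact (cell \<inter> f -` B)"
      using continuous_closed_vimage[OF B, of f] f(1)
      by (intro compact_Int_closed compact_cbox) (simp add: continuous_on_eq_continuous_at)
    then have "closed (\<phi> ` (cell \<inter> f -` B))"
      by (intro compact_imp_closed compact_continuous_image \<phi>c)
    moreover have "\<phi> ` (cell \<inter> f -` B) \<inter> \<phi> ` cell = h -` B \<inter> \<phi> ` cell"
      unfolding eq by blast
    ultimately show "\<exists>A. closed A \<and> A \<inter> \<phi> ` cell = h -` B \<inter> \<phi> ` cell" by blast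
  qed
  then obtain g where g: "real_polynomial_function g" "\<And>z. z \<in> \<phi> ` cell \<Longrightarrow> \<bar>h z - g z\<bar> < e"
    using Stone_Weierstrass_real_polynomial_function[OF K _ e] by blast
  have "trig_poly (\<lambda>x. g (\<phi> x))" using g(1)
  proof induction
    case (linear g)
    interpret bounded_linear g by fact
    \<comment> \<open>A real-linear functional on \<open>complex^3\<close> sees six real
      coordinates; at \<open>\<phi> x\<close> these are the cosines and sines of the coordinates of
      \<open>x\<close>.\<close>
    have "\<phi> x = (\<Sum>i\<in>UNIV. cos (axis i 1 \<bullet> x) *\<^sub>R axis i 1 + sin (axis i 1 \<bullet> x) *\<^sub>R axis i \<i>)" for x
      unfolding inner_axis'
      by (simp add: vec_eq_iff \<phi>_def axis_def complex_eq_iff if_distrib cong: if_cong)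
    then have "g (\<phi> x) = (\<Sum>i\<in>UNIV. g (axis i 1) * cos (axis i 1 \<bullet> x) + g (axis i \<i>) * sin (axis i 1 \<bullet> x))" for x
      by (simp add: sum add scaleR mult.commute)
    then show ?case by (auto intro!: trig_poly_sum trig_poly.intros)
  qed (auto intro: trig_poly_const trig_poly.add trig_poly_mult)
  then show ?thesis
  proof (rule that)
    show "\<bar>f x - g (\<phi> x)\<bar> < e" if "x \<in> cell" for x
      using g(2)[of "\<phi> x"] h[OF that] that by simp
  qed
qed

lemma cell_integrable: "continuous_on UNIV f \<Longrightarrow> f integrable_on cell"
  for f :: "real^3 \<Rightarrow> 'a::banach"
  by (rule integrable_continuous) (rule continuous_on_subset, auto)

lemma periodic_eq_0_if_square_integral_eq_0:
  fixes f :: "real^3 \<Rightarrow> real"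
  assumes f: "continuous_on UNIV f" "periodic f" and 0: "integral cell (\<lambda>x. f x * f x) = 0"
  shows "f x = 0"
proof -
  have ne: "box 0 (vec (2 * pi) :: real^3) \<noteq> {}" by (auto simp: interval_ne_empty_cart)
  have "continuous_on cell (\<lambda>x. f x * f x)"
    using f(1) by (auto intro!: continuous_intros intro: continuous_on_subset)
  then have "f x = 0" if "x \<in> cell" for x
    using integral_cbox_eq_0_iff[OF _ ne] 0 that by fastforce
  moreover obtain d where "\<And>i. \<exists>n::int. d $ i = 2 * pi * of_int n" "x + d \<in> cell"
    using exists_cell_representative[of x] by blast
  ultimately show ?thesis using periodic_lattice[OF f(2)] by metis
qed

text \<open>Since \<open>f\<close> is orthogonal to every trigonometric polynomial p, the integral
  of f^2 equals that of f (f - p), which is at most sup |f - p| times the integral of |f|; density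
  makes this arbitrarily small.\<close>

lemma fourier_uniqueness:
  fixes f :: "real^3 \<Rightarrow> real"
  assumes f: "continuous_on UNIV f" "periodic f"
    and c: "\<And>k. int_vec k \<Longrightarrow> integral cell (\<lambda>x. f x * cos (k \<bullet> x)) = 0"
    and s: "\<And>k. int_vec k \<Longrightarrow> integral cell (\<lambda>x. f x * sin (k \<bullet> x)) = 0"
  shows "f x = 0"
proof (rule periodic_eq_0_if_square_integral_eq_0[OF f])
  have fp: "integral cell (\<lambda>x. f x * p x) = 0" if "trig_poly p" for p
    using that
  proof induction
    case (add p q)
    then show ?case using f(1) trig_poly_continuous
      by (simp add: distrib_left integral_add cell_integrable continuous_on_mult)
  next
    case (scale p a)
    then show ?case by (simp add: mult.left_commute[of _ a])
  qed (use c s in auto)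
  define N where "N = integral cell (\<lambda>x. \<bar>f x\<bar>)"
  have N: "N \<ge> 0" unfolding N_def by (rule integral_nonneg) (auto intro!: cell_integrable continuous_intros f)
  have le: "integral cell (\<lambda>x. f x * f x) \<le> e * N" if e: "e > 0" for e
  proof -
    obtain p where p: "trig_poly p" "\<And>x. x \<in> cell \<Longrightarrow> \<bar>f x - p x\<bar> < e" using trig_poly_dense[OF f e] by blast
    note pc = trig_poly_continuous[OF p(1), of UNIV]
    have "integral cell (\<lambda>x. f x * f x) = integral cell (\<lambda>x. f x * f x) - integral cell (\<lambda>x. f x * p x)"
      using fp[OF p(1)] by simp
    also have "\<dots> = integral cell (\<lambda>x. f x * f x - f x * p x)"
      by (rule integral_diff[symmetric]) (auto intro!: cell_integrable continuous_intros f pc)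
    also have "\<dots> \<le> integral cell (\<lambda>x. e * \<bar>f x\<bar>)"
    proof (rule integral_le)
      fix x assume "x \<in> cell"
      have "f x * f x - f x * p x \<le> \<bar>f x\<bar> * \<bar>f x - p x\<bar>"
        by (metis abs_ge_self abs_mult right_diff_distrib)
      also have "\<dots> \<le> \<bar>f x\<bar> * e" using p(2)[OF \<open>x \<in> cell\<close>] by (intro mult_left_mono) auto
      finally show "f x * f x - f x * p x \<le> e * \<bar>f x\<bar>" by (simp add: mult.commute)
    qed (auto intro!: cell_integrable continuous_intros f pc)
    finally show ?thesis by (simp add: N_def)
  qed
  have "integral cell (\<lambda>x. f x * f x) \<le> 0"
  proof (rule field_le_epsilon)
    fix e :: real assume "e > 0"
    \<comment> \<open>The denominator \<open>N + 1\<close> covers the case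
      \<open>N = 0\<close>.\<close>
    then have "integral cell (\<lambda>x. f x * f x) \<le> (e / (N + 1)) * N" using N by (intro le) auto
    also have "\<dots> \<le> e" using N \<open>e > 0\<close> by (simp add: field_simps)
    finally show "integral cell (\<lambda>x. f x * f x) \<le> 0 + e" by simp
  qed
  moreover have "integral cell (\<lambda>x. f x * f x) \<ge> 0"
    by (rule integral_nonneg) (auto intro!: cell_integrable continuous_intros f)
  ultimately show "integral cell (\<lambda>x. f x * f x) = 0" by simp
qed

section \<open>Fourier coefficients\<close>

abbreviation cell_volume :: real where "cell_volume \<equiv> integral cell (\<lambda>x. 1)"

lemma cell_volume_pos: "cell_volume > 0"
proof -
  have "box 0 (vec (2 * pi) :: real^3) \<noteq> {}" by (auto simp: interval_ne_empty_cart)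
  then show ?thesis by (simp add: content_pos_lt_eq box_eq_empty not_le)
qed

text \<open>Up to sign, \<open>k $ j\<close> times either function is the derivative of the other
  along the j-th axis, so its integral vanishes; a nonzero \<open>k\<close> has some nonzero
  component.\<close>

lemma integral_cell_sin_cos:
  assumes "int_vec k"
  shows "integral cell (\<lambda>x. cos (k \<bullet> x)) = (if k = 0 then cell_volume else 0)"
    and "integral cell (\<lambda>x. sin (k \<bullet> x)) = 0"
proof -
  have ax: "k \<bullet> (x + axis j s) = k \<bullet> x + k $ j * s" for x j s
    by (simp add: inner_add_right inner_axis)
  have "integral cell (\<lambda>x. k $ j * cos (k \<bullet> x)) = 0" for j
    by (rule integral_cell_derivative_eq_0[OF _ periodic_cos_sin(2)[OF assms], where j = j])
      (auto simp: ax intro!: derivative_eq_intros continuous_intros)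
  moreover have "integral cell (\<lambda>x. - (k $ j) * sin (k \<bullet> x)) = 0" for j
    by (rule integral_cell_derivative_eq_0[OF _ periodic_cos_sin(1)[OF assms], where j = j])
      (auto simp: ax intro!: derivative_eq_intros continuous_intros)
  ultimately have *: "k $ j * integral cell (\<lambda>x. cos (k \<bullet> x)) = 0" "k $ j * integral cell (\<lambda>x. sin (k \<bullet> x)) = 0" for j
    by (simp_all del: integral_const)
  have "k = 0 \<or> (\<exists>j. k $ j \<noteq> 0)" by (auto simp: vec_eq_iff)
  then show "integral cell (\<lambda>x. cos (k \<bullet> x)) = (if k = 0 then cell_volume else 0)"
    "integral cell (\<lambda>x. sin (k \<bullet> x)) = 0"
    using * by (cases "k = 0"; auto simp del: integral_const)+
qed

text \<open>The second indicator is there because \<open>k\<close> and \<open>- k\<close> label the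
  same cosine and opposite sines. At \<open>k = l = 0\<close> both indicators fire, which gives the
  full volume for cosines and 0 for sines.\<close>

lemma integral_cell_trig_products:
  assumes k: "int_vec k" and l: "int_vec l"
  shows "integral cell (\<lambda>x. cos (k \<bullet> x) * cos (l \<bullet> x)) = cell_volume / 2 * (of_bool (k = l) + of_bool (k = - l))"
    and "integral cell (\<lambda>x. sin (k \<bullet> x) * sin (l \<bullet> x)) = cell_volume / 2 * (of_bool (k = l) - of_bool (k = - l))"
    and "integral cell (\<lambda>x. sin (k \<bullet> x) * cos (l \<bullet> x)) = 0"
    and "integral cell (\<lambda>x. cos (k \<bullet> x) * sin (l \<bullet> x)) = 0"
proof -
  have e: "(\<lambda>x. cos (k \<bullet> x) * cos (l \<bullet> x)) = (\<lambda>x. (1/2) * cos ((k - l) \<bullet> x) + (1/2) * cos ((k + l) \<bullet> x))"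
    "(\<lambda>x. sin (k \<bullet> x) * sin (l \<bullet> x)) = (\<lambda>x. (1/2) * cos ((k - l) \<bullet> x) - (1/2) * cos ((k + l) \<bullet> x))"
    "(\<lambda>x. sin (k \<bullet> x) * cos (l \<bullet> x)) = (\<lambda>x. (1/2) * sin ((k + l) \<bullet> x) + (1/2) * sin ((k - l) \<bullet> x))"
    "(\<lambda>x. cos (k \<bullet> x) * sin (l \<bullet> x)) = (\<lambda>x. (1/2) * sin ((k + l) \<bullet> x) - (1/2) * sin ((k - l) \<bullet> x))"
    by (rule ext, simp add: inner_add_left inner_diff_left cos_times_cos sin_times_sin
        sin_times_cos cos_times_sin add_divide_distrib diff_divide_distrib)+
  have i: "(\<lambda>x. (1/2) * cos (n \<bullet> x)) integrable_on cell" "(\<lambda>x. (1/2) * sin (n \<bullet> x)) integrable_on cell" for n :: "real^3"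
    by (auto intro!: cell_integrable continuous_intros)
  have m: "integral cell (\<lambda>x. (1/2) * cos (n \<bullet> x)) = (1/2) * (if n = 0 then cell_volume else 0)"
    "integral cell (\<lambda>x. (1/2) * sin (n \<bullet> x)) = 0" if "int_vec n" for n
    using integral_cell_sin_cos[OF that] by (simp_all only: integral_mult_right)
  have kl: "k - l = 0 \<longleftrightarrow> k = l" "k + l = 0 \<longleftrightarrow> k = - l" by (auto simp: eq_neg_iff_add_eq_0)
  show "integral cell (\<lambda>x. cos (k \<bullet> x) * cos (l \<bullet> x)) = cell_volume / 2 * (of_bool (k = l) + of_bool (k = - l))"
    unfolding e integral_add[OF i(1) i(1)] using k l by (simp only: m int_vec_simps kl) (simp add: field_simps)
  show "integral cell (\<lambda>x. sin (k \<bullet> x) * sin (l \<bullet> x)) = cell_volume / 2 * (of_bool (k = l) - of_bool (k = - l))"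
    unfolding e integral_diff[OF i(1) i(1)] using k l by (simp only: m int_vec_simps kl) (simp add: field_simps)
  show "integral cell (\<lambda>x. sin (k \<bullet> x) * cos (l \<bullet> x)) = 0"
    unfolding e integral_add[OF i(2) i(2)] using k l by (simp only: m int_vec_simps add_0)
  show "integral cell (\<lambda>x. cos (k \<bullet> x) * sin (l \<bullet> x)) = 0"
    unfolding e integral_diff[OF i(2) i(2)] using k l by (simp only: m int_vec_simps diff_zero)
qed

text \<open>A symmetric index set lists every wave twice, so the coefficients are not unique: the
  integrals recover just the even part of \<open>a\<close> and the odd part of
  \<open>b\<close>.\<close>

lemma integral_cell_trig_sum:
  fixes a b :: "real^3 \<Rightarrow> real"
  assumes K: "finite K" "\<And>k. k \<in> K \<Longrightarrow> int_vec k" "\<And>k. k \<in> K \<Longrightarrow> - k \<in> K" and l: "int_vec l"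
  shows "integral cell (\<lambda>x. (\<Sum>k\<in>K. a k * cos (k \<bullet> x) + b k * sin (k \<bullet> x)) * cos (l \<bullet> x))
      = (if l \<in> K then cell_volume / 2 * (a l + a (- l)) else 0)"
    and "integral cell (\<lambda>x. (\<Sum>k\<in>K. a k * cos (k \<bullet> x) + b k * sin (k \<bullet> x)) * sin (l \<bullet> x))
      = (if l \<in> K then cell_volume / 2 * (b l - b (- l)) else 0)"
proof -
  note I = integral_cell_trig_products[OF K(2) l]
  have alg: "(\<Sum>k\<in>K. a k * (v * (p k + q k))) = v * ((\<Sum>k\<in>K. p k * a k) + (\<Sum>k\<in>K. q k * a k))" for v and p q :: "real^3 \<Rightarrow> real"
    unfolding sum.distrib[symmetric] sum_distrib_left by (intro sum.cong refl) (simp add: algebra_simps)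
  have lK: "- l \<in> K \<longleftrightarrow> l \<in> K" using K(3)[of l] K(3)[of "- l"] by auto
  have alg': "(\<Sum>k\<in>K. b k * (v * (p k - q k))) = v * ((\<Sum>k\<in>K. p k * b k) - (\<Sum>k\<in>K. q k * b k))" for v and p q :: "real^3 \<Rightarrow> real"
    unfolding sum_subtractf[symmetric] sum_distrib_left by (intro sum.cong refl) (simp add: algebra_simps)
  have delta: "(\<Sum>k\<in>K. of_bool (k = m) * c k) = (if m \<in> K then c m else 0)" for m and c :: "real^3 \<Rightarrow> real"
    by (simp add: of_bool_def if_distrib[of "\<lambda>x. x * _"] K(1) cong: if_cong)
  have 1: "integral cell (\<lambda>x. (\<Sum>k\<in>K. a k * cos (k \<bullet> x) + b k * sin (k \<bullet> x)) * t x)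
     = (\<Sum>k\<in>K. a k * integral cell (\<lambda>x. cos (k \<bullet> x) * t x) + b k * integral cell (\<lambda>x. sin (k \<bullet> x) * t x))"
    if t: "continuous_on UNIV t" for t
  proof -
    have "integral cell (\<lambda>x. (\<Sum>k\<in>K. a k * cos (k \<bullet> x) + b k * sin (k \<bullet> x)) * t x)
      = integral cell (\<lambda>x. \<Sum>k\<in>K. a k * (cos (k \<bullet> x) * t x) + b k * (sin (k \<bullet> x) * t x))"
      by (simp only: sum_distrib_right distrib_right mult.assoc)
    also have "\<dots> = (\<Sum>k\<in>K. integral cell (\<lambda>x. a k * (cos (k \<bullet> x) * t x) + b k * (sin (k \<bullet> x) * t x)))"
      by (rule integral_sum[OF K(1)]) (auto intro!: cell_integrable continuous_intros t)
    also have "\<dots> = (\<Sum>k\<in>K. integral cell (\<lambda>x. a k * (cos (k \<bullet> x) * t x)) + integral cell (\<lambda>x. b k * (sin (k \<bullet> x) * t x)))"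
      by (intro sum.cong refl integral_add) (auto intro!: cell_integrable continuous_intros t)
    finally show ?thesis by simp
  qed
  have "integral cell (\<lambda>x. (\<Sum>k\<in>K. a k * cos (k \<bullet> x) + b k * sin (k \<bullet> x)) * cos (l \<bullet> x))
     = (\<Sum>k\<in>K. a k * (cell_volume / 2 * (of_bool (k = l) + of_bool (k = - l))))"
    by (subst 1) (auto intro!: continuous_intros sum.cong simp del: integral_const simp: I)
  also have "\<dots> = cell_volume / 2 * ((\<Sum>k\<in>K. of_bool (k = l) * a k) + (\<Sum>k\<in>K. of_bool (k = - l) * a k))"
    by (rule alg)
  finally show "integral cell (\<lambda>x. (\<Sum>k\<in>K. a k * cos (k \<bullet> x) + b k * sin (k \<bullet> x)) * cos (l \<bullet> x))
      = (if l \<in> K then cell_volume / 2 * (a l + a (- l)) else 0)"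
    unfolding delta lK by (cases "l \<in> K") (simp_all del: integral_const)
  have "integral cell (\<lambda>x. (\<Sum>k\<in>K. a k * cos (k \<bullet> x) + b k * sin (k \<bullet> x)) * sin (l \<bullet> x))
     = (\<Sum>k\<in>K. b k * (cell_volume / 2 * (of_bool (k = l) - of_bool (k = - l))))"
    by (subst 1) (auto intro!: continuous_intros sum.cong simp del: integral_const simp: I)
  also have "\<dots> = cell_volume / 2 * ((\<Sum>k\<in>K. of_bool (k = l) * b k) - (\<Sum>k\<in>K. of_bool (k = - l) * b k))"
    by (rule alg')
  finally show "integral cell (\<lambda>x. (\<Sum>k\<in>K. a k * cos (k \<bullet> x) + b k * sin (k \<bullet> x)) * sin (l \<bullet> x))
      = (if l \<in> K then cell_volume / 2 * (b l - b (- l)) else 0)"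
    unfolding delta lK by (cases "l \<in> K") (simp_all del: integral_const)
qed

text \<open>Both sides have the same Fourier coefficients. The normalisation is
  \<open>1 / cell_volume\<close> instead of the usual \<open>2 / cell_volume\<close> since
  \<open>k\<close> and \<open>- k\<close> both occur in the sum; this also fits
  \<open>k = 0\<close>.\<close>

lemma fourier_finite_support:
  fixes f :: "real^3 \<Rightarrow> real"
  assumes f: "continuous_on UNIV f" "periodic f"
    and K: "finite K" "\<And>k. k \<in> K \<Longrightarrow> int_vec k" "\<And>k. k \<in> K \<Longrightarrow> - k \<in> K"
    and 0: "\<And>k. int_vec k \<Longrightarrow> k \<notin> K \<Longrightarrow> integral cell (\<lambda>x. f x * cos (k \<bullet> x)) = 0"
      "\<And>k. int_vec k \<Longrightarrow> k \<notin> K \<Longrightarrow> integral cell (\<lambda>x. f x * sin (k \<bullet> x)) = 0"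
  shows "f x = (\<Sum>k\<in>K. (integral cell (\<lambda>y. f y * cos (k \<bullet> y)) / cell_volume) * cos (k \<bullet> x)
      + (integral cell (\<lambda>y. f y * sin (k \<bullet> y)) / cell_volume) * sin (k \<bullet> x))"
proof -
  define a where "a k = integral cell (\<lambda>y. f y * cos (k \<bullet> y)) / cell_volume" for k
  define b where "b k = integral cell (\<lambda>y. f y * sin (k \<bullet> y)) / cell_volume" for k
  define s where "s x = (\<Sum>k\<in>K. a k * cos (k \<bullet> x) + b k * sin (k \<bullet> x))" for x
  have ab: "a (- k) = a k" "b (- k) = - b k" for k by (simp_all add: a_def b_def)
  have sc: "continuous_on UNIV s" unfolding s_def by (intro continuous_intros)
  have sp: "periodic s" using periodic_cos_sin[OF K(2)] by (simp add: s_def periodic_def)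
  have I: "integral cell (\<lambda>x. s x * cos (l \<bullet> x)) = (if l \<in> K then cell_volume / 2 * (a l + a (- l)) else 0)"
    "integral cell (\<lambda>x. s x * sin (l \<bullet> x)) = (if l \<in> K then cell_volume / 2 * (b l - b (- l)) else 0)"
    if "int_vec l" for l
    unfolding s_def using integral_cell_trig_sum[of K l a b] K that by blast+
  have "f x - s x = 0"
  proof (rule fourier_uniqueness)
    show "continuous_on UNIV (\<lambda>x. f x - s x)" using f(1) sc by (intro continuous_intros)
    show "periodic (\<lambda>x. f x - s x)" using f(2) sp by (simp add: periodic_def)
    fix k assume k: "int_vec k"
    have d: "integral cell (\<lambda>x. (f x - s x) * t x) = integral cell (\<lambda>x. f x * t x) - integral cell (\<lambda>x. s x * t x)"
      if "continuous_on UNIV t" for t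
      unfolding left_diff_distrib by (rule integral_diff) (auto intro!: cell_integrable continuous_intros f sc that)
    show "integral cell (\<lambda>x. (f x - s x) * cos (k \<bullet> x)) = 0"
      by (subst d) (use I(1)[OF k] 0(1)[OF k] cell_volume_pos in
        \<open>auto intro!: continuous_intros simp: ab a_def simp del: integral_const\<close>)
    show "integral cell (\<lambda>x. (f x - s x) * sin (k \<bullet> x)) = 0"
      by (subst d) (use I(2)[OF k] 0(2)[OF k] cell_volume_pos in
        \<open>auto intro!: continuous_intros simp: ab b_def simp del: integral_const\<close>)
  qed
  then show ?thesis by (simp add: s_def a_def b_def)
qed

section \<open>Curl eigenfields as trigonometric sums\<close>

definition freqs :: "real \<Rightarrow> (real^3) set" where "freqs lam = {k. int_vec k \<and> norm k = lam}"

lemma finite_freqs: "finite (freqs lam)"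
proof -
  let ?Z = "{z :: real. z \<in> \<int> \<and> - lam \<le> z \<and> z \<le> lam}"
  have "finite ?Z"
  proof -
    have "?Z \<subseteq> of_int ` {- \<lceil>\<bar>lam\<bar>\<rceil> .. \<lceil>\<bar>lam\<bar>\<rceil>}"
    proof
      fix z assume z: "z \<in> ?Z"
      then obtain n :: int where n: "z = of_int n" by (auto elim: Ints_cases)
      have "- \<lceil>\<bar>lam\<bar>\<rceil> \<le> n" "n \<le> \<lceil>\<bar>lam\<bar>\<rceil>" using z n by (auto simp: le_ceiling_iff) linarith+
      then show "z \<in> of_int ` {- \<lceil>\<bar>lam\<bar>\<rceil> .. \<lceil>\<bar>lam\<bar>\<rceil>}" using n by auto
    qed
    then show ?thesis by (rule finite_subset) simp
  qed
  then have "finite ((\<lambda>(a, b, c). vector [a, b, c] :: real^3) ` (?Z \<times> ?Z \<times> ?Z))" by simp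
  moreover have "freqs lam \<subseteq> (\<lambda>(a, b, c). vector [a, b, c]) ` (?Z \<times> ?Z \<times> ?Z)"
  proof
    fix k assume k: "k \<in> freqs lam"
    then have "k $ i \<in> ?Z" for i
      using component_le_norm_cart[of k i] by (auto simp: freqs_def int_vec_def)
    moreover have "k = vector [k $ 1, k $ 2, k $ 3]" by (simp add: vec_eq_iff forall_3)
    ultimately show "k \<in> (\<lambda>(a, b, c). vector [a, b, c]) ` (?Z \<times> ?Z \<times> ?Z)"
      by (intro image_eqI[of _ _ "(k $ 1, k $ 2, k $ 3)"]) auto
  qed
  ultimately show ?thesis by (rule finite_subset[rotated])
qed

unbundle cross3_syntax

text \<open>A circularly polarised (Beltrami) plane wave: for \<open>a\<close> orthogonal to
  \<open>k\<close> and \<open>norm k = lam\<close>, the two amplitudes are orthogonal and of equal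
  length, and the sign fixes the handedness belonging to the eigenvalue
  \<open>+ lam\<close>.\<close>

definition wave :: "real \<Rightarrow> real^3 \<Rightarrow> real^3 \<Rightarrow> real^3 \<Rightarrow> real^3"
  where "wave lam k a x = cos (k \<bullet> x) *\<^sub>R a - (sin (k \<bullet> x) / lam) *\<^sub>R (k \<times> a)"

text \<open>The derivative of \<^const>\<open>wave\<close> with respect to the phase \<open>k \<bullet> x\<close>.\<close>

definition wave' :: "real \<Rightarrow> real^3 \<Rightarrow> real^3 \<Rightarrow> real^3 \<Rightarrow> real^3"
  where "wave' lam k a x = - sin (k \<bullet> x) *\<^sub>R a - (cos (k \<bullet> x) / lam) *\<^sub>R (k \<times> a)"

text \<open>The amplitudes are not determined by the field: \<open>k\<close> and \<open>- k\<close>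
  carry the same wave, so for each such pair just the sum \<open>A k + A (- k)\<close>
  matters.\<close>

definition field :: "real \<Rightarrow> (real^3 \<Rightarrow> real^3) \<Rightarrow> real^3 \<Rightarrow> real^3"
  where "field lam A x = (\<Sum>k\<in>freqs lam. wave lam k (A k) x)"

lemma freqs_minus [simp]: "- k \<in> freqs lam \<longleftrightarrow> k \<in> freqs lam"
  by (simp add: freqs_def)

lemma cross_cross_self: "k \<times> (k \<times> a) = (k \<bullet> a) *\<^sub>R k - (k \<bullet> k) *\<^sub>R a"
  by (simp add: cross3_simps forall_3)

lemma freqs_cross_cross:
  "k \<in> freqs lam \<Longrightarrow> k \<bullet> a = 0 \<Longrightarrow> k \<times> (k \<times> a) = - (lam\<^sup>2 *\<^sub>R a)"
  by (simp add: cross_cross_self freqs_def power2_norm_eq_inner[symmetric])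

lemma wave_has_derivative: "(wave lam k a has_derivative (\<lambda>h. (k \<bullet> h) *\<^sub>R wave' lam k a x)) (at x)"
  unfolding wave_def[abs_def] wave'_def divide_inverse
  by (auto intro!: derivative_eq_intros simp: algebra_simps)

lemma wave'_has_derivative: "(wave' lam k a has_derivative (\<lambda>h. - (k \<bullet> h) *\<^sub>R wave lam k a x)) (at x)"
  unfolding wave_def wave'_def[abs_def] divide_inverse
  by (auto intro!: derivative_eq_intros simp: algebra_simps)

lemma field_has_derivative:
  "(field lam A has_derivative (\<lambda>h. \<Sum>k\<in>freqs lam. (k \<bullet> h) *\<^sub>R wave' lam k (A k) x)) (at x)"
  unfolding field_def[abs_def] by (intro has_derivative_sum wave_has_derivative)

lemma field_jacobian:
  "jacobian (field lam A) (at x) $ i $ j = (\<Sum>k\<in>freqs lam. k $ j * wave' lam k (A k) x $ i)"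
  unfolding jacobian_def frechet_derivative_at[OF field_has_derivative, symmetric]
  by (simp add: matrix_def inner_axis)

text \<open>On a function of the phase \<open>k \<bullet> x\<close> the curl is
  \<open>k \<times>\<close> the phase derivative, and on the plane orthogonal to \<open>k\<close>
  applying \<open>k \<times>\<close> twice is multiplication by - lam^2.\<close>

lemma field_curl:
  assumes lam: "lam > 0" and A: "\<And>k. k \<in> freqs lam \<Longrightarrow> k \<bullet> A k = 0"
  shows "curl (field lam A) x = lam *\<^sub>R field lam A x"
proof -
  have "k \<times> wave' lam k (A k) x = lam *\<^sub>R wave lam k (A k) x" if "k \<in> freqs lam" for k
    using freqs_cross_cross[OF that A[OF that]] lam
    by (simp add: wave'_def wave_def Cross3.right_diff_distrib cross_mult_right algebra_simps power2_eq_square)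
  then have "lam *\<^sub>R field lam A x = (\<Sum>k\<in>freqs lam. k \<times> wave' lam k (A k) x)"
    by (simp add: field_def scaleR_sum_right)
  also have "\<dots> = curl (field lam A) x"
    by (simp add: curl_def Let_def vec_eq_iff forall_3 cross_components field_jacobian sum_subtractf mult.commute)
  finally show ?thesis by simp
qed

lemma field_in_E_plus:
  assumes lam: "lam > 0" and A: "\<And>k. k \<in> freqs lam \<Longrightarrow> k \<bullet> A k = 0"
  shows "field lam A \<in> E_plus lam"
proof -
  have "periodic (field lam A)"
    using periodic_cos_sin by (simp add: periodic_def field_def wave_def freqs_def)
  moreover have "real_analytic (\<lambda>x. field lam A x $ i)" for i
  proof (cases "freqs lam = {}")
    case True
    then show ?thesis using real_analytic_wave[of 0 "0::real^3" 0] by (simp add: field_def)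
  next
    case False
    have "field lam A x $ i = (\<Sum>k\<in>freqs lam. A k $ i * cos (k \<bullet> x) + (- (k \<times> A k) $ i / lam) * sin (k \<bullet> x))" for x
      by (simp add: field_def wave_def mult.commute)
    then show ?thesis using False by (simp only:) (intro real_analytic_sum real_analytic_wave finite_freqs)
  qed
  ultimately show ?thesis using field_curl[OF assms] by (auto simp: E_plus_def)
qed

text \<open>Integration by parts needs continuous first derivatives; analyticity of the components
  provides them.\<close>

lemma E_plus_C1:
  assumes "W \<in> E_plus lam"
  shows "(W has_derivative (\<lambda>h. jacobian W (at x) *v h)) (at x)"
    and "continuous_on UNIV (\<lambda>x. jacobian W (at x) $ i $ j)"
proof -
  have "\<exists>G. (\<forall>j::3. continuous_on UNIV (G j)) \<and>
     (\<forall>x. ((\<lambda>x. W x $ i) has_derivative (\<lambda>h. \<Sum>j\<in>UNIV. h $ j * G j x)) (at x))" for i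
  proof -
    have "real_analytic (\<lambda>x. W x $ i)" using assms by (simp add: E_plus_def)
    then show ?thesis by (rule real_analytic_C1) blast
  qed
  then have "\<forall>i. \<exists>G. (\<forall>j::3. continuous_on UNIV (G j)) \<and>
     (\<forall>x. ((\<lambda>x. W x $ i) has_derivative (\<lambda>h. \<Sum>j\<in>UNIV. h $ j * G j x)) (at x))" by (rule allI)
  from choice[OF this] obtain G where G: "\<And>i j. continuous_on UNIV (G i j)"
     "\<And>i x. ((\<lambda>x. W x $ i) has_derivative (\<lambda>h. \<Sum>j\<in>UNIV. h $ j * G i j x)) (at x)" by blast
  define D where "D x = (\<chi> i j. G i j x)" for x
  have D: "(W has_derivative (\<lambda>h. D x *v h)) (at x)" for x
  proof -
    have "((\<lambda>x. \<Sum>i\<in>UNIV. (W x $ i) *\<^sub>R axis i 1) has_derivative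
        (\<lambda>h. \<Sum>i\<in>UNIV. (\<Sum>j\<in>UNIV. h $ j * G i j x) *\<^sub>R (axis i 1 :: real^3))) (at x)"
      by (intro has_derivative_sum has_derivative_scaleR_left G)
    moreover have "(\<Sum>i\<in>UNIV. (v $ i) *\<^sub>R axis i 1) = v" for v :: "real^3"
      by (simp add: vec_eq_iff axis_def if_distrib cong: if_cong)
    moreover have "(\<Sum>i\<in>UNIV. (\<Sum>j\<in>UNIV. h $ j * G i j x) *\<^sub>R (axis i 1 :: real^3)) = D x *v h" for h
      by (simp add: vec_eq_iff axis_def D_def matrix_vector_mult_def mult.commute if_distrib cong: if_cong)
    ultimately show ?thesis by simp
  qed
  have J: "jacobian W (at x) = D x" for x
    unfolding jacobian_def frechet_derivative_at[OF D, symmetric] by simp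
  show "(W has_derivative (\<lambda>h. jacobian W (at x) *v h)) (at x)" using D J by simp
  show "continuous_on UNIV (\<lambda>x. jacobian W (at x) $ i $ j)" using G(1) by (simp add: J D_def)
qed

lemma has_derivative_imp_directional:
  fixes f :: "real^'n \<Rightarrow> real"
  assumes "(f has_derivative f') (at x)"
  shows "((\<lambda>s. f (x + axis j s)) has_real_derivative f' (axis j 1)) (at 0)"
proof -
  have ax: "axis j s = s *\<^sub>R (axis j 1 :: real^'n)" for s by (simp add: vec_eq_iff axis_def)
  have "((\<lambda>s. f (x + s *\<^sub>R axis j 1)) has_derivative (\<lambda>s. f' (s *\<^sub>R axis j 1))) (at 0)"
    using assms by (auto intro!: derivative_eq_intros has_derivative_compose[where g = f, of _ _ 0])
  moreover have "(\<lambda>s. f' (s *\<^sub>R axis j 1)) = (*) (f' (axis j 1))"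
    using linear_scale[OF has_derivative_linear[OF assms]] by (auto simp: mult.commute)
  ultimately show ?thesis by (subst ax) (simp add: has_field_derivative_def)
qed

text \<open>With \<open>A\<close> and \<open>S\<close> the cosine and sine coefficients of \<open>W\<close>, integration by parts turns the
  equation \<open>curl W = lam W\<close> into \<open>lam A = k \<times> S\<close> and \<open>lam S = - k \<times> A\<close>.\<close>

lemma E_plus_fourier:
  assumes W: "W \<in> E_plus lam" and k: "int_vec k"
  defines "A \<equiv> \<chi> i. integral cell (\<lambda>x. W x $ i * cos (k \<bullet> x))"
    and "S \<equiv> \<chi> i. integral cell (\<lambda>x. W x $ i * sin (k \<bullet> x))"
  shows "lam *\<^sub>R A = k \<times> S" "lam *\<^sub>R S = - (k \<times> A)"
proof -
  define D where "D x = jacobian W (at x)" for x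
  have D: "\<And>x. (W has_derivative (\<lambda>h. D x *v h)) (at x)" "\<And>i j. continuous_on UNIV (\<lambda>x. D x $ i $ j)"
    using E_plus_C1[OF W] by (simp_all add: D_def)
  have Wc: "continuous_on UNIV W"
    by (intro continuous_at_imp_continuous_on ballI has_derivative_continuous[OF D(1)])
  have Wp: "W (x + axis j (2 * pi)) = W x" for x j using W by (simp add: E_plus_def periodic_def)
  have Wd: "((\<lambda>x. W x $ i) has_derivative (\<lambda>h. (D x *v h) $ i)) (at x)" for x i
    by (rule bounded_linear.has_derivative[OF bounded_linear_vec_nth D(1)])
  have Dj: "(D x *v axis j 1) $ i = D x $ i $ j" for x i j
    by (simp add: matrix_vector_mult_basis column_def)
  have kx: "((\<lambda>x. k \<bullet> x) has_derivative (\<lambda>h. k \<bullet> h)) (at x)" for x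
    by (auto intro!: derivative_eq_intros)
  have "integral cell (\<lambda>x. D x $ i $ j * cos (k \<bullet> x) - k $ j * (W x $ i * sin (k \<bullet> x))) = 0" for i j
  proof (rule integral_cell_derivative_eq_0[where j = j])
    have "((\<lambda>x. W x $ i * cos (k \<bullet> x)) has_derivative
       (\<lambda>h. W x $ i * ((k \<bullet> h) * - sin (k \<bullet> x)) + (D x *v h) $ i * cos (k \<bullet> x))) (at x)" for x
      by (intro has_derivative_mult Wd has_derivative_cos kx)
    from has_derivative_imp_directional[OF this]
    show "((\<lambda>s. W (x + axis j s) $ i * cos (k \<bullet> (x + axis j s))) has_real_derivative
       D x $ i $ j * cos (k \<bullet> x) - k $ j * (W x $ i * sin (k \<bullet> x))) (at 0)" for x
      by (rule DERIV_cong) (simp add: Dj inner_axis)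
    show "periodic (\<lambda>x. W x $ i * cos (k \<bullet> x))"
      using Wp periodic_cos_sin(1)[OF k] by (simp add: periodic_def)
  qed (intro continuous_intros D(2) Wc)
  then have 1: "integral cell (\<lambda>x. D x $ i $ j * cos (k \<bullet> x)) = k $ j * S $ i" for i j
    by (subst (asm) integral_diff) (auto simp: S_def intro!: cell_integrable continuous_intros D(2) Wc)
  have "integral cell (\<lambda>x. D x $ i $ j * sin (k \<bullet> x) + k $ j * (W x $ i * cos (k \<bullet> x))) = 0" for i j
  proof (rule integral_cell_derivative_eq_0[where j = j])
    have "((\<lambda>x. W x $ i * sin (k \<bullet> x)) has_derivative
       (\<lambda>h. W x $ i * ((k \<bullet> h) * cos (k \<bullet> x)) + (D x *v h) $ i * sin (k \<bullet> x))) (at x)" for x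
      by (intro has_derivative_mult Wd has_derivative_sin kx)
    from has_derivative_imp_directional[OF this]
    show "((\<lambda>s. W (x + axis j s) $ i * sin (k \<bullet> (x + axis j s))) has_real_derivative
       D x $ i $ j * sin (k \<bullet> x) + k $ j * (W x $ i * cos (k \<bullet> x))) (at 0)" for x
      by (rule DERIV_cong) (simp add: Dj inner_axis)
    show "periodic (\<lambda>x. W x $ i * sin (k \<bullet> x))"
      using Wp periodic_cos_sin(2)[OF k] by (simp add: periodic_def)
  qed (intro continuous_intros D(2) Wc)
  then have 2: "integral cell (\<lambda>x. D x $ i $ j * sin (k \<bullet> x)) = - k $ j * A $ i" for i j
    by (subst (asm) integral_add) (auto simp: A_def eq_neg_iff_add_eq_0 intro!: cell_integrable continuous_intros D(2) Wc)
  have curl: "lam * W x $ 1 = D x $ 3 $ 2 - D x $ 2 $ 3" "lam * W x $ 2 = D x $ 1 $ 3 - D x $ 3 $ 1"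
    "lam * W x $ 3 = D x $ 2 $ 1 - D x $ 1 $ 2" for x
  proof -
    have "curl W x = lam *\<^sub>R W x" using W by (simp add: E_plus_def)
    then show "lam * W x $ 1 = D x $ 3 $ 2 - D x $ 2 $ 3" "lam * W x $ 2 = D x $ 1 $ 3 - D x $ 3 $ 1"
      "lam * W x $ 3 = D x $ 2 $ 1 - D x $ 1 $ 2"
      by (simp_all add: curl_def Let_def D_def vec_eq_iff forall_3)
  qed
  have I: "integral cell (\<lambda>x. (lam * W x $ i) * t x) = lam * integral cell (\<lambda>x. W x $ i * t x)" for i t
    by (simp add: mult.assoc)
  have J: "integral cell (\<lambda>x. (D x $ i $ j - D x $ i' $ j') * t x)
    = integral cell (\<lambda>x. D x $ i $ j * t x) - integral cell (\<lambda>x. D x $ i' $ j' * t x)"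
    if "continuous_on UNIV t" for t i j i' j'
    unfolding left_diff_distrib by (rule integral_diff) (auto intro!: cell_integrable continuous_intros D(2) that)
  have c: "continuous_on UNIV (\<lambda>x. cos (k \<bullet> x))" "continuous_on UNIV (\<lambda>x. sin (k \<bullet> x))"
    by (intro continuous_intros)+
  have "lam * A $ i = (k \<times> S) $ i" for i
    using exhaust_3[of i]
    by (auto simp: A_def cross_components I[symmetric] curl J[OF c(1)] 1 simp del: integral_mult_right integral_cmul)
  then show "lam *\<^sub>R A = k \<times> S" by (simp add: vec_eq_iff)
  have "lam * S $ i = (- (k \<times> A)) $ i" for i
    using exhaust_3[of i]
    by (auto simp: S_def cross_components I[symmetric] curl J[OF c(2)] 2 simp del: integral_mult_right integral_cmul)
  note S = this
  show "lam *\<^sub>R S = - (k \<times> A)"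
    by (subst vec_eq_iff, intro allI, unfold vector_scaleR_component real_scaleR_def) (rule S)
qed

lemma E_plus_imp_field:
  assumes lam: "lam > 0" and W: "W \<in> E_plus lam"
  obtains A where "\<forall>k\<in>freqs lam. k \<bullet> A k = 0" "W = field lam A"
proof -
  define A where "A k = (\<chi> i. integral cell (\<lambda>x. W x $ i * cos (k \<bullet> x)))" for k
  define S where "S k = (\<chi> i. integral cell (\<lambda>x. W x $ i * sin (k \<bullet> x)))" for k
  have AS: "lam *\<^sub>R A k = k \<times> S k" "lam *\<^sub>R S k = - (k \<times> A k)" if "int_vec k" for k
    using E_plus_fourier[OF W that] by (simp_all add: A_def S_def)
  have kA: "k \<bullet> A k = 0" if "int_vec k" for k
  proof -
    have "lam * (k \<bullet> A k) = k \<bullet> (k \<times> S k)" using AS(1)[OF that] by (metis inner_scaleR_right)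
    then show ?thesis using lam by (simp add: dot_cross_self)
  qed
  have S: "S k = - ((1 / lam) *\<^sub>R (k \<times> A k))" if "int_vec k" for k
  proof -
    have "(1 / lam) *\<^sub>R (lam *\<^sub>R S k) = S k" using lam by simp
    then show ?thesis using AS(2)[OF that] by simp
  qed
  have A0: "A k = 0" if "int_vec k" "k \<notin> freqs lam" for k
  proof -
    \<comment> \<open>Inserting one coefficient relation into the other gives lam^2 A = |k|^2 A for
      \<open>A\<close> orthogonal to \<open>k\<close>, so the coefficient vanishes off the sphere of
      radius \<open>lam\<close>.\<close>
    have "lam\<^sup>2 *\<^sub>R A k = lam *\<^sub>R (k \<times> S k)" by (simp add: power2_eq_square AS(1)[OF that(1), symmetric])
    also have "\<dots> = k \<times> (lam *\<^sub>R S k)" by (simp add: cross_mult_right)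
    also have "\<dots> = (norm k)\<^sup>2 *\<^sub>R A k"
      by (simp add: AS(2)[OF that(1)] cross_cross_self kA[OF that(1)] power2_norm_eq_inner)
    finally have "(lam\<^sup>2 - (norm k)\<^sup>2) *\<^sub>R A k = 0" by (simp add: algebra_simps)
    moreover have "norm k \<noteq> lam" using that by (simp add: freqs_def)
    then have "(norm k)\<^sup>2 \<noteq> lam\<^sup>2" using lam by (simp add: power2_eq_iff_nonneg)
    ultimately show ?thesis by simp
  qed
  have Wc: "continuous_on UNIV (\<lambda>x. W x $ i)" for i
  proof -
    have "continuous_on UNIV W"
      by (intro continuous_at_imp_continuous_on ballI has_derivative_continuous[OF E_plus_C1(1)[OF W]])
    then show ?thesis by (intro continuous_intros)
  qed
  have Wp: "periodic (\<lambda>x. W x $ i)" for i using W by (simp add: E_plus_def periodic_def)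
  have "W x = field lam (\<lambda>k. (1 / cell_volume) *\<^sub>R A k) x" for x
  proof -
    have "W x $ i = (\<Sum>k\<in>freqs lam. (A k $ i / cell_volume) * cos (k \<bullet> x) + (S k $ i / cell_volume) * sin (k \<bullet> x))" for i
      unfolding A_def S_def vec_lambda_beta
    proof (rule fourier_finite_support[OF Wc Wp finite_freqs])
      fix k assume k: "int_vec k" "k \<notin> freqs lam"
      show "integral cell (\<lambda>x. W x $ i * cos (k \<bullet> x)) = 0"
        using A0[OF k] by (simp add: A_def vec_eq_iff)
      show "integral cell (\<lambda>x. W x $ i * sin (k \<bullet> x)) = 0"
        using S[OF k(1)] A0[OF k] by (simp add: S_def vec_eq_iff)
    qed (auto simp: freqs_def)
    also have "(\<Sum>k\<in>freqs lam. (A k $ i / cell_volume) * cos (k \<bullet> x) + (S k $ i / cell_volume) * sin (k \<bullet> x))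
      = field lam (\<lambda>k. (1 / cell_volume) *\<^sub>R A k) x $ i" for i
      unfolding field_def sum_component wave_def
      by (intro sum.cong refl) (simp add: freqs_def S cross_mult_right divide_inverse algebra_simps del: integral_const)
    finally show ?thesis by (simp only: vec_eq_iff) blast
  qed
  moreover have "k \<bullet> ((1 / cell_volume) *\<^sub>R A k) = 0" if "k \<in> freqs lam" for k
    using that kA by (simp add: freqs_def)
  ultimately show ?thesis by (intro that[of "\<lambda>k. (1 / cell_volume) *\<^sub>R A k"]) auto
qed

section \<open>Dimension of the eigenspaces\<close>

lemma sum_fun_apply: "(\<Sum>i\<in>I. f i) x = (\<Sum>i\<in>I. f i x)"
  by (induction I rule: infinite_finite_induct) auto

lemma E_plus_eq_fields:
  assumes "lam > 0"
  shows "E_plus lam = {field lam A | A. \<forall>k\<in>freqs lam. k \<bullet> A k = 0}"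
proof (intro equalityI subsetI)
  fix W assume "W \<in> E_plus lam"
  then show "W \<in> {field lam A | A. \<forall>k\<in>freqs lam. k \<bullet> A k = 0}"
    by (rule E_plus_imp_field[OF assms]) blast
qed (use field_in_E_plus[OF assms] in auto)

lemma wave_add: "wave lam k (a + b) x = wave lam k a x + wave lam k b x"
  by (simp add: wave_def cross_add_right algebra_simps)

lemma wave_scaleR: "wave lam k (c *\<^sub>R a) x = c *\<^sub>R wave lam k a x"
  by (simp add: wave_def cross_mult_right algebra_simps)

lemma wave_0 [simp]: "wave lam k 0 x = 0"
  by (simp add: wave_def)

lemma wave_minus: "wave lam (- k) a = wave lam k a"
  by (simp add: wave_def fun_eq_iff)

lemma subspace_E_plus:
  assumes "lam > 0"
  shows "subspace (E_plus lam)"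
proof (rule subspaceI)
  show "0 \<in> E_plus lam"
  proof -
    have "(0 :: real^3 \<Rightarrow> real^3) = field lam (\<lambda>_. 0)" by (simp add: fun_eq_iff field_def)
    also have "field lam (\<lambda>_. 0) \<in> E_plus lam" by (rule field_in_E_plus[OF assms]) simp
    finally show ?thesis .
  qed
next
  fix V W assume "V \<in> E_plus lam" "W \<in> E_plus lam"
  then obtain A B where A: "\<forall>k\<in>freqs lam. k \<bullet> A k = 0" "V = field lam A"
    and B: "\<forall>k\<in>freqs lam. k \<bullet> B k = 0" "W = field lam B"
    unfolding E_plus_eq_fields[OF assms] by blast
  have "V + W = field lam (\<lambda>k. A k + B k)"
    by (simp add: A B field_def fun_eq_iff wave_add sum.distrib)
  then show "V + W \<in> E_plus lam" using A B by (simp add: field_in_E_plus[OF assms] inner_add_right)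
next
  fix c V assume "V \<in> E_plus lam"
  then obtain A where A: "\<forall>k\<in>freqs lam. k \<bullet> A k = 0" "V = field lam A"
    unfolding E_plus_eq_fields[OF assms] by blast
  have "c *\<^sub>R V = field lam (\<lambda>k. c *\<^sub>R A k)"
    by (simp add: A field_def fun_eq_iff wave_scaleR scaleR_fun_def scaleR_sum_right)
  then show "c *\<^sub>R V \<in> E_plus lam" using A by (simp add: field_in_E_plus[OF assms])
qed

lemma wave_in_E_plus:
  assumes "lam > 0" "k \<in> freqs lam" "k \<bullet> a = 0"
  shows "wave lam k a \<in> E_plus lam"
proof -
  have "wave lam k a = field lam (\<lambda>l. if l = k then a else 0)"
    using assms(2) finite_freqs
    by (simp add: field_def fun_eq_iff if_distrib[of "\<lambda>a. wave lam _ a _"] cong: if_cong)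
  then show ?thesis using assms by (simp add: field_in_E_plus)
qed

text \<open>\<open>polar (- k) = polar k\<close>, so the two modes at \<open>k\<close> and \<open>- k\<close> have the amplitudes \<open>e + h\<close> and
  \<open>e - h\<close>, with \<open>e\<close> and \<open>h\<close> orthogonal, and together span the waves with frequencies \<open>\<plusminus>k\<close>.\<close>

definition polar :: "real^3 \<Rightarrow> real^3" where "polar k = (SOME e. e \<noteq> 0 \<and> k \<bullet> e = 0)"

definition amplitude :: "real \<Rightarrow> real^3 \<Rightarrow> real^3"
  where "amplitude lam k = polar k + (1 / lam) *\<^sub>R (k \<times> polar k)"

definition mode :: "real \<Rightarrow> real^3 \<Rightarrow> real^3 \<Rightarrow> real^3"
  where "mode lam k = wave lam k (amplitude lam k)"

lemma polar: "polar k \<noteq> 0" "k \<bullet> polar k = 0"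
proof -
  obtain e where "e \<noteq> 0" "orthogonal k e" by (rule orthogonal_to_vector_exists[of k]) simp
  then have "e \<noteq> 0 \<and> k \<bullet> e = 0" by (simp add: orthogonal_def)
  then have "polar k \<noteq> 0 \<and> k \<bullet> polar k = 0" unfolding polar_def by (rule someI)
  then show "polar k \<noteq> 0" "k \<bullet> polar k = 0" by auto
qed

lemma polar_minus: "polar (- k) = polar k"
  by (simp add: polar_def)

lemma amplitude_minus: "amplitude lam (- k) = polar k - (1 / lam) *\<^sub>R (k \<times> polar k)"
  by (simp add: amplitude_def polar_minus)

lemma amplitude_orthogonal: "k \<bullet> amplitude lam k = 0"
  by (simp add: amplitude_def inner_add_right polar dot_cross_self)

lemma cross_polar_ne_0: "k \<noteq> 0 \<Longrightarrow> k \<times> polar k \<noteq> 0"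
  using norm_and_cross_eq_0[of k "polar k"] polar by auto

text \<open>The vectors \<open>k\<close>, \<open>e\<close> and \<open>h\<close> form an orthogonal
  frame, so \<open>a\<close> is the sum of its projections to \<open>e\<close> and \<open>h\<close>,
  and these two are combinations of the amplitudes at \<open>k\<close> and
  \<open>- k\<close>.\<close>

lemma amplitudes_span:
  assumes lam: "lam > 0" and k: "k \<in> freqs lam" and a: "k \<bullet> a = 0"
  obtains p q where "a = p *\<^sub>R amplitude lam k + q *\<^sub>R amplitude lam (- k)"
proof -
  define e h where "e = polar k" and "h = k \<times> polar k"
  have k0: "k \<noteq> 0" using k lam by (auto simp: freqs_def)
  have e: "e \<noteq> 0" "k \<bullet> e = 0" and h: "h \<noteq> 0" "k \<bullet> h = 0" "e \<bullet> h = 0"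
    using polar[of k] cross_polar_ne_0[OF k0] by (simp_all add: e_def h_def dot_cross_self)
  define p q where "p = (a \<bullet> e) / (e \<bullet> e)" and "q = (a \<bullet> h) / (h \<bullet> h)"
  define r where "r = a - p *\<^sub>R e - q *\<^sub>R h"
  have r: "k \<bullet> r = 0" "e \<bullet> r = 0" "h \<bullet> r = 0"
    using e h a by (simp_all add: r_def p_def q_def inner_diff_right inner_commute[of _ a] inner_commute[of h e])
  \<comment> \<open>The double cross product identity makes the remainder \<open>r\<close> parallel
    to \<open>h\<close>; being also orthogonal to \<open>h \<noteq> 0\<close>, it vanishes.\<close>
  have "r \<times> h = (r \<bullet> e) *\<^sub>R k - (r \<bullet> k) *\<^sub>R e"
    unfolding h_def e_def by (simp add: cross3_simps forall_3)
  then have "r \<times> h = 0" "r \<bullet> h = 0" using r by (simp_all add: inner_commute)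
  then have "r = 0" using norm_and_cross_eq_0[of r h] h(1) by auto
  then have "a = p *\<^sub>R e + q *\<^sub>R h" by (simp add: r_def algebra_simps)
  \<comment> \<open>Half the sum of the two amplitudes is \<open>e\<close>, and
    \<open>lam / 2\<close> times their difference is \<open>h\<close>.\<close>
  also have "\<dots> = ((p + q * lam) / 2) *\<^sub>R amplitude lam k + ((p - q * lam) / 2) *\<^sub>R amplitude lam (- k)"
  proof -
    have amp: "amplitude lam k = e + (1 / lam) *\<^sub>R h" "amplitude lam (- k) = e - (1 / lam) *\<^sub>R h"
      unfolding amplitude_minus by (simp_all add: amplitude_def e_def h_def)
    show ?thesis unfolding amp using lam by (simp add: vec_eq_iff field_simps)
  qed
  finally show ?thesis by (rule that)
qed

lemma E_plus_subset_span_modes: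
  assumes lam: "lam > 0"
  shows "E_plus lam \<subseteq> span (mode lam ` freqs lam)"
proof
  fix W assume "W \<in> E_plus lam"
  then obtain A where A: "\<And>k. k \<in> freqs lam \<Longrightarrow> k \<bullet> A k = 0" "W = field lam A"
    using E_plus_eq_fields[OF lam] by blast
  have "wave lam k (A k) \<in> span (mode lam ` freqs lam)" if k: "k \<in> freqs lam" for k
  proof -
    obtain p q where pq: "A k = p *\<^sub>R amplitude lam k + q *\<^sub>R amplitude lam (- k)"
      using amplitudes_span[OF lam k A(1)[OF k]] by blast
    \<comment> \<open>By \<open>wave_minus\<close>, the wave at \<open>k\<close> with the amplitude
      belonging to \<open>- k\<close> is the mode at \<open>- k\<close>.\<close>
    have "wave lam k (A k) = p *\<^sub>R mode lam k + q *\<^sub>R mode lam (- k)"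
      by (simp add: fun_eq_iff pq wave_add wave_scaleR mode_def wave_minus scaleR_fun_def)
    then show ?thesis using k by (simp add: span_add span_scale span_base)
  qed
  moreover have "W = (\<Sum>k\<in>freqs lam. wave lam k (A k))"
    by (simp add: A fun_eq_iff field_def sum_fun_apply)
  ultimately show "W \<in> span (mode lam ` freqs lam)" by (simp add: span_sum)
qed

lemma modes_in_E_plus: "lam > 0 \<Longrightarrow> mode lam ` freqs lam \<subseteq> E_plus lam"
  by (auto simp: mode_def intro!: wave_in_E_plus amplitude_orthogonal)

text \<open>Independence is a property of sets; stated for families, vanishing of coefficients also
  excludes repetitions, and both facts enter the dimension count.\<close>

lemma independent_family:
  fixes f :: "'i \<Rightarrow> 'v::real_vector"
  assumes I: "finite I" and c: "\<And>c i. (\<Sum>i\<in>I. c i *\<^sub>R f i) = 0 \<Longrightarrow> i \<in> I \<Longrightarrow> c i = 0"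
  shows "independent (f ` I)" "inj_on f I"
proof -
  show inj: "inj_on f I"
  proof (rule inj_onI, rule ccontr)
    fix i j assume ij: "i \<in> I" "j \<in> I" "f i = f j" "i \<noteq> j"
    have "(\<Sum>l\<in>I. (of_bool (l = i) - of_bool (l = j)) *\<^sub>R f l) = (\<Sum>l\<in>I. (if l = i then f l else 0) - (if l = j then f l else 0))"
      by (intro sum.cong) auto
    also have "\<dots> = 0" using ij I by (simp add: sum_subtractf)
    finally show False using c[of "\<lambda>l. of_bool (l = i) - of_bool (l = j)" i] ij by simp
  qed
  show "independent (f ` I)"
  proof (rule independent_if_scalars_zero)
    fix g v assume 0: "(\<Sum>x\<in>f ` I. g x *\<^sub>R x) = 0" and v: "v \<in> f ` I"
    from v obtain i where i: "i \<in> I" "v = f i" by blast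
    have "(\<Sum>i\<in>I. g (f i) *\<^sub>R f i) = 0" using 0 by (simp add: sum.reindex[OF inj])
    from c[OF this i(1)] show "g v = 0" using i(2) by simp
  qed (use I in simp)
qed

text \<open>Testing a vanishing combination against cos (l.x) leaves the amplitudes at
  \<open>l\<close> and \<open>- l\<close>. Their components along the orthogonal vectors
  \<open>polar l\<close> and \<open>l \<times> polar l\<close> carry \<open>c l + c (- l)\<close>
  and \<open>c l - c (- l)\<close>, so both are 0.\<close>

lemma modes_independent:
  assumes lam: "lam > 0"
  shows "independent (mode lam ` freqs lam)" "inj_on (mode lam) (freqs lam)"
proof -
  have "c l = 0" if 0: "(\<Sum>k\<in>freqs lam. c k *\<^sub>R mode lam k) = 0" and l: "l \<in> freqs lam" for c l
  proof -
    let ?b = "\<lambda>k i. c k * (- (k \<times> amplitude lam k) $ i / lam)"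
    have "(\<Sum>k\<in>freqs lam. (c k *\<^sub>R amplitude lam k) $ i * cos (k \<bullet> x) + ?b k i * sin (k \<bullet> x)) = 0" for x i
    proof -
      have "(\<Sum>k\<in>freqs lam. c k *\<^sub>R mode lam k x) = 0"
        using fun_cong[OF 0, of x] by (simp add: sum_fun_apply scaleR_fun_def)
      then have "(\<Sum>k\<in>freqs lam. c k *\<^sub>R mode lam k x) $ i = 0" by simp
      then show ?thesis by (simp add: mode_def wave_def algebra_simps)
    qed
    note 1 = this
    have "cell_volume / 2 * ((c l *\<^sub>R amplitude lam l) $ i + (c (- l) *\<^sub>R amplitude lam (- l)) $ i)
      = integral cell (\<lambda>x. (\<Sum>k\<in>freqs lam. (c k *\<^sub>R amplitude lam k) $ i * cos (k \<bullet> x) + ?b k i * sin (k \<bullet> x)) * cos (l \<bullet> x))" for i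
      using l by (subst integral_cell_trig_sum(1)[OF finite_freqs]) (auto simp: freqs_def simp del: integral_const)
    then have "cell_volume / 2 * ((c l *\<^sub>R amplitude lam l) $ i + (c (- l) *\<^sub>R amplitude lam (- l)) $ i) = 0" for i
      by (simp only: 1 mult_zero_left integral_0)
    then have "c l *\<^sub>R amplitude lam l + c (- l) *\<^sub>R amplitude lam (- l) = 0"
      using cell_volume_pos by (simp add: vec_eq_iff del: integral_const)
    then have *: "(c l + c (- l)) *\<^sub>R polar l + ((c l - c (- l)) / lam) *\<^sub>R (l \<times> polar l) = 0"
      by (simp add: amplitude_minus amplitude_def polar_minus algebra_simps diff_divide_distrib)
    have "l \<noteq> 0" using l lam by (auto simp: freqs_def)
    note ne = polar(1)[of l] cross_polar_ne_0[OF this]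
    have "(c l + c (- l)) * (polar l \<bullet> polar l) = 0"
      using arg_cong[OF *, of "\<lambda>v. polar l \<bullet> v"] by (simp add: inner_add_right dot_cross_self)
    moreover have "(c l - c (- l)) / lam * ((l \<times> polar l) \<bullet> (l \<times> polar l)) = 0"
      using arg_cong[OF *, of "\<lambda>v. (l \<times> polar l) \<bullet> v"] by (simp add: inner_add_right dot_cross_self)
    ultimately show "c l = 0" using ne lam by simp
  qed
  note c = this
  show "independent (mode lam ` freqs lam)" by (rule independent_family(1)[OF finite_freqs]) (rule c)
  show "inj_on (mode lam) (freqs lam)" by (rule independent_family(2)[OF finite_freqs]) (rule c)
qed

lemma dim_E_plus:
  assumes "lam > 0"
  shows "dim (E_plus lam) = card (freqs lam)"
proof (rule dim_unique)
  show "mode lam ` freqs lam \<subseteq> E_plus lam" by (rule modes_in_E_plus[OF assms])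
  show "E_plus lam \<subseteq> span (mode lam ` freqs lam)" by (rule E_plus_subset_span_modes[OF assms])
  show "independent (mode lam ` freqs lam)" by (rule modes_independent[OF assms])
  show "card (mode lam ` freqs lam) = card (freqs lam)"
    by (rule card_image[OF modes_independent(2)[OF assms]])
qed

text \<open>Three integer squares add up to 2 exactly when one entry is 0 and the others are 1 or
  -1: 3 positions times 4 sign choices.\<close>

lemma card_freqs_sqrt2: "card (freqs (sqrt 2)) = 12"
proof -
  define T :: "(int \<times> int \<times> int) set" where
    "T = {(1,1,0), (1,-1,0), (-1,1,0), (-1,-1,0), (1,0,1), (1,0,-1), (-1,0,1), (-1,0,-1), (0,1,1), (0,1,-1), (0,-1,1), (0,-1,-1)}"
  define v where "v = (\<lambda>(a, b, c). vector [of_int a, of_int b, of_int c] :: real^3)"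
  have sq: "n \<in> {-1, 0, 1}" if "n\<^sup>2 \<le> 2" for n :: int
  proof -
    have "\<bar>n\<bar> < 2" by (rule power2_less_imp_less[of _ 2]) (use that in auto)
    then show ?thesis by auto
  qed
  have n: "norm k = sqrt 2 \<longleftrightarrow> (k $ 1)\<^sup>2 + (k $ 2)\<^sup>2 + (k $ 3)\<^sup>2 = 2" for k :: "real^3"
    by (simp add: norm_eq_sqrt_inner inner_vec_def sum_3 power2_eq_square)
  have "freqs (sqrt 2) = v ` T"
  proof (intro equalityI subsetI)
    fix k assume k: "k \<in> freqs (sqrt 2)"
    then have "\<forall>i. \<exists>m. k $ i = of_int m" by (auto simp: freqs_def int_vec_def elim: Ints_cases)
    then obtain a b c :: int where abc: "k $ 1 = of_int a" "k $ 2 = of_int b" "k $ 3 = of_int c" by metis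
    then have kv: "k = v (a, b, c)" by (simp add: v_def vec_eq_iff forall_3)
    have "(of_int (a\<^sup>2 + b\<^sup>2 + c\<^sup>2) :: real) = of_int 2" using k abc by (simp add: freqs_def n)
    then have s: "a\<^sup>2 + b\<^sup>2 + c\<^sup>2 = 2" by (simp only: of_int_eq_iff)
    have "a\<^sup>2 \<le> 2" "b\<^sup>2 \<le> 2" "c\<^sup>2 \<le> 2"
      using s zero_le_power2[of a] zero_le_power2[of b] zero_le_power2[of c] by linarith+
    from this[THEN sq] s have "(a, b, c) \<in> T" unfolding T_def by (elim insertE emptyE) simp_all
    then show "k \<in> v ` T" using kv by blast
  next
    fix k assume "k \<in> v ` T"
    then show "k \<in> freqs (sqrt 2)"
      by (auto simp: T_def v_def freqs_def n int_vec_def forall_3)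
  qed
  moreover have "inj v" by (auto simp: inj_def v_def vec_eq_iff forall_3)
  moreover have "card T = 12" by (simp add: T_def)
  ultimately show ?thesis by (simp add: card_image inj_on_subset)
qed

unbundle no cross3_syntax

section \<open>Jets of curl eigenfields\<close>

lemma E_plus_jacobian_linear:
  assumes "V \<in> E_plus lam" "W \<in> E_plus lam"
  shows "jacobian (V + W) (at x) = jacobian V (at x) + jacobian W (at x)"
    and "jacobian (c *\<^sub>R V) (at x) = c *\<^sub>R jacobian V (at x)"
proof -
  note d = E_plus_C1(1)[OF assms(1), of x] E_plus_C1(1)[OF assms(2), of x]
  have "(V + W has_derivative (\<lambda>h. (jacobian V (at x) + jacobian W (at x)) *v h)) (at x)"
    using has_derivative_add[OF d] by (simp add: plus_fun_def matrix_vector_mult_add_rdistrib)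
  from frechet_derivative_at[OF this, symmetric]
  show "jacobian (V + W) (at x) = jacobian V (at x) + jacobian W (at x)"
    by (simp add: jacobian_def[of "V + W"])
  have "(c *\<^sub>R V has_derivative (\<lambda>h. (c *\<^sub>R jacobian V (at x)) *v h)) (at x)"
    using has_derivative_scaleR_right[OF d(1), of c] by (simp add: scaleR_fun_def scaleR_matrix_vector_assoc)
  from frechet_derivative_at[OF this, symmetric]
  show "jacobian (c *\<^sub>R V) (at x) = c *\<^sub>R jacobian V (at x)"
    by (simp add: jacobian_def[of "c *\<^sub>R V"])
qed

lemma scaleR_fun_apply: "(c *\<^sub>R f) x = c *\<^sub>R f x"
  by (simp add: scaleR_fun_def)

lemma sym_part_linear: "sym_part (A + B) = sym_part A + sym_part B" "sym_part (c *\<^sub>R A) = c *\<^sub>R sym_part A"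
  by (simp_all add: sym_part_def transpose_def vec_eq_iff algebra_simps)

text \<open>Each wave is transverse, \<open>k\<close> being orthogonal to \<open>a\<close> and to
  \<open>k \<times> a\<close>. The trigonometric form avoids the second derivatives that div curl =
  0 would call for.\<close>

lemma E_plus_divergence_free:
  assumes lam: "lam > 0" and W: "W \<in> E_plus lam"
  shows "trace (jacobian W (at x)) = 0"
proof -
  obtain A where A: "\<forall>k\<in>freqs lam. k \<bullet> A k = 0" "W = field lam A"
    using E_plus_imp_field[OF lam W] .
  have "trace (jacobian W (at x)) = (\<Sum>k\<in>freqs lam. k \<bullet> wave' lam k (A k) x)"
    unfolding trace_def A(2) field_jacobian by (subst sum.swap) (simp add: inner_vec_def)
  also have "\<dots> = 0"
    using A(1) by (intro sum.neutral) (simp add: wave'_def inner_diff_right dot_cross_self)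
  finally show ?thesis .
qed

lemma sym_part_in_Sym0: "trace A = 0 \<Longrightarrow> sym_part A \<in> Sym0"
  by (auto simp: Sym0_def sym_part_def transpose_def trace_def vec_eq_iff sum_3 add.commute)

lemma sym_part_Sym0: "A \<in> Sym0 \<Longrightarrow> sym_part A = A"
  by (simp add: Sym0_def sym_part_def flip: scaleR_2)

lemma subspace_Sym0: "subspace Sym0"
  by (rule subspaceI) (auto simp: Sym0_def transpose_def trace_def vec_eq_iff sum_3 simp flip: distrib_left)

text \<open>Three off-diagonal and two diagonal entries are free; a lower bound is what the
  dimension count needs.\<close>

lemma dim_Sym0_ge: "dim Sym0 \<ge> 5"
proof -
  define S :: "(real^3) \<times> (real^2) \<Rightarrow> real^3^3" where
    "S = (\<lambda>(v, w). vector [vector [w$1, v$1, v$2], vector [v$1, w$2, v$3], vector [v$2, v$3, - w$1 - w$2]])"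
  have "linear S"
    by (rule linearI) (auto simp: S_def vec_eq_iff forall_3 algebra_simps split: prod.splits)
  moreover have "inj S"
    by (auto simp: inj_def S_def vec_eq_iff forall_3 forall_2)
  ultimately have "dim (range S) = 5" using dim_image_eq[of S UNIV] by simp
  moreover have "range S \<subseteq> Sym0"
    by (auto simp: S_def Sym0_def transpose_def trace_def vec_eq_iff forall_3 sum_3)
  ultimately show ?thesis by (metis dim_subset)
qed

text \<open>A rotation of the amplitude by the angle \<open>k \<bullet> x\<close> moves the value \<open>a\<close> from the origin to \<open>x\<close>.\<close>

lemma E_plus_wave_value:
  assumes lam: "lam > 0" and k: "k \<in> freqs lam" and a: "k \<bullet> a = 0"
  obtains W where "W \<in> E_plus lam" "W x = a"
proof
  define b where "b = cos (k \<bullet> x) *\<^sub>R a + (sin (k \<bullet> x) / lam) *\<^sub>R (cross3 k a)"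
  have kb: "cross3 k b = cos (k \<bullet> x) *\<^sub>R (cross3 k a) - (lam * sin (k \<bullet> x)) *\<^sub>R a"
    using lam by (simp add: b_def cross_add_right cross_mult_right freqs_cross_cross[OF k a] power2_eq_square)
  show "wave lam k b \<in> E_plus lam"
    by (rule wave_in_E_plus[OF lam k]) (simp add: b_def inner_add_right a dot_cross_self)
  have "(cos (k \<bullet> x) * cos (k \<bullet> x)) *\<^sub>R a + (sin (k \<bullet> x) * sin (k \<bullet> x)) *\<^sub>R a = a"
    by (simp flip: scaleR_add_left power2_eq_square)
  then show "wave lam k b x = a"
    using lam unfolding wave_def kb by (simp add: b_def algebra_simps)
qed

text \<open>Each coordinate direction is orthogonal to the frequency with 0 in that position and 1
  in the other two, whose length is sqrt 2; so each component of \<open>v\<close> is attained by a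
  wave of its own.\<close>

lemma E_plus_sqrt2_value:
  obtains W where "W \<in> E_plus (sqrt 2)" "W x = v"
proof -
  have fr: "vector [0, 1, 1] \<in> freqs (sqrt 2)" "vector [1, 0, 1] \<in> freqs (sqrt 2)" "vector [1, 1, 0] \<in> freqs (sqrt 2)"
    by (auto simp: freqs_def int_vec_def forall_3 norm_eq_sqrt_inner inner_vec_def sum_3)
  have o: "(vector [0, 1, 1] :: real^3) \<bullet> (v $ 1 *\<^sub>R axis 1 1) = 0" "(vector [1, 0, 1] :: real^3) \<bullet> (v $ 2 *\<^sub>R axis 2 1) = 0"
    "(vector [1, 1, 0] :: real^3) \<bullet> (v $ 3 *\<^sub>R axis 3 1) = 0"
    by (auto simp: inner_axis)
  have "sqrt 2 > (0::real)" by simp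
  obtain W1 where W1: "W1 \<in> E_plus (sqrt 2)" "W1 x = v $ 1 *\<^sub>R axis 1 1"
    using E_plus_wave_value[OF \<open>sqrt 2 > 0\<close> fr(1) o(1)] .
  obtain W2 where W2: "W2 \<in> E_plus (sqrt 2)" "W2 x = v $ 2 *\<^sub>R axis 2 1"
    using E_plus_wave_value[OF \<open>sqrt 2 > 0\<close> fr(2) o(2)] .
  obtain W3 where W3: "W3 \<in> E_plus (sqrt 2)" "W3 x = v $ 3 *\<^sub>R axis 3 1"
    using E_plus_wave_value[OF \<open>sqrt 2 > 0\<close> fr(3) o(3)] .
  show ?thesis
  proof
    show "W1 + W2 + W3 \<in> E_plus (sqrt 2)"
      using W1 W2 W3 subspace_E_plus[OF \<open>sqrt 2 > 0\<close>] by (intro subspace_add)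
    show "(W1 + W2 + W3) x = v" by (simp add: W1 W2 W3 vec_eq_iff forall_3 axis_def)
  qed
qed

text \<open>The jets at two points, with the value at the second point forgotten, depend linearly on 12
  parameters, while independent prescription would make them fill a space of dimension 13.\<close>

lemma E_plus_sqrt2_no_interpolation:
  "\<exists>H1\<in>Sym0. \<exists>H2\<in>Sym0. \<not> (\<exists>W\<in>E_plus (sqrt 2).
     W x1 = 0 \<and> W x2 = 0 \<and> jacobian W (at x1) = H1 \<and> jacobian W (at x2) = H2)"
proof (rule ccontr)
  assume "\<not> ?thesis"
  then have all: "\<exists>W\<in>E_plus (sqrt 2). W x1 = 0 \<and> jacobian W (at x1) = H1 \<and> jacobian W (at x2) = H2"
    if "H1 \<in> Sym0" "H2 \<in> Sym0" for H1 H2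
    using that by blast
  have lam: "sqrt 2 > (0::real)" by simp
  note sub = subspace_E_plus[OF lam]
  define T where "T W = (W x1, sym_part (jacobian W (at x1)), sym_part (jacobian W (at x2)))" for W
  let ?M = "mode (sqrt 2) ` freqs (sqrt 2)"
  have T_add: "T (V + W) = T V + T W" and T_scale: "T (c *\<^sub>R V) = c *\<^sub>R T V"
    if "V \<in> E_plus (sqrt 2)" "W \<in> E_plus (sqrt 2)" for V W c
    using that by (simp_all add: T_def E_plus_jacobian_linear sym_part_linear scaleR_fun_apply)
  have T0: "T 0 = 0" using T_scale[OF subspace_0[OF sub] subspace_0[OF sub], of 0] by simp
  have Tspan: "W \<in> E_plus (sqrt 2) \<and> T W \<in> span (T ` ?M)" if "W \<in> span ?M" for W
    using that
  proof (induction rule: span_induct_alt)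
    case base
    have "0 \<in> E_plus (sqrt 2) \<and> T 0 \<in> span (T ` ?M)" using subspace_0[OF sub] T0 by (simp only: span_zero)
    then show ?case by (simp only: zero_fun_def)
  next
    case (step c V W)
    have V: "V \<in> E_plus (sqrt 2)" using modes_in_E_plus[OF lam] step(1) by blast
    then have cV: "c *\<^sub>R V \<in> E_plus (sqrt 2)" by (rule subspace_scale[OF sub])
    have "T (c *\<^sub>R V + W) = c *\<^sub>R T V + T W"
      using step T_add[OF cV] T_scale[OF V V] by simp
    moreover have "c *\<^sub>R T V + T W \<in> span (T ` ?M)"
      using step by (intro span_add span_scale) (auto intro: span_base)
    ultimately have "c *\<^sub>R V + W \<in> E_plus (sqrt 2) \<and> T (c *\<^sub>R V + W) \<in> span (T ` ?M)"
      using step cV subspace_add[OF sub] by simp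
    then show ?case by (simp only: plus_fun_def)
  qed
  have "dim (T ` E_plus (sqrt 2)) \<le> card (T ` ?M)"
    using Tspan E_plus_subset_span_modes[OF lam] finite_freqs by (intro dim_le_card) auto
  also have "\<dots> \<le> card (freqs (sqrt 2))"
    using card_image_le[of "freqs (sqrt 2)" "\<lambda>k. T (mode (sqrt 2) k)"] finite_freqs by (simp add: image_image)
  finally have le: "dim (T ` E_plus (sqrt 2)) \<le> 12" by (simp add: card_freqs_sqrt2)
  have "UNIV \<times> Sym0 \<times> Sym0 \<subseteq> T ` E_plus (sqrt 2)"
  proof clarify
    fix v :: "real^3" and H1 H2 :: "real^3^3" assume H: "H1 \<in> Sym0" "H2 \<in> Sym0"
    obtain V where V: "V \<in> E_plus (sqrt 2)" "V x1 = v" by (rule E_plus_sqrt2_value)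
    \<comment> \<open>The gradients of \<open>V\<close> are uncontrolled, but what they lack to
      reach the targets is again symmetric and trace-free, so a field vanishing at \<open>x1\<close>
      can make up for it.\<close>
    have "H1 - sym_part (jacobian V (at x1)) \<in> Sym0" "H2 - sym_part (jacobian V (at x2)) \<in> Sym0"
      using H V by (auto intro!: subspace_diff[OF subspace_Sym0] sym_part_in_Sym0 E_plus_divergence_free)
    note S = this
    obtain W where W: "W \<in> E_plus (sqrt 2)" "W x1 = 0"
      "jacobian W (at x1) = H1 - sym_part (jacobian V (at x1))"
      "jacobian W (at x2) = H2 - sym_part (jacobian V (at x2))"
      using all[OF S] by blast
    have "T (V + W) = (v, H1, H2)"
      using V W S by (simp add: T_add) (simp add: T_def sym_part_Sym0)
    then show "(v, H1, H2) \<in> T ` E_plus (sqrt 2)"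
      using subspace_add[OF sub V(1) W(1)] by (metis image_eqI)
  qed
  then have "dim ((UNIV :: (real^3) set) \<times> Sym0 \<times> Sym0) \<le> 12" using le dim_subset order_trans by blast
  moreover have "dim ((UNIV :: (real^3) set) \<times> Sym0 \<times> Sym0) = 3 + (dim Sym0 + dim Sym0)"
    by (simp add: dim_Times subspace_Sym0 subspace_Times)
  ultimately show False using dim_Sym0_ge by simp
qed

section \<open>Half-period symmetry\<close>

lemma cos_sin_add_int_pi:
  fixes n :: int
  shows "cos (t + of_int n * pi) = (if even n then cos t else - cos t)"
    and "sin (t + of_int n * pi) = (if even n then sin t else - sin t)"
proof -
  have e: "cos (s + of_int (2 * q) * pi) = cos s" "sin (s + of_int (2 * q) * pi) = sin s" for s and q :: int
    using cos_int_2pin[of q] sin_int_2pin[of q] by (simp_all add: cos_add sin_add mult_ac)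
  have "cos (t + of_int n * pi) = (if even n then cos t else - cos t) \<and> sin (t + of_int n * pi) = (if even n then sin t else - sin t)"
  proof (cases "even n")
    case True
    then obtain q where "n = 2 * q" by blast
    then show ?thesis using e[of t q] by simp
  next
    case False
    then obtain q where q: "n = 2 * q + 1" by (elim oddE)
    have "t + of_int n * pi = (t + pi) + of_int (2 * q) * pi" by (simp add: q algebra_simps)
    then show ?thesis using e[of "t + pi" q] False by (simp add: add.assoc)
  qed
  then show "cos (t + of_int n * pi) = (if even n then cos t else - cos t)"
    "sin (t + of_int n * pi) = (if even n then sin t else - sin t)" by auto
qed

lemma freqs_shift_parity:
  assumes "k \<in> freqs (sqrt (real m))"
  shows "cos (k \<bullet> (x + pi *\<^sub>R vec 1)) = (-1) ^ m * cos (k \<bullet> x)"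
    and "sin (k \<bullet> (x + pi *\<^sub>R vec 1)) = (-1) ^ m * sin (k \<bullet> x)"
proof -
  have "\<forall>i. \<exists>m. k $ i = of_int m" using assms by (auto simp: freqs_def int_vec_def elim: Ints_cases)
  then obtain a b c :: int where abc: "k $ 1 = of_int a" "k $ 2 = of_int b" "k $ 3 = of_int c" by metis
  have "(norm k)\<^sup>2 = real m" using assms by (simp add: freqs_def)
  then have "of_int (a * a + b * b + c * c) = (of_int (int m) :: real)"
    unfolding power2_norm_eq_inner by (simp add: inner_vec_def sum_3 abc)
  then have "a * a + b * b + c * c = int m" by (simp only: of_int_eq_iff)
  then have "even (a * a + b * b + c * c) = even m" by simp
  \<comment> \<open>An integer and its square have the same parity.\<close>
  then have par: "even (a + b + c) \<longleftrightarrow> even m" by auto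
  have "k \<bullet> (x + pi *\<^sub>R vec 1) = k \<bullet> x + of_int (a + b + c) * pi"
    by (simp add: inner_add_right inner_vec_def sum_3 abc algebra_simps)
  then show "cos (k \<bullet> (x + pi *\<^sub>R vec 1)) = (-1) ^ m * cos (k \<bullet> x)"
    "sin (k \<bullet> (x + pi *\<^sub>R vec 1)) = (-1) ^ m * sin (k \<bullet> x)"
    using par by (simp_all only: cos_sin_add_int_pi) auto
qed

lemma E_plus_half_period_shift:
  assumes m: "m \<ge> 1" and W: "W \<in> E_plus (sqrt (real m))"
  shows "W (x + pi *\<^sub>R vec 1) = (-1) ^ m *\<^sub>R W x"
    and "jacobian W (at (x + pi *\<^sub>R vec 1)) = (-1) ^ m *\<^sub>R jacobian W (at x)"
proof -
  have lam: "sqrt (real m) > 0" using m by simp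
  obtain A where A: "\<forall>k\<in>freqs (sqrt (real m)). k \<bullet> A k = 0" "W = field (sqrt (real m)) A"
    using E_plus_imp_field[OF lam W] .
  show "W (x + pi *\<^sub>R vec 1) = (-1) ^ m *\<^sub>R W x"
    unfolding A(2) field_def scaleR_sum_right
    by (intro sum.cong refl) (simp only: wave_def freqs_shift_parity, simp add: algebra_simps)
  have "wave' (sqrt (real m)) k a (x + pi *\<^sub>R vec 1) = (-1) ^ m *\<^sub>R wave' (sqrt (real m)) k a x"
    if "k \<in> freqs (sqrt (real m))" for k a
    using that by (simp only: wave'_def freqs_shift_parity) (simp add: algebra_simps)
  then show "jacobian W (at (x + pi *\<^sub>R vec 1)) = (-1) ^ m *\<^sub>R jacobian W (at x)"
    unfolding A(2) by (simp add: vec_eq_iff field_jacobian sum_distrib_left mult_ac del: vec_1)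
qed

text \<open>A unit vector as value at \<open>x\<close> forces plus or minus that vector at the
  shifted point, so the value 0 is out of reach there.\<close>

lemma half_period_jets_dependent:
  assumes m: "m \<ge> 1"
  shows "\<exists>j1\<in>jet_targets. \<exists>j2\<in>jet_targets. \<forall>W\<in>E_plus (sqrt (real m)).
    first_jet W x = j1 \<longrightarrow> first_jet W (x + pi *\<^sub>R vec 1) \<noteq> j2"
proof (rule bexI[of _ "(axis 1 1, 0)"], rule bexI[of _ "(0, 0)"], intro ballI impI)
  show "(axis 1 1, 0) \<in> jet_targets" "(0, 0) \<in> jet_targets"
    using subspace_0[OF subspace_Sym0] by (auto simp: jet_targets_def)
  fix W assume W: "W \<in> E_plus (sqrt (real m))" "first_jet W x = (axis 1 1, 0)"
  then show "first_jet W (x + pi *\<^sub>R vec 1) \<noteq> (0, 0)"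
    using E_plus_half_period_shift(1)[OF m W(1), of x] by (auto simp: first_jet_def)
qed

lemma two_point_jet_in_targets:
  assumes "lam > 0" "W \<in> E_plus lam"
  shows "two_point_jet x y W \<in> jet_targets \<times> jet_targets"
  using sym_part_in_Sym0[OF E_plus_divergence_free[OF assms]]
  by (simp add: two_point_jet_def first_jet_def jet_targets_def)

section \<open>Evolution within an eigenspace\<close>

text \<open>On a finite-dimensional space of functions, finitely many evaluation functionals determine a
  function linearly; hence the space is closed under pointwise limits and pointwise derivatives.\<close>

lemma finite_dim_interpolation:
  fixes B :: "('a \<Rightarrow> 'b::real_inner) set"
  assumes "finite B"
  shows "\<exists>S v. finite S \<and> (\<forall>\<sigma>\<in>S. v \<sigma> \<in> span B) \<and> (\<forall>w\<in>span B. w = (\<Sum>\<sigma>\<in>S. (w (fst \<sigma>) \<bullet> snd \<sigma>) *\<^sub>R v \<sigma>))"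
  using assms
proof (induction B)
  case empty
  then show ?case by (intro exI[of _ "{}"]) simp
next
  case (insert b B)
  then obtain S v where S: "finite S" and v: "\<And>\<sigma>. \<sigma> \<in> S \<Longrightarrow> v \<sigma> \<in> span B"
    and rep: "\<And>w. w \<in> span B \<Longrightarrow> w = (\<Sum>\<sigma>\<in>S. (w (fst \<sigma>) \<bullet> snd \<sigma>) *\<^sub>R v \<sigma>)" by blast
  show ?case
  proof (cases "b \<in> span B")
    case True
    then show ?thesis using S v rep by (intro exI[of _ S] exI[of _ v]) (auto simp: span_redundant)
  next
    case False
    \<comment> \<open>\<open>P\<close> is the interpolation operator already available, the identity
      on \<open>span B\<close>. As in Newton interpolation, a point where the residual
      \<open>r\<close> of the new element \<open>b\<close> is nonzero serves as one further
      node.\<close>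
    define P where "P w = (\<Sum>\<sigma>\<in>S. (w (fst \<sigma>) \<bullet> snd \<sigma>) *\<^sub>R v \<sigma>)" for w :: "'a \<Rightarrow> 'b"
    have P_lin: "P (w + k *\<^sub>R b) = P w + k *\<^sub>R P b" for w k
      by (simp add: P_def scaleR_fun_apply inner_add_left algebra_simps sum.distrib scaleR_sum_right)
    define r where "r = b - P b"
    have Pb: "P b \<in> span B" unfolding P_def using v by (intro span_sum span_scale) auto
    have "r \<noteq> 0" using False Pb by (auto simp: r_def)
    then obtain x where x: "r x \<noteq> 0" by (auto simp: fun_eq_iff)
    define \<sigma>0 where "\<sigma>0 = (x, r x)"
    define h where "h = (1 / (r x \<bullet> r x)) *\<^sub>R r"
    have insert_span: "span B \<subseteq> span (insert b B)" by (intro span_mono) auto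
    have h: "h \<in> span (insert b B)" unfolding h_def r_def
      using insert_span Pb by (intro span_scale span_diff) (auto intro: span_base)
    \<comment> \<open>The new node measures the multiple of \<open>r\<close>, so the old nodal
      fields must give up what they contribute there. Adding two conditionals treats the cases
      \<open>\<sigma>0 \<in> S\<close> and \<open>\<sigma>0 \<notin> S\<close> alike.\<close>
    define v' where "v' \<sigma> = (if \<sigma> \<in> S then v \<sigma> - (v \<sigma> x \<bullet> r x) *\<^sub>R h else 0) + (if \<sigma> = \<sigma>0 then h else 0)" for \<sigma>
    have "w = (\<Sum>\<sigma>\<in>insert \<sigma>0 S. (w (fst \<sigma>) \<bullet> snd \<sigma>) *\<^sub>R v' \<sigma>)" if "w \<in> span (insert b B)" for w
    proof -
      obtain \<beta> where \<beta>: "w - \<beta> *\<^sub>R b \<in> span B" using \<open>w \<in> _\<close> unfolding span_breakdown_eq by blast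
      have "P w = P (w - \<beta> *\<^sub>R b) + \<beta> *\<^sub>R P b" using P_lin[of "w - \<beta> *\<^sub>R b" \<beta>] by simp
      also have "P (w - \<beta> *\<^sub>R b) = w - \<beta> *\<^sub>R b" using rep[OF \<beta>] by (simp only: P_def)
      finally have w: "w = P w + \<beta> *\<^sub>R r" by (simp add: r_def fun_eq_iff scaleR_fun_apply algebra_simps)
      have "w x \<bullet> r x = P w x \<bullet> r x + \<beta> * (r x \<bullet> r x)"
        by (subst w) (simp add: scaleR_fun_apply inner_add_left)
      then have "(w x \<bullet> r x - P w x \<bullet> r x) *\<^sub>R h = \<beta> *\<^sub>R r" using x by (simp add: h_def)
      then have "w = P w + (w x \<bullet> r x - P w x \<bullet> r x) *\<^sub>R h" using w by simp
      also have "\<dots> = (\<Sum>\<sigma>\<in>S. (w (fst \<sigma>) \<bullet> snd \<sigma>) *\<^sub>R (v \<sigma> - (v \<sigma> x \<bullet> r x) *\<^sub>R h)) + (w x \<bullet> r x) *\<^sub>R h"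
        by (simp add: P_def sum_fun_apply scaleR_fun_apply inner_sum_left scaleR_diff_right sum_subtractf
            scaleR_sum_left algebra_simps)
      also have "\<dots> = (\<Sum>\<sigma>\<in>insert \<sigma>0 S. (w (fst \<sigma>) \<bullet> snd \<sigma>) *\<^sub>R v' \<sigma>)"
      proof -
        have 1: "(\<Sum>\<sigma>\<in>insert \<sigma>0 S. (w (fst \<sigma>) \<bullet> snd \<sigma>) *\<^sub>R (if \<sigma> \<in> S then v \<sigma> - (v \<sigma> x \<bullet> r x) *\<^sub>R h else 0))
          = (\<Sum>\<sigma>\<in>S. (w (fst \<sigma>) \<bullet> snd \<sigma>) *\<^sub>R (v \<sigma> - (v \<sigma> x \<bullet> r x) *\<^sub>R h))"
          using S by (intro sum.mono_neutral_cong_right) auto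
        have 2: "(\<Sum>\<sigma>\<in>insert \<sigma>0 S. (w (fst \<sigma>) \<bullet> snd \<sigma>) *\<^sub>R (if \<sigma> = \<sigma>0 then h else 0)) = (w x \<bullet> r x) *\<^sub>R h"
        proof -
          have "(\<Sum>\<sigma>\<in>insert \<sigma>0 S. (w (fst \<sigma>) \<bullet> snd \<sigma>) *\<^sub>R (if \<sigma> = \<sigma>0 then h else 0))
            = (\<Sum>\<sigma>\<in>{\<sigma>0}. (w (fst \<sigma>) \<bullet> snd \<sigma>) *\<^sub>R h)"
            using S by (intro sum.mono_neutral_cong_right) auto
          then show ?thesis by (simp add: \<sigma>0_def)
        qed
        show ?thesis unfolding v'_def scaleR_add_right sum.distrib 1 2 ..
      qed
      finally show ?thesis .
    qed
    moreover have "v' \<sigma> \<in> span (insert b B)" for \<sigma>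
      unfolding v'_def using subsetD[OF insert_span v[of \<sigma>]] h
        by (cases "\<sigma> \<in> S"; cases "\<sigma> = \<sigma>0") (simp_all add: span_add span_diff span_scale span_zero)
    ultimately show ?thesis using S by (intro exI[of _ "insert \<sigma>0 S"] exI[of _ v']) auto
  qed
qed

text \<open>The interpolation formula expresses \<open>u s x\<close> by finitely many values of
  \<open>u s\<close> with coefficients independent of \<open>s\<close>. Differentiating these values
  at each point gives the same formula for \<open>D\<close>, which thus lies in the space.\<close>

lemma E_plus_time_derivative:
  assumes lam: "lam > 0" and u: "\<And>s. s \<ge> 0 \<Longrightarrow> u s \<in> E_plus lam" and t: "t \<ge> 0"
    and D: "\<And>x. ((\<lambda>s. u s x) has_vector_derivative D x) (at t within {0..})"
  shows "D \<in> E_plus lam"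
proof -
  let ?M = "mode lam ` freqs lam"
  have sp: "span ?M = E_plus lam"
    using E_plus_subset_span_modes[OF lam] span_minimal[OF modes_in_E_plus[OF lam] subspace_E_plus[OF lam]] by blast
  have "finite ?M" by (intro finite_imageI finite_freqs)
  from finite_dim_interpolation[OF this, unfolded sp]
  obtain S v where S: "finite S" "\<forall>\<sigma>\<in>S. v \<sigma> \<in> E_plus lam"
    and rep: "\<forall>w\<in>E_plus lam. w = (\<Sum>\<sigma>\<in>S. (w (fst \<sigma>) \<bullet> snd \<sigma>) *\<^sub>R v \<sigma>)"
    by (elim exE conjE)
  have "D x = (\<Sum>\<sigma>\<in>S. (D (fst \<sigma>) \<bullet> snd \<sigma>) *\<^sub>R v \<sigma> x)" for x
  proof (rule vector_derivative_unique_within)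
    show "at t within {0..} \<noteq> bot"
    proof -
      \<comment> \<open>Uniqueness of the derivative needs \<open>t\<close> to be a limit point of
        the half-line; \<open>t + 1\<close> keeps the interval nondegenerate at
        \<open>t = 0\<close>.\<close>
      have "t islimpt {0..t + 1}" using t by simp
      then have "t islimpt {0..}" by (rule islimpt_subset) auto
      then show ?thesis by (simp add: trivial_limit_within)
    qed
    show "((\<lambda>s. u s x) has_vector_derivative D x) (at t within {0..})" by (rule D)
    have "((\<lambda>s. u s (fst \<sigma>) \<bullet> snd \<sigma>) has_vector_derivative D (fst \<sigma>) \<bullet> snd \<sigma>) (at t within {0..})" for \<sigma>
      by (rule bounded_linear.has_vector_derivative[OF bounded_linear_inner_left D])
    then have 1: "((\<lambda>s. \<Sum>\<sigma>\<in>S. (u s (fst \<sigma>) \<bullet> snd \<sigma>) *\<^sub>R v \<sigma> x) has_vector_derivative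
       (\<Sum>\<sigma>\<in>S. (D (fst \<sigma>) \<bullet> snd \<sigma>) *\<^sub>R v \<sigma> x)) (at t within {0..})"
      by (intro has_vector_derivative_sum bounded_linear.has_vector_derivative[OF bounded_linear_scaleR_left])
    have 2: "u s x = (\<Sum>\<sigma>\<in>S. (u s (fst \<sigma>) \<bullet> snd \<sigma>) *\<^sub>R v \<sigma> x)" if "s \<in> {0..}" for s
    proof -
      have "u s x = (\<Sum>\<sigma>\<in>S. (u s (fst \<sigma>) \<bullet> snd \<sigma>) *\<^sub>R v \<sigma>) x"
        by (rule fun_cong[OF bspec[OF rep u]]) (use that in simp)
      also have "\<dots> = (\<Sum>\<sigma>\<in>S. (u s (fst \<sigma>) \<bullet> snd \<sigma>) *\<^sub>R v \<sigma> x)"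
        by (simp only: sum_fun_apply scaleR_fun_apply)
      finally show ?thesis .
    qed
    show "((\<lambda>s. u s x) has_vector_derivative (\<Sum>\<sigma>\<in>S. (D (fst \<sigma>) \<bullet> snd \<sigma>) *\<^sub>R v \<sigma> x)) (at t within {0..})"
      by (rule has_vector_derivative_transform[OF _ 2 1]) (use t in simp)
  qed
  then have 3: "D = (\<Sum>\<sigma>\<in>S. (D (fst \<sigma>) \<bullet> snd \<sigma>) *\<^sub>R v \<sigma>)"
    unfolding fun_eq_iff sum_fun_apply scaleR_fun_apply by (rule allI)
  have 4: "(\<Sum>\<sigma>\<in>S. (D (fst \<sigma>) \<bullet> snd \<sigma>) *\<^sub>R v \<sigma>) \<in> E_plus lam"
    using S subspace_E_plus[OF lam] by (intro subspace_sum subspace_scale) auto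
  show ?thesis by (subst 3) (rule 4)
qed

section \<open>The momentum equation on an eigenspace\<close>

lemma E_plus_laplacian:
  assumes lam: "lam > 0" and W: "W \<in> E_plus lam"
  shows "laplacian W x = - (lam\<^sup>2 *\<^sub>R W x)"
proof -
  obtain A where A: "W = field lam A" using E_plus_imp_field[OF lam W] .
  have 1: "partial j W = (\<lambda>x. \<Sum>k\<in>freqs lam. k $ j *\<^sub>R wave' lam k (A k) x)" for j
    unfolding A partial_def frechet_derivative_at[OF field_has_derivative, symmetric]
    by (simp add: inner_axis)
  have "((\<lambda>x. \<Sum>k\<in>freqs lam. k $ j *\<^sub>R wave' lam k (A k) x) has_derivative
      (\<lambda>h. \<Sum>k\<in>freqs lam. k $ j *\<^sub>R (- (k \<bullet> h) *\<^sub>R wave lam k (A k) x))) (at x)" for j x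
    by (intro has_derivative_sum has_derivative_scaleR_right wave'_has_derivative)
  from frechet_derivative_at[OF this, symmetric]
  have 2: "partial j (partial j W) x = (\<Sum>k\<in>freqs lam. - (k $ j * k $ j) *\<^sub>R wave lam k (A k) x)" for j x
    unfolding 1 by (simp add: partial_def inner_axis)
  have "laplacian W x = (\<Sum>k\<in>freqs lam. - (\<Sum>j\<in>UNIV. k $ j * k $ j) *\<^sub>R wave lam k (A k) x)"
    unfolding laplacian_def 2 by (subst sum.swap) (simp add: sum_negf scaleR_sum_left)
  also have "\<dots> = (\<Sum>k\<in>freqs lam. - (lam\<^sup>2) *\<^sub>R wave lam k (A k) x)"
  proof (intro sum.cong refl)
    fix k assume "k \<in> freqs lam"
    then have "(\<Sum>j\<in>UNIV. k $ j * k $ j) = lam\<^sup>2"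
      using power2_norm_eq_inner[of k] by (simp add: freqs_def inner_vec_def)
    then show "- (\<Sum>j\<in>UNIV. k $ j * k $ j) *\<^sub>R wave lam k (A k) x = - (lam\<^sup>2) *\<^sub>R wave lam k (A k) x" by simp
  qed
  finally show ?thesis by (simp add: A field_def scaleR_sum_right sum_negf)
qed

text \<open>\<open>J - transpose J\<close> acts as the cross product with \<open>curl W\<close>,
  which is parallel to \<open>W\<close>. The right-hand side is the gradient of
  \<open>|W|^2 / 2\<close>.\<close>

lemma E_plus_advection:
  assumes "W \<in> E_plus lam"
  shows "jacobian W (at x) *v W x = transpose (jacobian W (at x)) *v W x"
proof -
  define J where "J = jacobian W (at x)"
  have "curl W x = lam *\<^sub>R W x" using assms by (simp add: E_plus_def)
  then have c: "J $ 3 $ 2 = J $ 2 $ 3 + lam * W x $ 1" "J $ 1 $ 3 = J $ 3 $ 1 + lam * W x $ 2" "J $ 2 $ 1 = J $ 1 $ 2 + lam * W x $ 3"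
    by (auto simp: curl_def Let_def J_def vec_eq_iff forall_3 algebra_simps)
  show ?thesis unfolding J_def[symmetric]
    by (simp add: vec_eq_iff forall_3 matrix_vector_mult_def transpose_def sum_3 c algebra_simps)
qed

text \<open>The integral of |V|^2 is that of \<open>V\<close> against the gradient of
  \<open>q\<close>, hence minus that of q div V, which is 0. Because the gradient of
  \<open>q\<close> is \<open>V\<close>, the products \<open>q * V $ j\<close> have continuous
  derivatives.\<close>

lemma E_plus_gradient_eq_0:
  assumes lam: "lam > 0" and V: "V \<in> E_plus lam" and q: "periodic q"
    and dq: "\<And>x. (q has_derivative (\<lambda>h. V x \<bullet> h)) (at x)"
  shows "V x = 0"
proof -
  have Vc: "continuous_on UNIV V"
    by (intro continuous_at_imp_continuous_on ballI has_derivative_continuous[OF E_plus_C1(1)[OF V]])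
  have qc: "continuous_on UNIV q"
    by (intro continuous_at_imp_continuous_on ballI has_derivative_continuous[OF dq])
  have Vp: "periodic V" using V by (simp add: E_plus_def)
  let ?J = "\<lambda>x. jacobian V (at x)"
  have int: "integral cell (\<lambda>x. q x * ?J x $ j $ j + V x $ j * V x $ j) = 0" for j
  proof (rule integral_cell_derivative_eq_0[where j = j])
    have "((\<lambda>x. q x * V x $ j) has_derivative
       (\<lambda>h. q x * (?J x *v h) $ j + (V x \<bullet> h) * V x $ j)) (at x)" for x
      by (intro has_derivative_mult dq bounded_linear.has_derivative[OF bounded_linear_vec_nth E_plus_C1(1)[OF V]])
    from has_derivative_imp_directional[OF this]
    show "((\<lambda>s. q (x + axis j s) * V (x + axis j s) $ j) has_real_derivative
       q x * ?J x $ j $ j + V x $ j * V x $ j) (at 0)" for x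
      by (rule DERIV_cong) (simp add: inner_axis matrix_vector_mult_basis column_def)
    show "periodic (\<lambda>x. q x * V x $ j)" using Vp q by (simp add: periodic_def)
  qed (intro continuous_intros qc Vc E_plus_C1(2)[OF V])
  have "0 = (\<Sum>j\<in>UNIV. integral cell (\<lambda>x. q x * ?J x $ j $ j + V x $ j * V x $ j))"
    by (simp add: int)
  also have "\<dots> = integral cell (\<lambda>x. \<Sum>j\<in>UNIV. q x * ?J x $ j $ j + V x $ j * V x $ j)"
    by (rule integral_sum[symmetric]) (auto intro!: cell_integrable continuous_intros qc Vc E_plus_C1(2)[OF V])
  also have "(\<lambda>x. \<Sum>j\<in>UNIV. q x * ?J x $ j $ j + V x $ j * V x $ j) = (\<lambda>x. norm (V x) * norm (V x))"
  proof
    fix x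
    have "(\<Sum>j\<in>UNIV. q x * ?J x $ j $ j + V x $ j * V x $ j) = q x * trace (?J x) + V x \<bullet> V x"
      by (simp add: sum.distrib trace_def sum_distrib_left inner_vec_def)
    then show "(\<Sum>j\<in>UNIV. q x * ?J x $ j $ j + V x $ j * V x $ j) = norm (V x) * norm (V x)"
      by (simp add: E_plus_divergence_free[OF lam V] power2_norm_eq_inner flip: power2_eq_square)
  qed
  finally have "norm (V x) = 0"
    using Vc Vp by (intro periodic_eq_0_if_square_integral_eq_0[of "\<lambda>x. norm (V x)"]) (auto intro!: continuous_intros simp: periodic_def)
  then show ?thesis by simp
qed

lemma E_plus_solution_decay:
  assumes "E_plus_solution \<nu> lam u" and t: "t \<ge> 0"
  shows "u t = exp (- \<nu> * lam\<^sup>2 * t) *\<^sub>R u 0"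
proof -
  have lam: "lam > 0" and u: "\<And>s. s \<ge> 0 \<Longrightarrow> u s \<in> E_plus lam" and NS: "NS_solution \<nu> u"
    using assms(1) by (auto simp: E_plus_solution_def)
  obtain p where p: "\<And>s. s \<ge> 0 \<Longrightarrow> periodic (p s)" "\<And>s x. s \<ge> 0 \<Longrightarrow> p s differentiable (at x)"
    and ex: "\<And>s x. s \<ge> 0 \<Longrightarrow> \<exists>u'. ((\<lambda>s. u s x) has_vector_derivative u') (at s within {0..}) \<and>
      u' + jacobian (u s) (at x) *v u s x + grad (p s) x = \<nu> *\<^sub>R laplacian (u s) x"
    using NS unfolding NS_solution_def by blast
  have deriv: "((\<lambda>s. u s x) has_vector_derivative - (\<nu> * lam\<^sup>2) *\<^sub>R u s x) (at s within {0..})" if s: "s \<ge> 0" for s x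
  proof -
    obtain D where D: "\<And>x. ((\<lambda>s. u s x) has_vector_derivative D x) (at s within {0..})"
      "\<And>x. D x + jacobian (u s) (at x) *v u s x + grad (p s) x = \<nu> *\<^sub>R laplacian (u s) x"
      using ex[OF s] by metis
    have DE: "D \<in> E_plus lam" by (rule E_plus_time_derivative[OF lam u s D(1)])
    \<comment> \<open>By the momentum equation this is the gradient of Bernoulli's total pressure,
      the function \<open>q\<close> below.\<close>
    define V where "V = - (\<nu> * lam\<^sup>2) *\<^sub>R u s - D"
    have VE: "V \<in> E_plus lam" unfolding V_def
      using subspace_E_plus[OF lam] u[OF s] DE by (intro subspace_diff subspace_scale)
    have Vx: "V x = grad (p s) x + transpose (jacobian (u s) (at x)) *v u s x" for x
      using D(2)[of x] E_plus_advection[OF u[OF s], of x] E_plus_laplacian[OF lam u[OF s], of x]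
      by (simp add: V_def scaleR_fun_apply algebra_simps)
    define q where "q x = p s x + (1 / 2) * (u s x \<bullet> u s x)" for x
    have "(q has_derivative (\<lambda>h. V x \<bullet> h)) (at x)" for x
    proof -
      have lin: "linear (frechet_derivative (p s) (at x))" by (rule linear_frechet_derivative[OF p(2)[OF s]])
      have pd: "(p s has_derivative (\<lambda>h. grad (p s) x \<bullet> h)) (at x)"
      proof -
        have "frechet_derivative (p s) (at x) h = grad (p s) x \<bullet> h" for h
        proof -
          have "h = (\<Sum>j\<in>UNIV. h $ j *\<^sub>R axis j 1)" by (simp add: vec_eq_iff axis_def if_distrib cong: if_cong)
          then have "frechet_derivative (p s) (at x) h = (\<Sum>j\<in>UNIV. h $ j * frechet_derivative (p s) (at x) (axis j 1))"
            using linear_sum[OF lin, of "\<lambda>j. h $ j *\<^sub>R axis j 1" UNIV] by (simp add: linear_scale[OF lin])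
          then show ?thesis by (simp add: grad_def partial_def inner_vec_def mult.commute)
        qed
        then have "frechet_derivative (p s) (at x) = (\<lambda>h. grad (p s) x \<bullet> h)" by (rule ext)
        then show ?thesis using p(2)[OF s] frechet_derivative_works[of "p s" "at x"] by simp
      qed
      note ud = E_plus_C1(1)[OF u[OF s], of x]
      have "(q has_derivative (\<lambda>h. grad (p s) x \<bullet> h + (1 / 2) * (u s x \<bullet> (jacobian (u s) (at x) *v h) + (jacobian (u s) (at x) *v h) \<bullet> u s x))) (at x)"
        unfolding q_def[abs_def]
        by (intro has_derivative_add pd has_derivative_mult_right has_derivative_inner ud)
      then show ?thesis
        by (rule has_derivative_eq_rhs)
          (simp add: fun_eq_iff Vx inner_add_left inner_commute[of _ "u s x"] dot_lmul_matrix transpose_matrix_vector)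
    qed
    moreover have "periodic q" using p(1)[OF s] u[OF s] by (auto simp: q_def periodic_def E_plus_def)
    ultimately have "V x = 0" for x using E_plus_gradient_eq_0[OF lam VE] by blast
    then have "D x = - (\<nu> * lam\<^sup>2) *\<^sub>R u s x" by (simp add: V_def scaleR_fun_apply)
    then show ?thesis using D(1)[of x] by simp
  qed
  have "u t x = exp (- \<nu> * lam\<^sup>2 * t) *\<^sub>R u 0 x" for x
  proof -
    \<comment> \<open>The integrating factor reduces the linear equation at each point to constancy
      on the half-line.\<close>
    have "((\<lambda>s. exp (\<nu> * lam\<^sup>2 * s) *\<^sub>R u s x) has_vector_derivative 0) (at s within {0..})"
      if "s \<in> {0..}" for s
      using deriv[of s x] that by (auto intro!: derivative_eq_intros simp: algebra_simps)
    then obtain c where "\<And>s. s \<in> {0..} \<Longrightarrow> exp (\<nu> * lam\<^sup>2 * s) *\<^sub>R u s x = c"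
      by (rule has_vector_derivative_zero_constant[OF convex_real_interval(1)]) auto
    then have "exp (\<nu> * lam\<^sup>2 * t) *\<^sub>R u t x = exp (\<nu> * lam\<^sup>2 * 0) *\<^sub>R u 0 x" using t by (metis atLeast_iff order_refl)
    then have "exp (- \<nu> * lam\<^sup>2 * t) *\<^sub>R (exp (\<nu> * lam\<^sup>2 * t) *\<^sub>R u t x) = exp (- \<nu> * lam\<^sup>2 * t) *\<^sub>R u 0 x" by simp
    then show ?thesis by (simp flip: exp_add)
  qed
  then show ?thesis by (simp add: fun_eq_iff scaleR_fun_apply)
qed

section \<open>Deformation gradients\<close>

definition mat_pow :: "real^3^3 \<Rightarrow> nat \<Rightarrow> real^3^3" where "mat_pow A n = ((**) A ^^ n) (mat 1)"

lemma mat_pow_Suc: "mat_pow A (Suc n) = A ** mat_pow A n"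
  by (simp add: mat_pow_def)

lemma bounded_linear_matrix_mult: "bounded_linear (\<lambda>N::real^3^3. A ** N)" "bounded_linear (\<lambda>N::real^3^3. N ** A)"
  for A :: "real^3^3"
  by (auto intro!: linear_conv_bounded_linear[THEN iffD1] linearI
      simp: vec_eq_iff matrix_matrix_mult_def sum_distrib_left mult_ac distrib_left distrib_right sum.distrib)

text \<open>A bound \<open>K\<close> for left multiplication by \<open>A\<close> dominates the terms
  by those of a scalar exponential series; the factor \<open>norm (mat 1)\<close> remains because
  the Euclidean norm of the identity matrix is not 1.\<close>

lemma mat_exp_sums: "(\<lambda>n. (1 / fact n) *\<^sub>R mat_pow A n) sums mat_exp A"
proof -
  obtain K where K: "K > 0" "\<And>N::real^3^3. norm (A ** N) \<le> norm N * K"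
    using bounded_linear.pos_bounded[OF bounded_linear_matrix_mult(1)] by blast
  have b: "norm (mat_pow A n) \<le> K ^ n * norm (mat 1 :: real^3^3)" for n
  proof (induction n)
    case 0 then show ?case by (simp add: mat_pow_def)
  next
    case (Suc n)
    have "norm (mat_pow A (Suc n)) \<le> norm (mat_pow A n) * K" unfolding mat_pow_Suc by (rule K(2))
    also have "\<dots> \<le> (K ^ n * norm (mat 1 :: real^3^3)) * K" using Suc K(1) by (intro mult_right_mono) auto
    finally show ?case by (simp add: mult_ac)
  qed
  have "summable (\<lambda>n. (1 / fact n) *\<^sub>R mat_pow A n)"
  proof (rule summable_comparison_test')
    show "summable (\<lambda>n. (inverse (fact n) * K ^ n) * norm (mat 1 :: real^3^3))"
      by (intro summable_mult2 summable_exp)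
    show "norm ((1 / fact n) *\<^sub>R mat_pow A n) \<le> (inverse (fact n) * K ^ n) * norm (mat 1 :: real^3^3)" for n
      using mult_left_mono[OF b[of n], of "inverse (fact n)"] by (simp add: divide_inverse mult.assoc)
  qed
  then show ?thesis unfolding mat_exp_def mat_pow_def by (rule summable_sums)
qed

lemma mat_pow_scaleR: "mat_pow (s *\<^sub>R A) n = s ^ n *\<^sub>R mat_pow A n"
proof (induction n)
  case 0 then show ?case by (simp add: mat_pow_def)
next
  case (Suc n)
  have "(s *\<^sub>R A) ** (s ^ n *\<^sub>R N) = s ^ Suc n *\<^sub>R (A ** N)" for N :: "real^3^3"
    by (simp add: vec_eq_iff matrix_matrix_mult_def sum_distrib_left mult_ac)
  then show ?case by (simp add: mat_pow_Suc Suc)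
qed

lemma mat_exp_0: "mat_exp 0 = mat 1"
proof -
  have "(\<lambda>n. (1 / fact n) *\<^sub>R mat_pow 0 n) sums (\<Sum>n\<in>{0}. (1 / fact n) *\<^sub>R mat_pow 0 n)"
  proof (rule sums_finite)
    fix n :: nat assume "n \<notin> {0}"
    then obtain m where "n = Suc m" by (cases n) auto
    then show "(1 / fact n) *\<^sub>R mat_pow 0 n = 0" by (simp add: mat_pow_Suc)
  qed simp
  then show ?thesis using mat_exp_sums[of 0] sums_unique2 by (fastforce simp: mat_pow_def)
qed

text \<open>Each entry is an everywhere convergent power series in \<open>s\<close>, and its formal
  derivative \<open>diffs c\<close> is the series of the corresponding entry of A exp (sA).\<close>

lemma mat_exp_entry_deriv:
  "((\<lambda>s. mat_exp (s *\<^sub>R A) $ i $ j) has_real_derivative (A ** mat_exp (s *\<^sub>R A)) $ i $ j) (at s)"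
proof -
  define c where "c n = mat_pow A n $ i $ j / fact n" for n
  have entry: "bounded_linear (\<lambda>N::real^3^3. N $ i $ j)"
    by (rule bounded_linear_compose[OF bounded_linear_vec_nth bounded_linear_vec_nth])
  have c: "(\<lambda>n. c n * s ^ n) sums mat_exp (s *\<^sub>R A) $ i $ j" for s
    using bounded_linear.sums[OF entry mat_exp_sums[of "s *\<^sub>R A"]]
    by (simp add: mat_pow_scaleR c_def mult.commute)
  have d: "(\<lambda>n. diffs c n * s ^ n) sums (A ** mat_exp (s *\<^sub>R A)) $ i $ j" for s
  proof -
    have "A ** (r *\<^sub>R N) = r *\<^sub>R (A ** N)" for r and N :: "real^3^3"
      by (rule linear_scale[OF bounded_linear.linear[OF bounded_linear_matrix_mult(1)]])
    then have "A ** ((1 / fact n) *\<^sub>R mat_pow (s *\<^sub>R A) n) = (s ^ n / fact n) *\<^sub>R mat_pow A (Suc n)" for n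
      by (simp add: mat_pow_scaleR mat_pow_Suc)
    then have "(A ** ((1 / fact n) *\<^sub>R mat_pow (s *\<^sub>R A) n)) $ i $ j = diffs c n * s ^ n" for n
      by (simp add: diffs_def c_def field_simps del: of_nat_Suc)
    then show ?thesis
      using bounded_linear.sums[OF bounded_linear_compose[OF entry bounded_linear_matrix_mult(1)[of A]] mat_exp_sums[of "s *\<^sub>R A"]]
      by simp
  qed
  have "((\<lambda>s. \<Sum>n. c n * s ^ n) has_field_derivative (\<Sum>n. diffs c n * s ^ n)) (at s)"
    by (rule termdiffs_strong_converges_everywhere) (use c in \<open>auto simp: sums_iff\<close>)
  then show ?thesis using c d by (simp add: sums_iff)
qed

lemma mat_exp_vec_deriv:
  assumes "(s has_real_derivative d) (at t within T)"
  shows "((\<lambda>t. mat_exp (s t *\<^sub>R A) *v h) has_vector_derivative d *\<^sub>R (A *v (mat_exp (s t *\<^sub>R A) *v h))) (at t within T)"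
proof -
  have e: "((\<lambda>t. mat_exp (s t *\<^sub>R A) $ i $ j) has_real_derivative (A ** mat_exp (s t *\<^sub>R A)) $ i $ j * d) (at t within T)" for i j
    by (rule DERIV_chain2[OF mat_exp_entry_deriv assms])
  have "((\<lambda>t. \<Sum>j\<in>UNIV. mat_exp (s t *\<^sub>R A) $ i $ j * h $ j) has_real_derivative
     (\<Sum>j\<in>UNIV. (A ** mat_exp (s t *\<^sub>R A)) $ i $ j * d * h $ j)) (at t within T)" for i
    by (intro DERIV_sum DERIV_cmult_right e)
  note fv = this[unfolded has_real_derivative_iff_has_vector_derivative]
  have "((\<lambda>t. \<Sum>i\<in>UNIV. (\<Sum>j\<in>UNIV. mat_exp (s t *\<^sub>R A) $ i $ j * h $ j) *\<^sub>R (axis i 1 :: real^3)) has_vector_derivative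
     (\<Sum>i\<in>UNIV. (\<Sum>j\<in>UNIV. (A ** mat_exp (s t *\<^sub>R A)) $ i $ j * d * h $ j) *\<^sub>R axis i 1)) (at t within T)"
    by (rule has_vector_derivative_sum, rule bounded_linear.has_vector_derivative[OF bounded_linear_scaleR_left], rule fv)
  moreover have "(\<Sum>i\<in>UNIV. f i *\<^sub>R (axis i 1 :: real^3)) = (\<chi> i. f i)" for f
    by (simp add: vec_eq_iff axis_def if_distrib cong: if_cong)
  moreover have "(\<chi> i. \<Sum>j\<in>UNIV. mat_exp (s t *\<^sub>R A) $ i $ j * h $ j) = mat_exp (s t *\<^sub>R A) *v h" for t
    by (simp add: matrix_vector_mult_def)
  moreover have "(\<chi> i. \<Sum>j\<in>UNIV. (A ** mat_exp (s t *\<^sub>R A)) $ i $ j * d * h $ j) = d *\<^sub>R (A *v (mat_exp (s t *\<^sub>R A) *v h))"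
    unfolding matrix_vector_mul_assoc by (simp add: vec_eq_iff matrix_vector_mult_def sum_distrib_left mult_ac)
  ultimately show ?thesis by simp
qed

lemma mat_exp_commute:
  assumes "A ** B = B ** A"
  shows "A ** mat_exp B = mat_exp B ** A"
proof -
  have "A ** mat_pow B n = mat_pow B n ** A" for n
  proof (induction n)
    case 0 then show ?case by (simp add: mat_pow_def)
  next
    case (Suc n)
    then show ?case by (metis assms mat_pow_Suc matrix_mul_assoc)
  qed
  moreover have "A ** (r *\<^sub>R N) = r *\<^sub>R (A ** N)" "(r *\<^sub>R N) ** A = r *\<^sub>R (N ** A)" for r and N :: "real^3^3"
    by (rule linear_scale[OF bounded_linear.linear[OF bounded_linear_matrix_mult(1)]],
        rule linear_scale[OF bounded_linear.linear[OF bounded_linear_matrix_mult(2)]])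
  ultimately have "A ** ((1 / fact n) *\<^sub>R mat_pow B n) = ((1 / fact n) *\<^sub>R mat_pow B n) ** A" for n by simp
  then show ?thesis
    using bounded_linear.sums[OF bounded_linear_matrix_mult(1)[of A] mat_exp_sums[of B]]
      bounded_linear.sums[OF bounded_linear_matrix_mult(2)[of A] mat_exp_sums[of B]]
    by (simp add: sums_unique2)
qed

text \<open>\<open>mat_exp_commute\<close> replaces one of two commuting matrices by its
  exponential; it is applied once for each factor.\<close>

lemma mat_exp_scaleR_commute:
  "mat_exp (s *\<^sub>R A) ** mat_exp (t *\<^sub>R A) = mat_exp (t *\<^sub>R A) ** mat_exp (s *\<^sub>R A)"
proof -
  have "(s *\<^sub>R A) ** (t *\<^sub>R A) = (t *\<^sub>R A) ** (s *\<^sub>R A)"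
    by (simp add: vec_eq_iff matrix_matrix_mult_def mult_ac)
  then have "(t *\<^sub>R A) ** mat_exp (s *\<^sub>R A) = mat_exp (s *\<^sub>R A) ** (t *\<^sub>R A)"
    by (intro mat_exp_commute) simp
  then show ?thesis by (intro mat_exp_commute) simp
qed

section \<open>Linearisation of the flow at a zero\<close>

lemma nonincreasing_on_halfline:
  fixes g :: "real \<Rightarrow> real"
  assumes "0 \<le> a" "a \<le> t" and d: "\<And>\<tau>. a \<le> \<tau> \<Longrightarrow> \<tau> \<le> t \<Longrightarrow> (g has_real_derivative g' \<tau>) (at \<tau> within {0..})"
    and neg: "\<And>\<tau>. a \<le> \<tau> \<Longrightarrow> \<tau> \<le> t \<Longrightarrow> g' \<tau> \<le> 0"
  shows "g t \<le> g a"
proof (rule DERIV_nonpos_imp_decreasing_open[OF assms(2)])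
  fix \<tau> assume \<tau>: "a < \<tau>" "\<tau> < t"
  \<comment> \<open>Inside the interval the derivative within the half-line is two-sided; at the
    ends, one of which may be 0, continuity suffices.\<close>
  then have "at \<tau> within {0..} = at \<tau>" using assms(1) by (intro at_within_interior) (simp add: interior_Ici[of _ "-1"])
  then show "\<exists>y. DERIV g \<tau> :> y \<and> y \<le> 0" using d[of \<tau>] neg[of \<tau>] \<tau> by auto
next
  have "continuous (at \<tau> within {a..t}) g" if "\<tau> \<in> {a..t}" for \<tau>
    by (rule continuous_within_subset[OF DERIV_continuous[OF d]]) (use that assms(1) in auto)
  then show "continuous_on {a..t} g" by (simp add: continuous_on_eq_continuous_within)
qed

text \<open>Writing \<open>s\<close> for the rescaled time, \<open>exp (- C s) * |Z|\<^sup>2\<close> is a Lyapunov function for the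
  difference \<open>Z\<close> between the flow displacement and its linearisation.\<close>

lemma flow_derivative_at_zero:
  fixes W :: "real^3 \<Rightarrow> real^3" and X :: "real^3 \<Rightarrow> real \<Rightarrow> real^3"
  assumes W: "(W has_derivative (\<lambda>h. M *v h)) (at x0)" "W x0 = 0"
    and L: "L \<ge> 0" "\<And>y. norm (W y) \<le> L * norm (y - x0)"
    and s: "\<And>\<tau>. \<tau> \<ge> 0 \<Longrightarrow> (s has_real_derivative \<phi> \<tau>) (at \<tau> within {0..})" "s 0 = 0"
    and \<phi>: "\<And>\<tau>. \<tau> \<ge> 0 \<Longrightarrow> \<phi> \<tau> \<ge> 0"
    and X: "\<And>a. X a 0 = a"
      "\<And>a \<tau>. \<tau> \<ge> 0 \<Longrightarrow> ((\<lambda>\<tau>. X a \<tau>) has_vector_derivative \<phi> \<tau> *\<^sub>R W (X a \<tau>)) (at \<tau> within {0..})"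
    and t: "t \<ge> 0"
  shows "((\<lambda>a. X a t) has_derivative (\<lambda>h. mat_exp (s t *\<^sub>R M) *v h)) (at x0)"
proof -
  have s_mono: "s \<sigma> \<le> s \<tau>" if "0 \<le> \<sigma>" "\<sigma> \<le> \<tau>" for \<sigma> \<tau>
  proof -
    have "- s \<tau> \<le> - s \<sigma>"
      by (rule nonincreasing_on_halfline[OF that, where g' = "\<lambda>\<tau>. - \<phi> \<tau>"]) (use that in \<open>auto intro!: DERIV_minus s(1) \<phi>\<close>)
    then show ?thesis by simp
  qed
  have s_nonneg: "s \<tau> \<ge> 0" if "0 \<le> \<tau>" for \<tau> using s_mono[OF order_refl that] s(2) by simp
  define Y where "Y a \<tau> = X a \<tau> - x0" for a \<tau>
  have Yd: "(Y a has_vector_derivative \<phi> \<tau> *\<^sub>R W (X a \<tau>)) (at \<tau> within {0..})" if "\<tau> \<ge> 0" for a \<tau>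
    unfolding Y_def using X(2)[OF that, of a] by (auto intro!: derivative_eq_intros)
  \<comment> \<open>A Gronwall estimate: the linear growth bound on \<open>W\<close> makes exp (- 2
    L s) |Y|^2 nonincreasing. It keeps trajectories that start near \<open>x0\<close> where the
    linearisation of \<open>W\<close> is accurate.\<close>
  have Yb: "norm (Y a \<tau>) \<le> exp (L * s \<tau>) * norm (a - x0)" if \<tau>: "\<tau> \<ge> 0" for a \<tau>
  proof -
    have "exp (- 2 * L * s \<tau>) * (Y a \<tau> \<bullet> Y a \<tau>) \<le> exp (- 2 * L * s 0) * (Y a 0 \<bullet> Y a 0)"
    proof (rule nonincreasing_on_halfline[OF order_refl \<tau>])
      fix r :: real assume r: "0 \<le> r"
      have d1: "((\<lambda>\<tau>. Y a \<tau> \<bullet> Y a \<tau>) has_real_derivative 2 * (\<phi> r * (W (X a r) \<bullet> Y a r))) (at r within {0..})"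
        using has_derivative_inner[OF Yd[OF r, unfolded has_vector_derivative_def] Yd[OF r, unfolded has_vector_derivative_def], of a a]
        unfolding has_field_derivative_def
        by (rule has_derivative_eq_rhs) (auto simp: fun_eq_iff inner_commute algebra_simps)
      have d2: "((\<lambda>\<tau>. exp (- 2 * L * s \<tau>)) has_real_derivative exp (- 2 * L * s r) * (- 2 * L * \<phi> r)) (at r within {0..})"
        using s(1)[OF r] by (auto intro!: derivative_eq_intros)
      show "((\<lambda>\<tau>. exp (- 2 * L * s \<tau>) * (Y a \<tau> \<bullet> Y a \<tau>)) has_real_derivative
         exp (- 2 * L * s r) * (2 * \<phi> r * (W (X a r) \<bullet> Y a r - L * (Y a r \<bullet> Y a r)))) (at r within {0..})"
        by (rule DERIV_cong[OF DERIV_mult[OF d2 d1]]) (simp add: algebra_simps)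
      have "W (X a r) \<bullet> Y a r \<le> norm (W (X a r)) * norm (Y a r)" by (rule norm_cauchy_schwarz)
      also have "\<dots> \<le> (L * norm (Y a r)) * norm (Y a r)"
        using L(2)[of "X a r"] by (intro mult_right_mono) (auto simp: Y_def)
      finally have "W (X a r) \<bullet> Y a r - L * (Y a r \<bullet> Y a r) \<le> 0"
        by (simp add: power2_norm_eq_inner[symmetric] power2_eq_square)
      then show "exp (- 2 * L * s r) * (2 * \<phi> r * (W (X a r) \<bullet> Y a r - L * (Y a r \<bullet> Y a r))) \<le> 0"
        using \<phi>[OF r] by (intro mult_nonneg_nonpos) auto
    qed
    then have "exp (2 * L * s \<tau>) * (exp (- 2 * L * s \<tau>) * (Y a \<tau> \<bullet> Y a \<tau>)) \<le> exp (2 * L * s \<tau>) * (Y a 0 \<bullet> Y a 0)"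
      by (intro mult_left_mono) (simp_all add: s)
    then have "(norm (Y a \<tau>))\<^sup>2 \<le> (exp (L * s \<tau>) * norm (a - x0))\<^sup>2"
      by (simp add: power2_norm_eq_inner power_mult_distrib Y_def X mult.assoc[symmetric] flip: exp_add exp_double)
    then show ?thesis by (rule power2_le_imp_le) simp
  qed
  \<comment> \<open>At \<open>a = x0\<close> the bound \<open>Yb\<close> is 0: the particle rests at
    the zero of \<open>W\<close>.\<close>
  have X0: "X x0 t = x0" using Yb[OF t, of x0] by (simp add: Y_def)
  obtain N where N: "N > 0" "\<And>v. norm (M *v v) \<le> norm v * N"
    using bounded_linear.pos_bounded[OF matrix_vector_mul_bounded_linear[of M]] by blast
  define B where "B = exp (2 * L * s t)"
  \<comment> \<open>\<open>2 * N\<close> absorbs the linear part of the error equation, and the 1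
    comes from 2 \<rho>.Z \<le> |\<rho>|^2 + |Z|^2. \<open>B\<close> is the square of the growth
    factor in \<open>Yb\<close> at time \<open>t\<close>, and \<open>K\<close> the constant that
    results after a square root.\<close>
  define C where "C = 2 * N + 1"
  define K where "K = sqrt (B * s t * exp (C * s t))"
  have K: "K \<ge> 0" using s_nonneg[OF t] by (simp add: K_def B_def)
  define R where "R a \<tau> = mat_exp (s \<tau> *\<^sub>R M) *v (a - x0)" for a \<tau>
  have main: "norm (Y a t - R a t) \<le> \<epsilon> * K * norm (a - x0)"
    if \<epsilon>: "\<epsilon> > 0" and \<delta>: "\<And>y. norm (y - x0) < \<delta> \<Longrightarrow> norm (W y - M *v (y - x0)) \<le> \<epsilon> * norm (y - x0)"
      and a: "exp (L * s t) * norm (a - x0) < \<delta>" for \<epsilon> \<delta> a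
  proof -
    define Z where "Z \<tau> = Y a \<tau> - R a \<tau>" for \<tau>
    have small: "norm (Y a \<tau>) \<le> exp (L * s t) * norm (a - x0)" if "0 \<le> \<tau>" "\<tau> \<le> t" for \<tau>
    proof -
      have "exp (L * s \<tau>) \<le> exp (L * s t)" using s_mono[OF that] L(1) by (simp add: mult_left_mono)
      then show ?thesis using Yb[OF that(1), of a] by (meson mult_right_mono norm_ge_zero order_trans)
    qed
    define g where "g \<tau> = exp (- C * s \<tau>) * (Z \<tau> \<bullet> Z \<tau>) - \<epsilon>\<^sup>2 * B * (norm (a - x0))\<^sup>2 * s \<tau>" for \<tau>
    define z where "z \<tau> = W (X a \<tau>) - M *v R a \<tau>" for \<tau>
    have "g t \<le> g 0"
    proof (rule nonincreasing_on_halfline[OF order_refl t])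
      fix r :: real assume r: "0 \<le> r" "r \<le> t"
      have "(Z has_vector_derivative \<phi> r *\<^sub>R z r) (at r within {0..})"
        unfolding Z_def[abs_def] R_def z_def scaleR_diff_right
        by (intro has_vector_derivative_diff Yd[OF r(1)] mat_exp_vec_deriv s(1)[OF r(1)])
      then have Zd: "(Z has_derivative (\<lambda>x. x *\<^sub>R \<phi> r *\<^sub>R z r)) (at r within {0..})"
        by (simp add: has_vector_derivative_def)
      have d1: "((\<lambda>\<tau>. Z \<tau> \<bullet> Z \<tau>) has_real_derivative 2 * (\<phi> r * (z r \<bullet> Z r))) (at r within {0..})"
        using has_derivative_inner[OF Zd Zd] unfolding has_field_derivative_def
        by (rule has_derivative_eq_rhs) (auto simp: fun_eq_iff inner_commute algebra_simps)
      have d2: "((\<lambda>\<tau>. exp (- C * s \<tau>)) has_real_derivative exp (- C * s r) * (- C * \<phi> r)) (at r within {0..})"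
        using s(1)[OF r(1)] by (auto intro!: derivative_eq_intros)
      have "((\<lambda>\<tau>. exp (- C * s \<tau>) * (Z \<tau> \<bullet> Z \<tau>)) has_real_derivative
          exp (- C * s r) * (\<phi> r * (2 * (z r \<bullet> Z r) - C * (Z r \<bullet> Z r)))) (at r within {0..})"
        by (rule DERIV_cong[OF DERIV_mult[OF d2 d1]]) (simp add: algebra_simps)
      then show "(g has_real_derivative exp (- C * s r) * (\<phi> r * (2 * (z r \<bullet> Z r) - C * (Z r \<bullet> Z r)))
          - \<epsilon>\<^sup>2 * B * (norm (a - x0))\<^sup>2 * \<phi> r) (at r within {0..})"
        unfolding g_def[abs_def] by (intro DERIV_diff DERIV_cmult s(1)[OF r(1)])
      define \<rho> where "\<rho> = W (X a r) - M *v Y a r"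
      have "norm \<rho> \<le> \<epsilon> * norm (Y a r)"
        using \<delta>[of "X a r"] small[OF r] a by (simp add: \<rho>_def Y_def)
      also have "\<dots> \<le> \<epsilon> * (exp (L * s t) * norm (a - x0))" using \<epsilon> small[OF r] by (intro mult_left_mono) auto
      finally have "(norm \<rho>)\<^sup>2 \<le> (\<epsilon> * (exp (L * s t) * norm (a - x0)))\<^sup>2" by (intro power_mono) auto
      also have "\<dots> = \<epsilon>\<^sup>2 * B * (norm (a - x0))\<^sup>2"
        by (simp add: B_def power_mult_distrib mult.assoc flip: exp_double)
      finally have \<rho>: "(norm \<rho>)\<^sup>2 \<le> \<epsilon>\<^sup>2 * B * (norm (a - x0))\<^sup>2" .
      \<comment> \<open>In rescaled time the error \<open>Z\<close> moves with the linear field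
        acting on \<open>Z\<close> itself plus the Taylor remainder \<open>\<rho>\<close> of
        \<open>W\<close> along the trajectory.\<close>
      have "z r = M *v Z r + \<rho>" by (simp add: z_def Z_def \<rho>_def matrix_vector_mult_diff_distrib)
      then have "2 * (z r \<bullet> Z r) = 2 * ((M *v Z r) \<bullet> Z r) + 2 * (\<rho> \<bullet> Z r)" by (simp add: inner_add_left)
      moreover have "(M *v Z r) \<bullet> Z r \<le> N * (Z r \<bullet> Z r)"
      proof -
        have "(M *v Z r) \<bullet> Z r \<le> norm (M *v Z r) * norm (Z r)" by (rule norm_cauchy_schwarz)
        also have "\<dots> \<le> (norm (Z r) * N) * norm (Z r)" by (intro mult_right_mono N) auto
        finally show ?thesis by (simp add: mult_ac flip: power2_norm_eq_inner power2_eq_square)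
      qed
      moreover have "2 * (\<rho> \<bullet> Z r) \<le> (norm \<rho>)\<^sup>2 + Z r \<bullet> Z r"
        using inner_ge_zero[of "\<rho> - Z r"]
        by (simp add: inner_diff_left inner_diff_right inner_commute power2_norm_eq_inner)
      ultimately have "2 * (z r \<bullet> Z r) - C * (Z r \<bullet> Z r) \<le> \<epsilon>\<^sup>2 * B * (norm (a - x0))\<^sup>2"
        using \<rho> by (simp add: C_def algebra_simps)
      then have "\<phi> r * (2 * (z r \<bullet> Z r) - C * (Z r \<bullet> Z r)) \<le> \<phi> r * (\<epsilon>\<^sup>2 * B * (norm (a - x0))\<^sup>2)"
        by (rule mult_left_mono) (rule \<phi>[OF r(1)])
      then have "exp (- C * s r) * (\<phi> r * (2 * (z r \<bullet> Z r) - C * (Z r \<bullet> Z r)))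
          \<le> exp (- C * s r) * (\<phi> r * (\<epsilon>\<^sup>2 * B * (norm (a - x0))\<^sup>2))"
        by (rule mult_left_mono) simp
      also have "\<dots> \<le> 1 * (\<phi> r * (\<epsilon>\<^sup>2 * B * (norm (a - x0))\<^sup>2))"
      proof (rule mult_right_mono)
        have "0 \<le> C * s r" using s_nonneg[OF r(1)] N(1) by (simp add: C_def)
        then show "exp (- C * s r) \<le> 1" by simp
        show "0 \<le> \<phi> r * (\<epsilon>\<^sup>2 * B * (norm (a - x0))\<^sup>2)" using \<phi>[OF r(1)] by (simp add: B_def)
      qed
      finally show "exp (- C * s r) * (\<phi> r * (2 * (z r \<bullet> Z r) - C * (Z r \<bullet> Z r)))
          - \<epsilon>\<^sup>2 * B * (norm (a - x0))\<^sup>2 * \<phi> r \<le> 0" by (simp add: mult_ac)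
    qed
    moreover have "Z 0 = 0" by (simp add: Z_def Y_def R_def X s mat_exp_0)
    ultimately have "exp (- C * s t) * (Z t \<bullet> Z t) \<le> \<epsilon>\<^sup>2 * B * (norm (a - x0))\<^sup>2 * s t"
      by (simp add: g_def s)
    then have "exp (C * s t) * (exp (- C * s t) * (Z t \<bullet> Z t)) \<le> exp (C * s t) * (\<epsilon>\<^sup>2 * B * (norm (a - x0))\<^sup>2 * s t)"
      by (rule mult_left_mono) simp
    moreover have "K\<^sup>2 = B * s t * exp (C * s t)" using s_nonneg[OF t] by (simp add: K_def B_def)
    ultimately have "(norm (Z t))\<^sup>2 \<le> (\<epsilon> * K * norm (a - x0))\<^sup>2"
      by (simp add: power2_norm_eq_inner power_mult_distrib mult_ac flip: mult.assoc[of "exp _" "exp _"] exp_add)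
    then show ?thesis unfolding Z_def by (rule power2_le_imp_le) (use \<epsilon> K in simp)
  qed
  show ?thesis unfolding has_derivative_at_alt
  proof (intro conjI allI impI)
    show "bounded_linear (\<lambda>h. mat_exp (s t *\<^sub>R M) *v h)" by (rule matrix_vector_mul_bounded_linear)
    fix e :: real assume e: "e > 0"
    \<comment> \<open>The added 1 keeps the quotient meaningful when \<open>K = 0\<close>, as
      happens at \<open>t = 0\<close>.\<close>
    define \<epsilon> where "\<epsilon> = e / (K + 1)"
    have \<epsilon>: "\<epsilon> > 0" using e K by (simp add: \<epsilon>_def)
    obtain \<delta> where \<delta>: "\<delta> > 0" "\<And>y. norm (y - x0) < \<delta> \<Longrightarrow> norm (W y - M *v (y - x0)) \<le> \<epsilon> * norm (y - x0)"
      using W \<epsilon> unfolding has_derivative_at_alt by auto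
    show "\<exists>d>0. \<forall>y. norm (y - x0) < d \<longrightarrow> norm (X y t - X x0 t - mat_exp (s t *\<^sub>R M) *v (y - x0)) \<le> e * norm (y - x0)"
    \<comment> \<open>Dividing by the growth factor in \<open>Yb\<close> keeps the trajectories
      within \<delta> of \<open>x0\<close> up to time \<open>t\<close>.\<close>
    proof (intro exI[of _ "\<delta> / exp (L * s t)"] conjI allI impI)
      show "\<delta> / exp (L * s t) > 0" using \<delta>(1) by simp
      fix a assume "norm (a - x0) < \<delta> / exp (L * s t)"
      then have "exp (L * s t) * norm (a - x0) < \<delta>" by (simp add: field_simps)
      then have "norm (Y a t - R a t) \<le> \<epsilon> * K * norm (a - x0)" using main[OF \<epsilon> \<delta>(2)] by blast
      also have "\<epsilon> * K \<le> e" using e K by (simp add: \<epsilon>_def field_simps)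
      then have "\<epsilon> * K * norm (a - x0) \<le> e * norm (a - x0)" by (rule mult_right_mono) simp
      finally show "norm (X a t - X x0 t - mat_exp (s t *\<^sub>R M) *v (a - x0)) \<le> e * norm (a - x0)"
        by (simp add: X0 Y_def R_def)
    qed
  qed
qed

text \<open>A finite sum of plane waves has a bounded gradient, each wave contributing at most
  \<open>norm k\<close> times the lengths of its two amplitudes.\<close>

lemma E_plus_lipschitz:
  assumes lam: "lam > 0" and W: "W \<in> E_plus lam"
  shows "\<exists>L\<ge>0. \<forall>x y. norm (W y - W x) \<le> L * norm (y - x)"
proof -
  obtain A where A: "W = field lam A" using E_plus_imp_field[OF lam W] .
  define L where "L = (\<Sum>k\<in>freqs lam. norm k * (norm (A k) + norm (cross3 k (A k)) / lam))"
  have L: "L \<ge> 0" unfolding L_def using lam by (intro sum_nonneg) auto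
  have "norm (W y - W x) \<le> L * norm (y - x)" for x y
    unfolding A
  proof (rule differentiable_bound[OF convex_UNIV field_has_derivative])
    fix x
    show "onorm (\<lambda>h. \<Sum>k\<in>freqs lam. (k \<bullet> h) *\<^sub>R wave' lam k (A k) x) \<le> L"
    proof (rule onorm_le)
      fix h :: "real^3"
      have "norm (\<Sum>k\<in>freqs lam. (k \<bullet> h) *\<^sub>R wave' lam k (A k) x)
        \<le> (\<Sum>k\<in>freqs lam. (norm k * norm h) * (norm (A k) + norm (cross3 k (A k)) / lam))"
      proof (rule sum_norm_le)
        fix k
        have "norm (wave' lam k (A k) x) \<le> norm (- sin (k \<bullet> x) *\<^sub>R A k) + norm ((cos (k \<bullet> x) / lam) *\<^sub>R cross3 k (A k))"
          unfolding wave'_def by (rule norm_triangle_ineq4)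
        also have "\<dots> \<le> 1 * norm (A k) + (1 / lam) * norm (cross3 k (A k))"
          using lam by (intro add_mono) (auto intro!: mult_right_mono divide_right_mono mult_left_le_one_le simp: abs_divide)
        finally show "norm ((k \<bullet> h) *\<^sub>R wave' lam k (A k) x) \<le> (norm k * norm h) * (norm (A k) + norm (cross3 k (A k)) / lam)"
          using Cauchy_Schwarz_ineq2[of k h] by (simp add: mult_mono)
      qed
      also have "\<dots> = L * norm h" by (simp add: L_def sum_distrib_left mult_ac)
      finally show "norm (\<Sum>k\<in>freqs lam. (k \<bullet> h) *\<^sub>R wave' lam k (A k) x) \<le> L * norm h" .
    qed
  qed auto
  then show ?thesis using L by blast
qed

text \<open>Since \<open>u t\<close> is a positive scalar function of time times \<open>u 0\<close>,
  every trajectory follows the steady field \<open>u 0\<close> with clock \<open>s\<close>; the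
  generator \<open>M\<close> is the gradient of \<open>u 0\<close> at the zero.\<close>

lemma deformation_gradient:
  assumes sol: "E_plus_solution \<nu> lam u" and X: "lagrangian_flow u X" and x0: "u 0 x0 = 0"
  shows "\<exists>M. \<forall>t\<ge>0. (\<lambda>a. X a t) differentiable (at x0) \<and>
    jacobian (\<lambda>a. X a t) (at x0) \<in> {mat_exp (s *\<^sub>R M) | s. s \<in> UNIV}"
proof -
  have lam: "lam > 0" and W: "u 0 \<in> E_plus lam" using sol by (auto simp: E_plus_solution_def)
  define \<kappa> where "\<kappa> = \<nu> * lam\<^sup>2"
  \<comment> \<open>The integral of exp (- \<kappa> t) from 0; \<open>\<kappa> = 0\<close> is the
    Euler case, where the clock is \<open>t\<close> itself.\<close>
  define s where "s t = (if \<kappa> = 0 then t else (1 - exp (- \<kappa> * t)) / \<kappa>)" for t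
  have s: "(s has_real_derivative exp (- \<kappa> * t)) (at t within {0..})" for t
    unfolding s_def[abs_def] by (cases "\<kappa> = 0") (auto intro!: derivative_eq_intros)
  obtain L where L: "L \<ge> 0" "\<forall>x y. norm (u 0 y - u 0 x) \<le> L * norm (y - x)"
    using E_plus_lipschitz[OF lam W] by blast
  define M where "M = jacobian (u 0) (at x0)"
  have d: "((\<lambda>a. X a t) has_derivative (\<lambda>h. mat_exp (s t *\<^sub>R M) *v h)) (at x0)" if t: "t \<ge> 0" for t
  proof (rule flow_derivative_at_zero[where W = "u 0" and \<phi> = "\<lambda>t. exp (- \<kappa> * t)", OF _ x0 L(1) _ s])
    show "(u 0 has_derivative (*v) M) (at x0)" unfolding M_def by (rule E_plus_C1(1)[OF W])
    show "norm (u 0 y) \<le> L * norm (y - x0)" for y using L(2)[rule_format, of y x0] x0 by simp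
    show "s 0 = 0" by (simp add: s_def)
    show "X a 0 = a" for a using X by (simp add: lagrangian_flow_def)
    show "((\<lambda>\<tau>. X a \<tau>) has_vector_derivative exp (- \<kappa> * \<tau>) *\<^sub>R u 0 (X a \<tau>)) (at \<tau> within {0..})" if "\<tau> \<ge> 0" for a \<tau>
    proof -
      have "((\<lambda>\<tau>. X a \<tau>) has_vector_derivative u \<tau> (X a \<tau>)) (at \<tau> within {0..})"
        using X that by (simp add: lagrangian_flow_def)
      then show ?thesis
        unfolding E_plus_solution_decay[OF sol that] by (simp add: \<kappa>_def scaleR_fun_apply)
    qed
  qed (use t in auto)
  show ?thesis
  proof (intro exI[of _ M] allI impI)
    fix t :: real assume "t \<ge> 0"
    note D = d[OF this]
    have "jacobian (\<lambda>a. X a t) (at x0) = mat_exp (s t *\<^sub>R M)"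
      unfolding jacobian_def frechet_derivative_at[OF D, symmetric] by simp
    then show "(\<lambda>a. X a t) differentiable (at x0) \<and>
      jacobian (\<lambda>a. X a t) (at x0) \<in> {mat_exp (s *\<^sub>R M) | s. s \<in> UNIV}"
      using D by (auto simp: differentiable_def)
  qed
qed

text \<open>\<open>F1\<close> is diagonal with distinct entries, so it commutes with diagonal
  matrices alone, and \<open>F2\<close> is not diagonal. The form of \<open>F2\<close> is v1^2 + (v1
  + v2)^2 + v3^2.\<close>

lemma SPD1_noncommuting:
  obtains F1 F2 where "F1 \<in> SPD1" "F2 \<in> SPD1" "F1 ** F2 \<noteq> F2 ** F1"
proof
  define F1 :: "real^3^3" where "F1 = vector [vector [2, 0, 0], vector [0, 1/2, 0], vector [0, 0, 1]]"
  define F2 :: "real^3^3" where "F2 = vector [vector [2, 1, 0], vector [1, 1, 0], vector [0, 0, 1]]"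
  have nz: "v $ 1 \<noteq> 0 \<or> v $ 2 \<noteq> 0 \<or> v $ 3 \<noteq> 0" if "v \<noteq> 0" for v :: "real^3"
    using that by (auto simp: vec_eq_iff forall_3)
  have "0 < v \<bullet> (F1 *v v)" if "v \<noteq> 0" for v
  proof -
    have "v \<bullet> (F1 *v v) = 2 * (v $ 1)\<^sup>2 + (v $ 2)\<^sup>2 / 2 + (v $ 3)\<^sup>2"
      by (simp add: F1_def matrix_vector_mult_def inner_vec_def sum_3 power2_eq_square)
    moreover have "0 < (v $ 1)\<^sup>2 \<or> 0 < (v $ 2)\<^sup>2 \<or> 0 < (v $ 3)\<^sup>2" using nz[OF that] by simp
    ultimately show ?thesis
      using zero_le_power2[of "v $ 1"] zero_le_power2[of "v $ 2"] zero_le_power2[of "v $ 3"] by linarith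
  qed
  then show "F1 \<in> SPD1"
    by (simp add: SPD1_def) (simp add: F1_def transpose_def vec_eq_iff forall_3 det_3)
  have "0 < v \<bullet> (F2 *v v)" if "v \<noteq> 0" for v
  proof -
    have "v \<bullet> (F2 *v v) = (v $ 1)\<^sup>2 + (v $ 1 + v $ 2)\<^sup>2 + (v $ 3)\<^sup>2"
      by (simp add: F2_def matrix_vector_mult_def inner_vec_def sum_3 power2_eq_square algebra_simps)
    moreover have "0 < (v $ 1)\<^sup>2 \<or> 0 < (v $ 1 + v $ 2)\<^sup>2 \<or> 0 < (v $ 3)\<^sup>2" using nz[OF that] by auto
    ultimately show ?thesis
      using zero_le_power2[of "v $ 1"] zero_le_power2[of "v $ 1 + v $ 2"] zero_le_power2[of "v $ 3"] by linarith
  qed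
  then show "F2 \<in> SPD1"
    by (simp add: SPD1_def) (simp add: F2_def transpose_def vec_eq_iff forall_3 det_3)
  have "(F1 ** F2) $ 1 $ 2 \<noteq> (F2 ** F1) $ 1 $ 2"
    by (simp add: F1_def F2_def matrix_matrix_mult_def sum_3)
  then show "F1 ** F2 \<noteq> F2 ** F1" by metis
qed

theorem proposition2p10:
  shows
   "(subspace (E_plus (sqrt 2)) \<and> dim (E_plus (sqrt 2)) = 12 \<and>
     (\<forall>x1 x2. \<not> same_torus_point x1 x2 \<longrightarrow>
       (\<exists>H1\<in>Sym0. \<exists>H2\<in>Sym0. \<not> (\<exists>W\<in>E_plus (sqrt 2).
          W x1 = 0 \<and> W x2 = 0 \<and> jacobian W (at x1) = H1 \<and> jacobian W (at x2) = H2))))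
    \<and>
    (\<forall>m::nat. m \<ge> 1 \<longrightarrow>
      (\<forall>W\<in>E_plus (sqrt (real m)). \<forall>x.
         W (x + pi *\<^sub>R vec 1) = (-1) ^ m *\<^sub>R W x \<and>
         jacobian W (at (x + pi *\<^sub>R vec 1)) = (-1) ^ m *\<^sub>R jacobian W (at x)) \<and>
      (\<forall>x. \<not> (\<forall>j1\<in>jet_targets. \<forall>j2\<in>jet_targets. \<exists>W\<in>E_plus (sqrt (real m)).
               first_jet W x = j1 \<and> first_jet W (x + pi *\<^sub>R vec 1) = j2)) \<and>
      (\<forall>x. two_point_jet x (x + pi *\<^sub>R vec 1) ` E_plus (sqrt (real m)) \<subset> jet_targets \<times> jet_targets))
    \<and>
    ((\<forall>\<nu> lam u. E_plus_solution \<nu> lam u \<longrightarrow>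
       (\<nu> = 0 \<longrightarrow> (\<forall>t\<ge>0. u t = u 0)) \<and>
       (\<nu> > 0 \<longrightarrow> (\<forall>t\<ge>0. u t = exp (- \<nu> * lam\<^sup>2 * t) *\<^sub>R u 0)) \<and>
       (\<forall>X x0. lagrangian_flow u X \<and> u 0 x0 = 0 \<longrightarrow>
          (\<exists>M. \<forall>t\<ge>0. (\<lambda>a. X a t) differentiable (at x0) \<and>
             jacobian (\<lambda>a. X a t) (at x0) \<in> {mat_exp (s *\<^sub>R M) | s. s \<in> UNIV})))
     \<and>
     (\<forall>t1 t2. t1 > 0 \<and> t2 > 0 \<and> t1 \<noteq> t2 \<longrightarrow>
       (\<exists>F1\<in>SPD1. \<exists>F2\<in>SPD1. \<not> (\<exists>\<nu> lam u X x0.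
          E_plus_solution \<nu> lam u \<and> lagrangian_flow u X \<and> u 0 x0 = 0 \<and>
          jacobian (\<lambda>a. X a t1) (at x0) = F1 \<and> jacobian (\<lambda>a. X a t2) (at x0) = F2))))"
  (is "_ \<and> ?part2 \<and> ?evolution \<and> ?unrealizable")
proof (intro conjI)
  show "subspace (E_plus (sqrt 2))" by (rule subspace_E_plus) simp
  show "dim (E_plus (sqrt 2)) = 12" using dim_E_plus[of "sqrt 2"] by (simp add: card_freqs_sqrt2)
  show "\<forall>x1 x2. \<not> same_torus_point x1 x2 \<longrightarrow>
       (\<exists>H1\<in>Sym0. \<exists>H2\<in>Sym0. \<not> (\<exists>W\<in>E_plus (sqrt 2).
          W x1 = 0 \<and> W x2 = 0 \<and> jacobian W (at x1) = H1 \<and> jacobian W (at x2) = H2))"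
    using E_plus_sqrt2_no_interpolation by blast
  show ?part2
  proof (intro allI impI conjI ballI)
    fix m :: nat assume m: "1 \<le> m"
    fix x
    show "W (x + pi *\<^sub>R vec 1) = (-1) ^ m *\<^sub>R W x"
      "jacobian W (at (x + pi *\<^sub>R vec 1)) = (-1) ^ m *\<^sub>R jacobian W (at x)"
      if "W \<in> E_plus (sqrt (real m))" for W
      by (rule E_plus_half_period_shift[OF m that])+
    obtain j1 j2 where j: "j1 \<in> jet_targets" "j2 \<in> jet_targets"
      "\<forall>W\<in>E_plus (sqrt (real m)). first_jet W x = j1 \<longrightarrow> first_jet W (x + pi *\<^sub>R vec 1) \<noteq> j2"
      using half_period_jets_dependent[OF m, of x] by blast
    then show "\<not> (\<forall>j1\<in>jet_targets. \<forall>j2\<in>jet_targets. \<exists>W\<in>E_plus (sqrt (real m)).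
        first_jet W x = j1 \<and> first_jet W (x + pi *\<^sub>R vec 1) = j2)" by blast
    have "(j1, j2) \<in> jet_targets \<times> jet_targets" using j by blast
    moreover have "(j1, j2) \<notin> two_point_jet x (x + pi *\<^sub>R vec 1) ` E_plus (sqrt (real m))"
      using j(3) unfolding two_point_jet_def by blast
    moreover have "two_point_jet x (x + pi *\<^sub>R vec 1) ` E_plus (sqrt (real m)) \<subseteq> jet_targets \<times> jet_targets"
      using m by (intro image_subsetI two_point_jet_in_targets) auto
    ultimately show "two_point_jet x (x + pi *\<^sub>R vec 1) ` E_plus (sqrt (real m)) \<subset> jet_targets \<times> jet_targets"
      by blast
  qed
  show ?evolution
  proof (intro allI impI conjI)
    fix \<nu> lam u assume sol: "E_plus_solution \<nu> lam u"
    show "u t = u 0" if "\<nu> = 0" "t \<ge> 0" for t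
      using E_plus_solution_decay[OF sol \<open>t \<ge> 0\<close>] \<open>\<nu> = 0\<close> by simp
    show "u t = exp (- \<nu> * lam\<^sup>2 * t) *\<^sub>R u 0" if "t \<ge> 0" for t
      by (rule E_plus_solution_decay[OF sol that])
    fix X x0 assume X: "lagrangian_flow u X \<and> u 0 x0 = 0"
    show "\<exists>M. \<forall>t\<ge>0. (\<lambda>a. X a t) differentiable (at x0) \<and>
        jacobian (\<lambda>a. X a t) (at x0) \<in> {mat_exp (s *\<^sub>R M) | s. s \<in> UNIV}"
      by (rule deformation_gradient[OF sol conjunct1[OF X] conjunct2[OF X]])
  qed
  show ?unrealizable
  proof (intro allI impI)
    fix t1 t2 :: real assume t: "t1 > 0 \<and> t2 > 0 \<and> t1 \<noteq> t2"
    \<comment> \<open>The same pair defeats all times, viscosities, eigenvalues and zeros at once,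
      since the obstruction is its failure to commute.\<close>
    obtain F1 F2 where F: "F1 \<in> SPD1" "F2 \<in> SPD1" "F1 ** F2 \<noteq> F2 ** F1" by (rule SPD1_noncommuting)
    have "F1 ** F2 = F2 ** F1"
      if sol: "E_plus_solution \<nu> lam u" "lagrangian_flow u X" "u 0 x0 = 0"
        and eq: "jacobian (\<lambda>a. X a t1) (at x0) = F1" "jacobian (\<lambda>a. X a t2) (at x0) = F2" for \<nu> lam u X x0
    proof -
      obtain M where M: "\<forall>t\<ge>0. (\<lambda>a. X a t) differentiable (at x0) \<and>
        jacobian (\<lambda>a. X a t) (at x0) \<in> {mat_exp (s *\<^sub>R M) | s. s \<in> UNIV}"
        by (rule exE[OF deformation_gradient[OF sol]])
      obtain r s where "F1 = mat_exp (r *\<^sub>R M)" "F2 = mat_exp (s *\<^sub>R M)"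
        using M[rule_format, of t1] M[rule_format, of t2] t eq by auto
      then show ?thesis using mat_exp_scaleR_commute by simp
    qed
    then show "\<exists>F1\<in>SPD1. \<exists>F2\<in>SPD1. \<not> (\<exists>\<nu> lam u X x0.
          E_plus_solution \<nu> lam u \<and> lagrangian_flow u X \<and> u 0 x0 = 0 \<and>
          jacobian (\<lambda>a. X a t1) (at x0) = F1 \<and> jacobian (\<lambda>a. X a t2) (at x0) = F2)"
      using F by blast
  qed
qed

end
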